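(* Consider the charged-particle dynamics $$\dot x=v,\qquad \dot v=v\times\frac{B(x)}{\varepsilon}+E(x),\qquad x(0)=x_0,\ v(0)=v_0,$$ in $\mathbb{R}^3$ with a general strong magnetic field $\frac1\varepsilon B(x)$, $0<\varepsilon\ll1$, and let $T>0$. Assume: a) the initial values $x_0,v_0$ are bounded by an $\varepsilon$-independent constant $M$; b) there is a bounded set $K$, independent of $\varepsilon$, such that the exact solution satisfies $x(t)\in K$ for $0\le t\le T$; c) the step size $h$ satisfies $h\le C\varepsilon$, and the non-resonance condition $$\Big|\operatorname{sinc}\Big(k\frac{h}{2\varepsilon}|B(x(t))|\Big)\Big|\ge c>0\qquad\text{for } k=1,2$$ holds along the exact solution for $0\le t\le T$. Let $(x^n,v^n)$ be the numerical solution given by any one of the three splitting schemes S1-AVF, S1-SV, S1-VP (defined in the context) with step size $h$, $x^0=x_0$, $v^0=v_0$, and let $t_n=nh$. Then the global errors satisfy $$|x^n-x(t_n)|\lesssim\varepsilon,\qquad |v^n_\parallel-v_\parallel(t_n)|\lesssim\varepsilon,\qquad |v^n-v(t_n)|\lesssim1,\qquad 0\le n\le T/h,$$ where the constants depend on $M,K,C,c$ and on bounds of derivatives of $B$ and $E$ (and on $T$), but not on $\varepsilon$, $h$ or $n$.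
   Context: $E=-\nabla U$ for a scalar potential $U$; $B$ and $E$ are assumed sufficiently smooth. $\operatorname{sinc}(y)=\sin(y)/y$ (with $\operatorname{sinc}(0)=1$). The notation $a\lesssim b$ means $a\le C'b$ for a constant $C'>0$ independent of $h$, $n$, $\varepsilon$. For $B=(b_1,b_2,b_3)^\top$, $$\widehat B(x)=\begin{pmatrix}0&b_3(x)&-b_2(x)\\ -b_3(x)&0&b_1(x)\\ b_2(x)&-b_1(x)&0\end{pmatrix},$$ so that $\widehat B(x)v=v\times B(x)$. The parallel components of the velocities are $v_\parallel(t)=\frac{B(x(t))}{|B(x(t))|}\big(\frac{B(x(t))}{|B(x(t))|}\cdot v(t)\big)$ and $v^n_\parallel=\frac{B(x^n)}{|B(x^n)|}\big(\frac{B(x^n)}{|B(x^n)|}\cdot v^n\big)$. The three schemes are, for $n\ge0$: S1-AVF (energy-preserving, implicit): $x^{n+1}=x^{n}+h\,e^{\frac{h}{\varepsilon}\widehat B(x^n)}v^{n}+\frac{h^2}{2}\int_{0}^1E(\rho x^{n}+(1-\rho)x^{n+1})\,d\rho$, $\ v^{n+1}=e^{\frac{h}{\varepsilon}\widehat B(x^n)}v^{n}+h\int_{0}^1E(\rho x^{n}+(1-\rho)x^{n+1})\,d\rho$. S1-SV (explicit): $x^{n+1}=x^{n}+h\,e^{\frac{h}{\varepsilon}\widehat B(x^n)}v^{n}+\frac{h^2}{2}E(x^{n})$, $\ v^{n+1}=e^{\frac{h}{\varepsilon}\widehat B(x^n)}v^{n}+\frac h2[E(x^{n})+E(x^{n+1})]$.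 S1-VP (volume-preserving): $v^{n+1}=e^{\frac{h}{\varepsilon}\widehat B(x^n)}v^{n}+h\varphi_1\big(\frac h\varepsilon\widehat B(x^n)\big)E(x^n)$, $\ x^{n+1}=x^n+hv^{n+1}$, where $\varphi_1(z)=(e^z-1)/z$ (as an entire function, $\varphi_1(0)=1$).
   Formalization: For the implicit scheme S1-AVF, x^{n+1} is taken to be the solution nearest to x^n (other solutions can lie at distance of order h^{-2}, where the bounds fail), and |B| is assumed bounded below by a positive constant on K, on which the constants also depend, so that the parallel velocity is defined. *)

theory Defs
  imports "HOL-Analysis.Analysis" "HOL-Probability.Sinc_Integral"
begin

(* The product "*" that the library puts on real^3^3 is componentwise, so its "exp"
   and "^" are not available for matrices; powers and power series are taken
   with respect to "**". *)

primrec mat_pow :: "real^3^3 \<Rightarrow> nat \<Rightarrow> real^3^3" where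
  "mat_pow A 0 = mat 1"
| "mat_pow A (Suc k) = A ** mat_pow A k"

definition mat_exp :: "real^3^3 \<Rightarrow> real^3^3" where
  "mat_exp A = (\<Sum>k. (1 / fact k) *\<^sub>R mat_pow A k)"

(* phi_1(z) = (e^z - 1) / z is entire, with Taylor coefficients 1/(k+1)!; see phi1_series. *)
definition mat_phi1 :: "real^3^3 \<Rightarrow> real^3^3" where
  "mat_phi1 A = (\<Sum>k. (1 / fact (Suc k)) *\<^sub>R mat_pow A k)"

lemma phi1_series:
  fixes z :: complex
  assumes "z \<noteq> 0"
  shows "(\<lambda>k. z ^ k /\<^sub>R fact (Suc k)) sums ((exp z - 1) / z)"
proof -
  have "(\<lambda>k. z ^ k /\<^sub>R fact k) sums exp z"
    by (rule exp_converges)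
  then have "(\<lambda>k. z ^ Suc k /\<^sub>R fact (Suc k)) sums (exp z - 1)"
    using sums_Suc_iff[of "\<lambda>k. z ^ k /\<^sub>R fact k"] by simp
  then have "(\<lambda>k. (z ^ Suc k /\<^sub>R fact (Suc k)) / z) sums ((exp z - 1) / z)"
    by (rule sums_divide)
  moreover have "(z ^ Suc k /\<^sub>R fact (Suc k)) / z = z ^ k /\<^sub>R fact (Suc k)" for k
    using assms by (simp add: field_simps)
  ultimately show ?thesis by simp
qed

definition hat :: "real^3 \<Rightarrow> real^3^3" where
  "hat b = vector [vector [0, b$3, - b$2],
                   vector [- b$3, 0, b$1],
                   vector [b$2, - b$1, 0]]"

lemma hat_mult: "hat b *v v = cross3 v b"
  by (simp add: hat_def cross3_def vec_eq_iff matrix_vector_mult_def sum_3 forall_3 algebra_simps)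

definition parallel_part :: "(real^3 \<Rightarrow> real^3) \<Rightarrow> real^3 \<Rightarrow> real^3 \<Rightarrow> real^3" where
  "parallel_part B x v =
     (let b = B x /\<^sub>R norm (B x) in (b \<bullet> v) *\<^sub>R b)"

definition cpd_solution ::
  "(real^3 \<Rightarrow> real^3) \<Rightarrow> (real^3 \<Rightarrow> real^3) \<Rightarrow> real \<Rightarrow> real \<Rightarrow> real^3 \<Rightarrow> real^3 \<Rightarrow>
   (real \<Rightarrow> real^3) \<Rightarrow> (real \<Rightarrow> real^3) \<Rightarrow> bool" where
  "cpd_solution B E \<epsilon> T x0 v0 x v \<longleftrightarrow>
     x 0 = x0 \<and> v 0 = v0 \<and>
     (\<forall>t\<in>{0..T}.
        (x has_vector_derivative v t) (at t within {0..T}) \<and>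
        (v has_vector_derivative cross3 (v t) ((1 / \<epsilon>) *\<^sub>R B (x t)) + E (x t)) (at t within {0..T}))"

definition avf_mean :: "(real^3 \<Rightarrow> real^3) \<Rightarrow> real^3 \<Rightarrow> real^3 \<Rightarrow> real^3" where
  "avf_mean E x y = integral {0..1} (\<lambda>\<rho>. E (\<rho> *\<^sub>R x + (1 - \<rho>) *\<^sub>R y))"

definition avf_position ::
  "(real^3 \<Rightarrow> real^3) \<Rightarrow> (real^3 \<Rightarrow> real^3) \<Rightarrow> real \<Rightarrow> real \<Rightarrow>
   real^3 \<Rightarrow> real^3 \<Rightarrow> real^3 \<Rightarrow> bool" where
  "avf_position B E \<epsilon> h x v y \<longleftrightarrow>
     y = x + h *\<^sub>R (mat_exp ((h / \<epsilon>) *\<^sub>R hat (B x)) *v v) + (h\<^sup>2 / 2) *\<^sub>R avf_mean E x y"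

(* The equation for the new position is implicit. If E is not globally Lipschitz it can have
   spurious roots at a distance of order h^(-2) from x, for every small h (e.g. for
   U(x) = -(x$1)^3), and following one of these does not approximate the flow. As usual for
   implicit schemes, the numerical solution takes the root nearest to the current position;
   the last conjunct is vacuous whenever the root is unique. *)
definition S1_AVF ::
  "(real^3 \<Rightarrow> real^3) \<Rightarrow> (real^3 \<Rightarrow> real^3) \<Rightarrow> real \<Rightarrow> real \<Rightarrow>
   real^3 \<Rightarrow> real^3 \<Rightarrow> real^3 \<Rightarrow> real^3 \<Rightarrow> bool" where
  "S1_AVF B E \<epsilon> h x v x' v' \<longleftrightarrow>
     avf_position B E \<epsilon> h x v x' \<and>
     v' = mat_exp ((h / \<epsilon>) *\<^sub>R hat (B x)) *v v + h *\<^sub>R avf_mean E x x' \<and>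
     (\<forall>y. avf_position B E \<epsilon> h x v y \<longrightarrow> dist x x' \<le> dist x y)"

definition S1_SV ::
  "(real^3 \<Rightarrow> real^3) \<Rightarrow> (real^3 \<Rightarrow> real^3) \<Rightarrow> real \<Rightarrow> real \<Rightarrow>
   real^3 \<Rightarrow> real^3 \<Rightarrow> real^3 \<Rightarrow> real^3 \<Rightarrow> bool" where
  "S1_SV B E \<epsilon> h x v x' v' \<longleftrightarrow>
     x' = x + h *\<^sub>R (mat_exp ((h / \<epsilon>) *\<^sub>R hat (B x)) *v v) + (h\<^sup>2 / 2) *\<^sub>R E x \<and>
     v' = mat_exp ((h / \<epsilon>) *\<^sub>R hat (B x)) *v v + (h / 2) *\<^sub>R (E x + E x')"

definition S1_VP ::
  "(real^3 \<Rightarrow> real^3) \<Rightarrow> (real^3 \<Rightarrow> real^3) \<Rightarrow> real \<Rightarrow> real \<Rightarrow>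
   real^3 \<Rightarrow> real^3 \<Rightarrow> real^3 \<Rightarrow> real^3 \<Rightarrow> bool" where
  "S1_VP B E \<epsilon> h x v x' v' \<longleftrightarrow>
     v' = mat_exp ((h / \<epsilon>) *\<^sub>R hat (B x)) *v v
          + h *\<^sub>R (mat_phi1 ((h / \<epsilon>) *\<^sub>R hat (B x)) *v E x) \<and>
     x' = x + h *\<^sub>R v'"

(* Only the steps that end in [0,T] are constrained, so that an implicit scheme is not
   required to be solvable after time T. *)
definition numerical_solution ::
  "(real^3 \<Rightarrow> real^3 \<Rightarrow> real^3 \<Rightarrow> real^3 \<Rightarrow> bool) \<Rightarrow> real \<Rightarrow> real \<Rightarrow> real^3 \<Rightarrow> real^3 \<Rightarrow>
   (nat \<Rightarrow> real^3) \<Rightarrow> (nat \<Rightarrow> real^3) \<Rightarrow> bool" where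
  "numerical_solution step h T x0 v0 X V \<longleftrightarrow>
     X 0 = x0 \<and> V 0 = v0 \<and>
     (\<forall>n. real (Suc n) \<le> T / h \<longrightarrow> step (X n) (V n) (X (Suc n)) (V (Suc n)))"

primrec C_order :: "nat \<Rightarrow> (real^3 \<Rightarrow> real^3) \<Rightarrow> bool" where
  "C_order 0 f \<longleftrightarrow> continuous_on UNIV f"
| "C_order (Suc k) f \<longleftrightarrow>
     (\<forall>x. f differentiable (at x)) \<and>
     (\<forall>u. C_order k (\<lambda>x. frechet_derivative f (at x) u))"

(* All derivatives of f of order at most k, including f itself, have norm at most L on S
   as multilinear maps: the recursion evaluates them at arbitrary vectors of the unit ball. *)
primrec derivs_bounded :: "nat \<Rightarrow> real \<Rightarrow> (real^3) set \<Rightarrow> (real^3 \<Rightarrow> real^3) \<Rightarrow> bool" where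
  "derivs_bounded 0 L S f \<longleftrightarrow> (\<forall>x\<in>S. norm (f x) \<le> L)"
| "derivs_bounded (Suc k) L S f \<longleftrightarrow>
     (\<forall>x\<in>S. norm (f x) \<le> L) \<and>
     (\<forall>u. norm u \<le> 1 \<longrightarrow> derivs_bounded k L S (\<lambda>x. frechet_derivative f (at x) u))"

end

(* Let b = B/|B| and theta = h|B|/eps. In one step of each scheme the velocity is first rotated by
   theta about b(x), and the remaining changes are O(h). The slow variables are the position x, the
   parallel velocity u = b(x).v and the energy |v|^2/2. Their increments contain oscillating terms,
   first and second harmonics in the rotation angle. A term h R(phi)z that oscillates with the angle
   phi is a difference q(R(phi)z) - q(z) with q(z) = (h/2)(1 - i cot(phi/2))z in complex notation;
   non-resonance for phi = theta and phi = 2 theta makes q = O(eps) with Lipschitz constant O(eps).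
   Subtracting such correctors from the slow variables leaves increments h F + O(h eps) with an
   averaged field F that does not depend on the scheme or on h.

   The exact flow, sampled at a step h/m that is small enough for the given solution, is a sequence
   of the same kind, with an error whose constants do not depend on m. A discrete Gronwall argument
   then compares the two sequences, and an induction on n keeps the numerical solution in the region
   where the estimates hold. The first component of F is the parallel velocity, so its error bound
   follows from the Lipschitz continuity of F. *)
theory Submission
  imports Defs
begin

text \<open>A direct comparison of velocities fails. During one step the position moves by O(h), so
  freezing B changes the phase of the rotation by O(h^2/\<epsilon>); for h comparable to \<epsilon>
  this is a local error O(h), which adds up to O(1). Only phase-free quantities can be compared, and
  the bound on \<open>V n - v\<close> is mere boundedness of both velocities. The energy must be one
  of the slow variables: averaging the quadratic term v . Db v over the rotation leaves half of
  |v|^2 - u^2 times the trace of Db, so x and u alone do not form a closed system. The same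
  quadratic term is the source of the second harmonic, hence of k = 2 in the non-resonance
  condition. Non-resonance is used in the form |sin| >= \<gamma> h/\<epsilon>. As this lower bound
  is proportional to the step, h cot remains O(\<epsilon>) for arbitrarily short steps, which is
  what makes the constants for the substeps h/m independent of m. For these substeps the condition
  is automatic, because their rotation angle is at most 1.\<close>

section \<open>Rotation formulas for the exponential and phi_1 of a skew matrix\<close>

definition perp :: "real^3 \<Rightarrow> real^3 \<Rightarrow> real^3" where
  "perp b v = v - (b \<bullet> v) *\<^sub>R b"

text \<open>Rodrigues' formula for the flow of w' = w x b with |b| = 1 at time \<theta>. The sine
  term has \<open>cross3 v b\<close> because \<open>hat\<close> acts as v x B.\<close>

definition rot :: "real \<Rightarrow> real^3 \<Rightarrow> real^3 \<Rightarrow> real^3" where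
  "rot \<theta> b v = (b \<bullet> v) *\<^sub>R b + cos \<theta> *\<^sub>R perp b v + sin \<theta> *\<^sub>R cross3 v b"

text \<open>The mean of the rotations \<open>rot\<close> over all angles between 0 and \<theta>,
  since phi_1(z) is the integral of exp(s z) over s in [0,1].\<close>

definition rot_phi1 :: "real \<Rightarrow> real^3 \<Rightarrow> real^3 \<Rightarrow> real^3" where
  "rot_phi1 \<theta> b v = (b \<bullet> v) *\<^sub>R b + (sin \<theta> / \<theta>) *\<^sub>R perp b v + ((1 - cos \<theta>) / \<theta>) *\<^sub>R cross3 v b"

text \<open>A matrix series may be summed after application to vectors: on basis vectors this gives
  convergence of every column, hence of every entry.\<close>

lemma suminf_matrix_vector_mult:
  fixes M :: "nat \<Rightarrow> real^3^3"
  assumes "\<And>v. (\<lambda>k. M k *v v) sums S v"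
  shows "suminf M *v v = S v"
proof -
  define N :: "real^3^3" where "N = (\<chi> i j. S (axis j 1) $ i)"
  have "(\<lambda>k. (M k *v axis j 1) $ i) sums (S (axis j 1) $ i)" for i j
    using bounded_linear.sums[OF bounded_linear_vec_nth assms] by blast
  then have "(\<lambda>k. M k $ i $ j) sums (N $ i $ j)" for i j
    by (simp add: N_def matrix_vector_mult_basis column_def)
  then have "M sums N"
    unfolding sums_def by (intro vec_tendstoI) simp
  then have "suminf M = N" by (simp add: sums_iff)
  have "bounded_linear (\<lambda>A::real^3^3. A *v v)"
    by (intro linear_conv_bounded_linear[THEN iffD1] linearI)
       (simp_all add: matrix_vector_mult_add_rdistrib scaleR_matrix_vector_assoc)
  from bounded_linear.sums[OF this \<open>M sums N\<close>] assms[of v]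
  have "N *v v = S v" by (rule sums_unique2)
  with \<open>suminf M = N\<close> show ?thesis by simp
qed

lemma cross3_cross3_unit:
  assumes "norm b = 1"
  shows "cross3 (cross3 v b) b = - perp b v"
proof -
  have "b \<bullet> b = 1" using assms by (simp add: norm_eq_1)
  then have 1: "b$1*b$1 + b$2*b$2 + b$3*b$3 = 1" by (simp add: inner_vec_def sum_3)
  have "cross3 (cross3 v b) b = (b \<bullet> v) *\<^sub>R b - (b$1*b$1 + b$2*b$2 + b$3*b$3) *\<^sub>R v"
    by (simp add: cross3_def vec_eq_iff forall_3 inner_vec_def sum_3 algebra_simps)
  then show ?thesis by (simp add: 1 perp_def)
qed

lemma perp_orthogonal: "norm b = 1 \<Longrightarrow> b \<bullet> perp b v = 0"
  by (simp add: perp_def inner_diff_right norm_eq_1)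

lemma perp_orthogonal': "norm b = 1 \<Longrightarrow> perp b v \<bullet> b = 0"
  by (simp add: perp_orthogonal inner_commute)

lemma cross3_perp: "cross3 (perp b v) b = cross3 v b"
proof -
  have "cross3 (perp b v) b = cross3 v b - (b \<bullet> v) *\<^sub>R cross3 b b"
    by (simp add: perp_def cross3_def vec_eq_iff forall_3 algebra_simps)
  then show ?thesis by (simp add: cross_refl)
qed

text \<open>On the plane orthogonal to b the matrix is \<theta> times a quarter turn.
  \<open>cos_coeff\<close> and \<open>sin_coeff\<close> encode the four-periodic sign pattern
  together with 1/k!; the factor k! cancels the latter, so no case distinction modulo 4 is
  needed.\<close>

lemma mat_pow_hat:
  assumes "norm b = 1" and "p \<bullet> b = 0" and A: "\<And>w. A *v w = \<theta> *\<^sub>R cross3 w b"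
  shows "mat_pow A k *v (u *\<^sub>R b + p) =
    (if k = 0 then u *\<^sub>R b else 0)
    + (fact k * \<theta> ^ k) *\<^sub>R (cos_coeff k *\<^sub>R p + sin_coeff k *\<^sub>R cross3 p b)"
proof (induction k)
  case 0
  show ?case by simp
next
  case (Suc k)
  have pb: "cross3 (cross3 p b) b = - p"
    using cross3_cross3_unit[OF assms(1)] assms(2) by (simp add: perp_def inner_commute)
  have "mat_pow A (Suc k) *v (u *\<^sub>R b + p) = \<theta> *\<^sub>R cross3 (mat_pow A k *v (u *\<^sub>R b + p)) b"
    by (simp flip: matrix_vector_mul_assoc add: A)
  also have "\<dots> = \<theta> *\<^sub>R ((fact k * \<theta> ^ k) *\<^sub>R (cos_coeff k *\<^sub>R cross3 p b - sin_coeff k *\<^sub>R p))"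
    unfolding Suc by (simp add: cross_add_left cross_mult_left cross_refl pb algebra_simps)
  also have "\<dots> = (fact (Suc k) * \<theta> ^ Suc k) *\<^sub>R
      (cos_coeff (Suc k) *\<^sub>R p + sin_coeff (Suc k) *\<^sub>R cross3 p b)"
    by (simp add: cos_coeff_Suc sin_coeff_Suc field_simps scaleR_right_diff_distrib scaleR_right_distrib
        del: of_nat_Suc of_nat_add)
  finally show ?case by simp
qed

lemma mat_exp_skew:
  assumes b: "norm b = 1" and A: "\<And>w. A *v w = \<theta> *\<^sub>R cross3 w b"
  shows "mat_exp A *v v = rot \<theta> b v"
proof -
  have "(\<lambda>k. ((1 / fact k) *\<^sub>R mat_pow A k) *v v) sums rot \<theta> b v" for v
  proof -
    have pb: "perp b v \<bullet> b = 0" by (rule perp_orthogonal'[OF b])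
    have c: "cross3 (perp b v) b = cross3 v b"
      by (rule cross3_perp)
    have v: "(b \<bullet> v) *\<^sub>R b + perp b v = v" by (simp add: perp_def)
    have eq: "((1 / fact k) *\<^sub>R mat_pow A k) *v v =
      (if k = 0 then (b \<bullet> v) *\<^sub>R b else 0)
      + ((cos_coeff k *\<^sub>R \<theta> ^ k) *\<^sub>R perp b v + (sin_coeff k *\<^sub>R \<theta> ^ k) *\<^sub>R cross3 v b)" for k
      using mat_pow_hat[OF b pb A, of k "b \<bullet> v"]
      by (simp add: v c scaleR_right_distrib scaleR_matrix_vector_assoc[symmetric] mult.commute)
    have "(\<lambda>k. if k = 0 then (b \<bullet> v) *\<^sub>R b else 0) sums ((b \<bullet> v) *\<^sub>R b)"
      using sums_single[of 0 "\<lambda>_. (b \<bullet> v) *\<^sub>R b"] by simp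
    then show ?thesis unfolding eq rot_def add.assoc
      by (intro sums_add sums_scaleR_left cos_converges sin_converges)
  qed
  then show ?thesis unfolding mat_exp_def by (rule suminf_matrix_vector_mult)
qed

text \<open>The coefficient 1/(k+1)! shifts the series by one index: the powers on
  \<open>perp\<close> produce the shifted sine series divided by \<theta>, and those on
  \<open>cross3\<close> the cosine series without its constant term.\<close>

lemma mat_phi1_skew:
  assumes b: "norm b = 1" and A: "\<And>w. A *v w = \<theta> *\<^sub>R cross3 w b" and "\<theta> \<noteq> 0"
  shows "mat_phi1 A *v v = rot_phi1 \<theta> b v"
proof -
  have "(\<lambda>k. ((1 / fact (Suc k)) *\<^sub>R mat_pow A k) *v v) sums rot_phi1 \<theta> b v" for v
  proof -
    have pb: "perp b v \<bullet> b = 0" by (rule perp_orthogonal'[OF b])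
    have c: "cross3 (perp b v) b = cross3 v b"
      by (rule cross3_perp)
    have v: "(b \<bullet> v) *\<^sub>R b + perp b v = v" by (simp add: perp_def)
    have eq: "((1 / fact (Suc k)) *\<^sub>R mat_pow A k) *v v =
      (if k = 0 then (b \<bullet> v) *\<^sub>R b else 0)
      + ((sin_coeff (Suc k) *\<^sub>R \<theta> ^ Suc k / \<theta>) *\<^sub>R perp b v
         + (- (cos_coeff (Suc k) *\<^sub>R \<theta> ^ Suc k) / \<theta>) *\<^sub>R cross3 v b)" for k
    proof -
      have "mat_pow A k *v v = (if k = 0 then (b \<bullet> v) *\<^sub>R b else 0)
          + (fact k * \<theta> ^ k) *\<^sub>R (cos_coeff k *\<^sub>R perp b v + sin_coeff k *\<^sub>R cross3 v b)"
        using mat_pow_hat[OF b pb A, of k "b \<bullet> v"] by (simp only: v c)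
      then show ?thesis
        using \<open>\<theta> \<noteq> 0\<close> v
        by (cases "k = 0") (simp add: sin_coeff_Suc cos_coeff_Suc add.commute,
          simp add: scaleR_right_distrib scaleR_matrix_vector_assoc[symmetric]
            sin_coeff_Suc cos_coeff_Suc field_simps del: of_nat_Suc)
    qed
    have 0: "(\<lambda>k. if k = 0 then (b \<bullet> v) *\<^sub>R b else 0) sums ((b \<bullet> v) *\<^sub>R b)"
      using sums_single[of 0 "\<lambda>_. (b \<bullet> v) *\<^sub>R b"] by simp
    have 1: "(\<lambda>k. sin_coeff (Suc k) *\<^sub>R \<theta> ^ Suc k) sums sin \<theta>"
      using sin_converges[of \<theta>] sums_Suc_iff[of "\<lambda>k. sin_coeff k *\<^sub>R \<theta> ^ k"] by simp
    have "(\<lambda>k. cos_coeff (Suc k) *\<^sub>R \<theta> ^ Suc k) sums (cos \<theta> - 1)"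
      using cos_converges[of \<theta>] sums_Suc_iff[of "\<lambda>k. cos_coeff k *\<^sub>R \<theta> ^ k"] by simp
    from sums_minus[OF this]
    have 2: "(\<lambda>k. - (cos_coeff (Suc k) *\<^sub>R \<theta> ^ Suc k)) sums (1 - cos \<theta>)" by simp
    show ?thesis unfolding eq rot_phi1_def add.assoc
      by (intro sums_add sums_scaleR_left sums_divide 0 1 2)
  qed
  then show ?thesis unfolding mat_phi1_def by (rule suminf_matrix_vector_mult)
qed

definition unit_field :: "(real^3 \<Rightarrow> real^3) \<Rightarrow> real^3 \<Rightarrow> real^3" where
  "unit_field B x = B x /\<^sub>R norm (B x)"

lemma hat_scaled:
  assumes "B x \<noteq> 0"
  shows "(s *\<^sub>R hat (B x)) *v w = (s * norm (B x)) *\<^sub>R cross3 w (unit_field B x)"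
  using assms by (simp add: scaleR_matrix_vector_assoc[symmetric] hat_mult unit_field_def cross_mult_right)

lemma norm_unit_field: "B x \<noteq> 0 \<Longrightarrow> norm (unit_field B x) = 1"
  by (simp add: unit_field_def)

lemma mat_exp_hat:
  assumes "B x \<noteq> 0"
  shows "mat_exp (s *\<^sub>R hat (B x)) *v v = rot (s * norm (B x)) (unit_field B x) v"
  by (rule mat_exp_skew[OF norm_unit_field[of B x, OF assms]]) (rule hat_scaled[of B x, OF assms])

lemma mat_phi1_hat:
  assumes "B x \<noteq> 0" and "s \<noteq> 0"
  shows "mat_phi1 (s *\<^sub>R hat (B x)) *v v = rot_phi1 (s * norm (B x)) (unit_field B x) v"
  by (rule mat_phi1_skew[OF norm_unit_field[of B x, OF assms(1)]])
     (use hat_scaled[of B x, OF assms(1)] assms in auto)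


section \<open>Correctors for the oscillating terms\<close>

definition half_cot :: "real \<Rightarrow> real \<Rightarrow> real" where
  "half_cot h \<phi> = (h / 2) * (cos \<phi> / sin \<phi>)"

text \<open>The corrector q of the complex formula, with \<open>cross3 v b\<close> in the role of i
  times \<open>perp b v\<close>.\<close>

definition osc1 :: "real \<Rightarrow> real \<Rightarrow> real^3 \<Rightarrow> real^3 \<Rightarrow> real^3" where
  "osc1 h \<theta> b v = (h / 2) *\<^sub>R perp b v - half_cot h (\<theta> / 2) *\<^sub>R cross3 v b"

text \<open>
  On the plane orthogonal to \<open>b\<close>, a quadratic form at a vector \<open>p\<close> with quarter turn \<open>q\<close> is half
  its trace times \<open>|p|\<^sup>2\<close> plus \<open>dev2 D p q\<close>; when \<open>p\<close> turns by \<open>\<theta>\<close>, the pair \<open>(dev2, mix2)\<close> turns by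
  \<open>2 \<theta>\<close>.
\<close>

definition dev2 :: "(real^3 \<Rightarrow> real^3) \<Rightarrow> real^3 \<Rightarrow> real^3 \<Rightarrow> real" where
  "dev2 D p q = (p \<bullet> D p - q \<bullet> D q) / 2"

definition mix2 :: "(real^3 \<Rightarrow> real^3) \<Rightarrow> real^3 \<Rightarrow> real^3 \<Rightarrow> real" where
  "mix2 D p q = (p \<bullet> D q + q \<bullet> D p) / 2"

text \<open>Corrector for v . D v when D maps into the plane orthogonal to b. With v = u b + p the
  form splits into u (Db . p), a first harmonic left to \<open>osc1\<close>, and p . D p. For the
  latter, \<open>dev2\<close> - i \<open>mix2\<close> turns by 2 \<theta>, and its corrector is the
  real part of (h/2)(1 - i cot \<theta>) times this number.\<close>

definition osc2 :: "real \<Rightarrow> real \<Rightarrow> real^3 \<Rightarrow> (real^3 \<Rightarrow> real^3) \<Rightarrow> real^3 \<Rightarrow> real" where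
  "osc2 h \<theta> b D v = (b \<bullet> v) * (D b \<bullet> osc1 h \<theta> b v)
     + (h / 2) * dev2 D (perp b v) (cross3 v b) - half_cot h \<theta> * mix2 D (perp b v) (cross3 v b)"

definition tr3 :: "(real^3 \<Rightarrow> real^3) \<Rightarrow> real" where
  "tr3 D = (\<Sum>i\<in>UNIV. D (axis i 1) $ i)"

context
  fixes b :: "real^3"
  assumes unit: "norm b = 1"
begin

lemma inner_unit: "b \<bullet> b = 1"
  using unit by (simp add: norm_eq_1)

lemma inner_rot: "b \<bullet> rot \<theta> b v = b \<bullet> v"
  by (simp add: rot_def inner_add_right inner_unit perp_orthogonal[OF unit] dot_cross_self)

lemma perp_rot: "perp b (rot \<theta> b v) = cos \<theta> *\<^sub>R perp b v + sin \<theta> *\<^sub>R cross3 v b"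
  by (simp add: perp_def[of b "rot \<theta> b v"] inner_rot) (simp add: rot_def)

lemma cross3_rot: "cross3 (rot \<theta> b v) b = cos \<theta> *\<^sub>R cross3 v b - sin \<theta> *\<^sub>R perp b v"
  by (simp add: rot_def cross_add_left cross_mult_left cross_refl cross3_perp cross3_cross3_unit[OF unit])

lemma norm_perp: "(norm (perp b v))\<^sup>2 = (norm v)\<^sup>2 - (b \<bullet> v)\<^sup>2"
  unfolding power2_norm_eq_inner
  by (simp add: perp_def inner_diff_left inner_diff_right inner_unit inner_commute power2_eq_square algebra_simps)

lemma norm_cross3_unit: "(norm (cross3 v b))\<^sup>2 = (norm v)\<^sup>2 - (b \<bullet> v)\<^sup>2"
  using norm_cross_dot[of v b] unit by (simp add: inner_commute algebra_simps power_mult_distrib)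

lemma inner_perp_cross3: "perp b v \<bullet> cross3 v b = 0"
  by (simp add: perp_def inner_diff_left dot_cross_self)

lemma norm_rot: "norm (rot \<theta> b v) = norm v"
proof -
  have "(norm (perp b (rot \<theta> b v)))\<^sup>2 = (cos \<theta>)\<^sup>2 * (norm (perp b v))\<^sup>2 + (sin \<theta>)\<^sup>2 * (norm (cross3 v b))\<^sup>2"
    unfolding perp_rot power2_norm_eq_inner
    by (simp add: inner_add_left inner_add_right inner_perp_cross3 inner_commute[of "cross3 v b" "perp b v"] power2_eq_square)
  also have "\<dots> = ((cos \<theta>)\<^sup>2 + (sin \<theta>)\<^sup>2) * (norm (perp b v))\<^sup>2"
    unfolding norm_cross3_unit norm_perp by (rule distrib_right[symmetric])
  finally have "(norm (rot \<theta> b v))\<^sup>2 = (norm v)\<^sup>2"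
    by (simp add: norm_perp inner_rot)
  then show ?thesis by simp
qed

text \<open>This is the identity (e^{i \<theta>} - 1)(1 - i cot(\<theta>/2))/2 = e^{i \<theta>} on
  the plane orthogonal to b; the component along b is the mean that remains.\<close>

lemma osc1_rot:
  assumes "sin (\<theta> / 2) \<noteq> 0"
  shows "osc1 h \<theta> b (rot \<theta> b v) - osc1 h \<theta> b v = h *\<^sub>R rot \<theta> b v - (h * (b \<bullet> v)) *\<^sub>R b"
proof -
  define \<phi> where "\<phi> = \<theta> / 2"
  have \<theta>: "\<theta> = 2 * \<phi>" and s: "sin \<phi> \<noteq> 0" using assms by (auto simp: \<phi>_def)
  define p q where "p = perp b v" and "q = cross3 v b"
  have 1: "(h / 2) * cos \<theta> + half_cot h \<phi> * sin \<theta> - h / 2 = h * cos \<theta>"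
    unfolding \<theta> half_cot_def sin_double cos_double_cos using s
    by (simp add: field_simps power2_eq_square)
  have 2: "(h / 2) * sin \<theta> - half_cot h \<phi> * cos \<theta> + half_cot h \<phi> = h * sin \<theta>"
    unfolding \<theta> half_cot_def sin_double cos_double_sin using s
    by (simp add: field_simps power2_eq_square)
  have "osc1 h \<theta> b (rot \<theta> b v) - osc1 h \<theta> b v =
     ((h / 2) * cos \<theta> + half_cot h \<phi> * sin \<theta> - h / 2) *\<^sub>R p
     + ((h / 2) * sin \<theta> - half_cot h \<phi> * cos \<theta> + half_cot h \<phi>) *\<^sub>R q"
    by (simp add: osc1_def perp_rot cross3_rot \<phi>_def[symmetric] p_def[symmetric] q_def[symmetric] algebra_simps)
  also have "\<dots> = h *\<^sub>R (cos \<theta> *\<^sub>R p + sin \<theta> *\<^sub>R q)"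
    unfolding 1 2 by (simp add: algebra_simps)
  also have "\<dots> = h *\<^sub>R rot \<theta> b v - (h * (b \<bullet> v)) *\<^sub>R b"
    by (simp add: rot_def p_def q_def algebra_simps)
  finally show ?thesis .
qed

text \<open>If p = \<open>perp b v\<close> is a unit vector, then b, p and p x b form an orthonormal
  basis, and the three values of the quadratic form add up to the trace. Scaling by |p|^2 includes p
  = 0: the identity behind it is p p^T + q q^T = |p|^2 (I - b b^T) with q = p x b.\<close>

lemma trace_perp:
  assumes "linear D"
  shows "perp b v \<bullet> D (perp b v) + cross3 v b \<bullet> D (cross3 v b)
    = ((norm v)\<^sup>2 - (b \<bullet> v)\<^sup>2) * (tr3 D - b \<bullet> D b)"
proof -
  define p where "p = perp b v"
  define M where "M = matrix D"
  have D: "D y = M *v y" for y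
    by (simp add: M_def matrix_vector_mul(2)[OF assms, THEN fun_cong, symmetric])
  have qv: "cross3 v b = cross3 p b" by (simp add: p_def cross3_perp)
  have pp: "(norm v)\<^sup>2 - (b \<bullet> v)\<^sup>2 = p \<bullet> p"
    by (simp add: p_def norm_perp flip: power2_norm_eq_inner)
  have bb: "b$1*b$1 + b$2*b$2 + b$3*b$3 = 1" using inner_unit by (simp add: inner_vec_def sum_3)
  have bp: "b$1*p$1 + b$2*p$2 + b$3*p$3 = 0"
    using perp_orthogonal[OF unit, of v] by (simp add: p_def[symmetric] inner_vec_def sum_3)
  \<comment> \<open>One diagonal and one off-diagonal entry of this matrix identity; the others
    follow by cyclic permutation. Each difference of the two sides is an explicit combination of the
    constraints |b|^2 = 1 and b . p = 0.\<close>
  have diag: "(p1*p1 + p2*p2 + p3*p3) * (1 - b1*b1) = p1*p1 + (p2*b3 - p3*b2)*(p2*b3 - p3*b2)"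
    if "b1*b1 + b2*b2 + b3*b3 = 1" "b1*p1 + b2*p2 + b3*p3 = 0" for b1 b2 b3 p1 p2 p3 :: real
  proof -
    have "(p1*p1 + p2*p2 + p3*p3) * (1 - b1*b1) - (p1*p1 + (p2*b3 - p3*b2)*(p2*b3 - p3*b2))
      = (p1*p1 - (p1*p1 + p2*p2 + p3*p3)) * (b1*b1 + b2*b2 + b3*b3 - 1)
        + (b1*p1 + b2*p2 + b3*p3) * (b1*p1 + b2*p2 + b3*p3 - 2*p1*b1)"
      by (simp add: algebra_simps)
    then show ?thesis by (simp add: that)
  qed
  have off: "(p1*p1 + p2*p2 + p3*p3) * (- (b1*b2)) = p1*p2 + (p2*b3 - p3*b2)*(p3*b1 - p1*b3)"
    if "b1*b1 + b2*b2 + b3*b3 = 1" "b1*p1 + b2*p2 + b3*p3 = 0" for b1 b2 b3 p1 p2 p3 :: real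
  proof -
    have "(p1*p1 + p2*p2 + p3*p3) * (- (b1*b2)) - (p1*p2 + (p2*b3 - p3*b2)*(p3*b1 - p1*b3))
      = p1*p2 * (b1*b1 + b2*b2 + b3*b3 - 1) - (b1*p1 + b2*p2 + b3*p3) * (p2*b1 + p1*b2)"
      by (simp add: algebra_simps)
    then show ?thesis by (simp add: that)
  qed
  note 1 = diag[of "b$1" "b$2" "b$3" "p$1" "p$2" "p$3"] diag[of "b$2" "b$3" "b$1" "p$2" "p$3" "p$1"]
    diag[of "b$3" "b$1" "b$2" "p$3" "p$1" "p$2"] off[of "b$1" "b$2" "b$3" "p$1" "p$2" "p$3"]
    off[of "b$2" "b$3" "b$1" "p$2" "p$3" "p$1"] off[of "b$3" "b$1" "b$2" "p$3" "p$1" "p$2"]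
  define q where "q = cross3 p b"
  have 2: "p$i * p$j + q$i * q$j = (p \<bullet> p) * ((if i = j then 1 else 0) - b$i * b$j)" for i j
  proof -
    have "\<forall>i j. p$i * p$j + q$i * q$j = (p \<bullet> p) * ((if i = j then 1 else 0) - b$i * b$j)"
      unfolding forall_3 q_def cross_components inner_vec_def sum_3 inner_real_def using 1 bb bp
      by (simp add: mult.commute add_ac)
    then show ?thesis by blast
  qed
  have "p \<bullet> (M *v p) + q \<bullet> (M *v q) = (\<Sum>i\<in>UNIV. \<Sum>j\<in>UNIV. M$i$j * (p$i * p$j + q$i * q$j))"
    by (simp add: inner_vec_def matrix_vector_mult_def sum_3 algebra_simps)
  also have "\<dots> = (\<Sum>i\<in>UNIV. \<Sum>j\<in>UNIV. M$i$j * ((p \<bullet> p) * ((if i = j then 1 else 0) - b$i * b$j)))"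
    unfolding 2 ..
  also have "\<dots> = (p \<bullet> p) * ((\<Sum>i\<in>UNIV. M$i$i) - b \<bullet> (M *v b))"
    by (simp add: inner_vec_def[of b] matrix_vector_mult_def sum_3 algebra_simps)
  finally have "p \<bullet> (M *v p) + cross3 p b \<bullet> (M *v cross3 p b) = (p \<bullet> p) * (tr3 D - b \<bullet> (M *v b))"
    by (simp add: q_def tr3_def D matrix_vector_mult_basis column_def)
  then show ?thesis by (simp add: qv pp D p_def[symmetric])
qed

lemma osc2_rot:
  assumes D: "linear D" and bD: "\<And>y. b \<bullet> D y = 0"
    and s1: "sin (\<theta> / 2) \<noteq> 0" and s2: "sin \<theta> \<noteq> 0"
  shows "h * (rot \<theta> b v \<bullet> D (rot \<theta> b v)) =
    h * (((norm v)\<^sup>2 - (b \<bullet> v)\<^sup>2) / 2 * tr3 D) + osc2 h \<theta> b D (rot \<theta> b v) - osc2 h \<theta> b D v"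
proof -
  define p q where "p = perp b v" and "q = cross3 v b"
  define c s where "c = cos \<theta>" and "s = sin \<theta>"
  define p' q' where "p' = perp b (rot \<theta> b v)" and "q' = cross3 (rot \<theta> b v) b"
  have p': "p' = c *\<^sub>R p + s *\<^sub>R q" and q': "q' = c *\<^sub>R q - s *\<^sub>R p"
    by (simp_all add: p'_def q'_def p_def q_def c_def s_def perp_rot cross3_rot)
  define u where "u = b \<bullet> v"
  have cs: "c * c + s * s = 1" by (simp add: c_def s_def flip: power2_eq_square)
  have s: "s \<noteq> 0" using s2 by (simp add: s_def)
  have vt: "rot \<theta> b v = u *\<^sub>R b + p'"
    by (simp add: u_def p'_def perp_def inner_rot)
  have quad: "rot \<theta> b v \<bullet> D (rot \<theta> b v) = u * (D b \<bullet> p') + p' \<bullet> D p'"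
    unfolding vt by (simp add: linear_add[OF D] linear_cmul[OF D] inner_add_left inner_add_right bD
      inner_commute algebra_simps)
  have "osc1 h \<theta> b (rot \<theta> b v) - osc1 h \<theta> b v = h *\<^sub>R p'"
    unfolding osc1_rot[OF s1] u_def[symmetric] by (simp add: vt algebra_simps)
  then have "D b \<bullet> (osc1 h \<theta> b (rot \<theta> b v) - osc1 h \<theta> b v) = h * (D b \<bullet> p')"
    by (simp only: inner_scaleR_right)
  then have o1: "D b \<bullet> osc1 h \<theta> b (rot \<theta> b v) = D b \<bullet> osc1 h \<theta> b v + h * (D b \<bullet> p')"
    by (simp add: inner_diff_right)
  have tr: "p' \<bullet> D p' + q' \<bullet> D q' = ((norm v)\<^sup>2 - u\<^sup>2) * tr3 D"
    using trace_perp[OF D, of "rot \<theta> b v"] by (simp add: p'_def q'_def inner_rot norm_rot bD u_def)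
  define X Y where "X = dev2 D p q" and "Y = mix2 D p q"
  have X': "dev2 D p' q' = (c * c - s * s) * X + 2 * s * c * Y"
    unfolding p' q' X_def Y_def dev2_def mix2_def
    by (simp add: linear_add[OF D] linear_diff[OF D] linear_cmul[OF D] inner_add_left inner_add_right
        inner_diff_left inner_diff_right add_divide_distrib diff_divide_distrib algebra_simps)
  have Y': "mix2 D p' q' = (c * c - s * s) * Y - 2 * s * c * X"
    unfolding p' q' X_def Y_def dev2_def mix2_def
    by (simp add: linear_add[OF D] linear_diff[OF D] linear_cmul[OF D] inner_add_left inner_add_right
        inner_diff_left inner_diff_right add_divide_distrib diff_divide_distrib algebra_simps)
  have half: "p' \<bullet> D p' = ((norm v)\<^sup>2 - u\<^sup>2) / 2 * tr3 D + dev2 D p' q'"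
    unfolding dev2_def using tr by (simp add: field_simps)
  \<comment> \<open>The real part of the identity behind \<open>osc1_rot\<close>, with 2 \<theta> in
    place of \<theta>.\<close>
  have key: "h * dev2 D p' q' = (h / 2) * dev2 D p' q' - half_cot h \<theta> * mix2 D p' q'
     - ((h / 2) * X - half_cot h \<theta> * Y)"
  proof -
    have "(c * c - s * s) * X + 2 * s * c * Y + X = 2 * c * (c * X + s * Y) + (1 - (c * c + s * s)) * X" by (simp add: algebra_simps)
    moreover have "(c * c - s * s) * Y - 2 * s * c * X - Y = - 2 * s * (c * X + s * Y) - (1 - (c * c + s * s)) * Y" by (simp add: algebra_simps)
    ultimately have "(h / 2) * (dev2 D p' q' + X) + half_cot h \<theta> * (mix2 D p' q' - Y) = 0"
      unfolding X' Y' half_cot_def c_def[symmetric] s_def[symmetric] cs using s by simp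
    then show ?thesis by (simp add: field_simps)
  qed
  have "osc2 h \<theta> b D (rot \<theta> b v) - osc2 h \<theta> b D v = h * u * (D b \<bullet> p') + h * dev2 D p' q'"
    unfolding osc2_def inner_rot u_def[symmetric] p'_def[symmetric] q'_def[symmetric]
      p_def[symmetric] q_def[symmetric] X_def[symmetric] Y_def[symmetric] o1
    using key by (simp add: algebra_simps)
  then show ?thesis unfolding quad half u_def[symmetric] by (simp add: algebra_simps)
qed

lemma inner_rot_osc1:
  assumes "sin (\<theta> / 2) \<noteq> 0"
  shows "h * (e \<bullet> rot \<theta> b v) = h * ((b \<bullet> v) * (b \<bullet> e)) + e \<bullet> osc1 h \<theta> b (rot \<theta> b v) - e \<bullet> osc1 h \<theta> b v"
proof -
  have "e \<bullet> (osc1 h \<theta> b (rot \<theta> b v) - osc1 h \<theta> b v) = e \<bullet> (h *\<^sub>R rot \<theta> b v - (h * (b \<bullet> v)) *\<^sub>R b)"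
    by (simp only: osc1_rot[OF assms])
  then show ?thesis by (simp add: inner_diff_right inner_commute)
qed

lemma inner_perp_cross3_swap: "e \<bullet> cross3 v b = perp b e \<bullet> cross3 v b"
  by (simp add: perp_def inner_diff_left dot_cross_self)

text \<open>Let J be the quarter turn. The transpose of phi_1(\<theta> J) times exp(\<theta> J) is
  (exp(\<theta> J) - 1)/(\<theta> J) on the plane, and the inverse of J is -J. The filtered force
  thus does work that is already a difference of one expression at the two velocities, without
  division by a sine.\<close>

lemma inner_rot_phi1:
  assumes "\<theta> \<noteq> 0"
  shows "rot_phi1 \<theta> b e \<bullet> rot \<theta> b v = (b \<bullet> v) * (b \<bullet> e)
    + (e \<bullet> cross3 v b) / \<theta> - (e \<bullet> cross3 (rot \<theta> b v) b) / \<theta>"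
proof -
  define p q where "p = perp b v" and "q = cross3 v b"
  define f g where "f = perp b e" and "g = cross3 e b"
  define c s where "c = cos \<theta>" and "s = sin \<theta>"
  have cs: "c * c + s * s = 1" by (simp add: c_def s_def flip: power2_eq_square)
  have gp: "g \<bullet> p = - (e \<bullet> q)"
  proof -
    have "cross3 e b \<bullet> v = - (e \<bullet> cross3 v b)"
      by (simp add: cross3_def inner_vec_def sum_3 algebra_simps)
    then show ?thesis unfolding g_def p_def q_def perp_def
      by (simp add: inner_diff_right dot_cross_self inner_commute)
  qed
  have gq: "g \<bullet> q = f \<bullet> p"
  proof -
    have "g \<bullet> q = (e \<bullet> v) * (b \<bullet> b) - (e \<bullet> b) * (b \<bullet> v)"
      by (simp add: g_def q_def cross3_def inner_vec_def sum_3 algebra_simps)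
    then show ?thesis unfolding f_def p_def perp_def
      by (simp add: inner_diff_right inner_diff_left inner_unit inner_commute)
  qed
  have fq: "f \<bullet> q = e \<bullet> q" by (simp add: f_def q_def inner_perp_cross3_swap[symmetric])
  have ep: "e \<bullet> p = f \<bullet> p"
    by (simp add: f_def p_def perp_def inner_diff_right inner_diff_left inner_unit inner_commute)
  have bo: "b \<bullet> p = 0" "b \<bullet> q = 0" "f \<bullet> b = 0" "g \<bullet> b = 0"
    by (simp_all add: p_def q_def f_def g_def perp_orthogonal[OF unit] perp_orthogonal'[OF unit] dot_cross_self)
  have "rot_phi1 \<theta> b e \<bullet> rot \<theta> b v = (b \<bullet> e) * (b \<bullet> v)
     + (s / \<theta>) * (c * (f \<bullet> p) + s * (f \<bullet> q)) + ((1 - c) / \<theta>) * (c * (g \<bullet> p) + s * (g \<bullet> q))"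
    unfolding rot_phi1_def rot_def p_def[symmetric] q_def[symmetric] f_def[symmetric] g_def[symmetric]
      c_def[symmetric] s_def[symmetric]
    by (simp add: inner_add_left inner_add_right bo inner_unit add_divide_distrib algebra_simps)
  moreover have "e \<bullet> cross3 (rot \<theta> b v) b = c * (e \<bullet> q) - s * (f \<bullet> p)"
    unfolding cross3_rot by (simp add: inner_diff_right p_def[symmetric] q_def[symmetric] ep c_def s_def)
  moreover have "s * (c * (f \<bullet> p) + s * (e \<bullet> q)) + (1 - c) * (s * (f \<bullet> p) - c * (e \<bullet> q))
     = (c * c + s * s) * (e \<bullet> q) - (c * (e \<bullet> q) - s * (f \<bullet> p))"
    by (simp add: algebra_simps)
  moreover have "(s / \<theta>) * (c * (f \<bullet> p) + s * (e \<bullet> q)) + ((1 - c) / \<theta>) * (s * (f \<bullet> p) - c * (e \<bullet> q))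
     = (s * (c * (f \<bullet> p) + s * (e \<bullet> q)) + (1 - c) * (s * (f \<bullet> p) - c * (e \<bullet> q))) / \<theta>"
    by (simp add: add_divide_distrib)
  ultimately show ?thesis unfolding gp gq fq q_def[symmetric] cs by (simp add: diff_divide_distrib)
qed

end


section \<open>Uniform estimates for families of steps\<close>

text \<open>
  All constants must be uniform in the fields, the initial values, \<open>\<epsilon>\<close> and \<open>h\<close>. These data are
  therefore collected in an index \<open>i\<close> ranging over a set \<open>I\<close>, and estimates are \<open>O\<close>-relations
  between functions of \<open>i\<close>.
\<close>

definition bo :: "'i set \<Rightarrow> ('i \<Rightarrow> 'a::real_normed_vector) \<Rightarrow> ('i \<Rightarrow> real) \<Rightarrow> bool" where
  "bo I f g \<longleftrightarrow> (\<exists>C. \<forall>i\<in>I. norm (f i) \<le> C * \<bar>g i\<bar>)"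

lemma boI: "(\<And>i. i \<in> I \<Longrightarrow> norm (f i) \<le> C * \<bar>g i\<bar>) \<Longrightarrow> bo I f g"
  unfolding bo_def by blast

lemma boE:
  assumes "bo I f g"
  obtains C where "C > 0" "\<And>i. i \<in> I \<Longrightarrow> norm (f i) \<le> C * \<bar>g i\<bar>"
proof -
  from assms obtain C where C: "\<And>i. i \<in> I \<Longrightarrow> norm (f i) \<le> C * \<bar>g i\<bar>"
    unfolding bo_def by blast
  show thesis
  proof (rule that[of "max C 1"])
    show "norm (f i) \<le> max C 1 * \<bar>g i\<bar>" if "i \<in> I" for i
      using C[OF that] mult_right_mono[of C "max C 1" "\<bar>g i\<bar>"] by simp
  qed simp
qed

lemma bo_1I: "(\<And>i. i \<in> I \<Longrightarrow> norm (f i) \<le> C) \<Longrightarrow> bo I f (\<lambda>_. 1)"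
  by (rule boI[where C = C]) simp

lemma bo_const [simp]: "bo I (\<lambda>_. c) (\<lambda>_. 1)"
  by (rule bo_1I) (rule order_refl)

lemma bo_zero [simp]: "bo I (\<lambda>_. 0) g"
  by (rule boI[where C = 0]) simp

lemma bo_refl [simp]: "bo I g g"
  by (rule boI[where C = 1]) simp

lemma bo_cong: "(\<And>i. i \<in> I \<Longrightarrow> f i = f' i) \<Longrightarrow> bo I f g \<longleftrightarrow> bo I f' g"
  unfolding bo_def by simp

lemma bo_add:
  assumes "bo I f h" "bo I g h"
  shows "bo I (\<lambda>i. f i + g i) h"
proof -
  from assms obtain C D where *: "\<And>i. i \<in> I \<Longrightarrow> norm (f i) \<le> C * \<bar>h i\<bar>" "\<And>i. i \<in> I \<Longrightarrow> norm (g i) \<le> D * \<bar>h i\<bar>"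
    unfolding bo_def by metis
  show ?thesis
  proof (rule boI[where C = "C + D"])
    fix i assume "i \<in> I"
    then show "norm (f i + g i) \<le> (C + D) * \<bar>h i\<bar>"
      using norm_triangle_ineq[of "f i" "g i"] *[of i] by (simp add: distrib_right)
  qed
qed

lemma bo_minus: "bo I f h \<Longrightarrow> bo I (\<lambda>i. - f i) h"
  unfolding bo_def by simp

lemma bo_diff: "bo I f h \<Longrightarrow> bo I g h \<Longrightarrow> bo I (\<lambda>i. f i - g i) h"
  using bo_add[OF _ bo_minus, of I f h g] by simp

lemma bo_trans:
  assumes "bo I f g" "bo I g h"
  shows "bo I f h"
proof -
  obtain C where C: "C > 0" "\<And>i. i \<in> I \<Longrightarrow> norm (f i) \<le> C * \<bar>g i\<bar>" using assms(1) by (rule boE) blast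
  obtain D where D: "\<And>i. i \<in> I \<Longrightarrow> \<bar>g i\<bar> \<le> D * \<bar>h i\<bar>" using assms(2) unfolding bo_def by auto
  show ?thesis
  proof (rule boI[where C = "C * D"])
    fix i assume i: "i \<in> I"
    have "C * \<bar>g i\<bar> \<le> C * (D * \<bar>h i\<bar>)" using D[OF i] C(1) by (intro mult_left_mono) auto
    then show "norm (f i) \<le> C * D * \<bar>h i\<bar>" using C(2)[OF i] by simp
  qed
qed

lemma bo_bilinear:
  assumes "bounded_bilinear pr" "bo I f g" "bo I f' g'"
  shows "bo I (\<lambda>i. pr (f i) (f' i)) (\<lambda>i. g i * g' i)"
proof -
  obtain C where C: "C > 0" "\<And>i. i \<in> I \<Longrightarrow> norm (f i) \<le> C * \<bar>g i\<bar>" using assms(2) by (rule boE) blast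
  obtain D where D: "D > 0" "\<And>i. i \<in> I \<Longrightarrow> norm (f' i) \<le> D * \<bar>g' i\<bar>" using assms(3) by (rule boE) blast
  obtain K where K: "K > 0" "\<And>a b. norm (pr a b) \<le> norm a * norm b * K"
    using bounded_bilinear.pos_bounded[OF assms(1)] by blast
  show ?thesis
  proof (rule boI[where C = "C * D * K"])
    fix i assume i: "i \<in> I"
    have "norm (f i) * norm (f' i) \<le> (C * \<bar>g i\<bar>) * (D * \<bar>g' i\<bar>)"
      using C D i by (intro mult_mono) (auto simp: less_imp_le)
    then have "norm (f i) * norm (f' i) * K \<le> (C * \<bar>g i\<bar>) * (D * \<bar>g' i\<bar>) * K"
      using K(1) by (intro mult_right_mono) auto
    then show "norm (pr (f i) (f' i)) \<le> C * D * K * \<bar>g i * g' i\<bar>"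
      using K(2)[of "f i" "f' i"] by (simp add: abs_mult mult_ac)
  qed
qed

lemma bounded_bilinear_cross3: "bounded_bilinear cross3"
  using bilinear_cross bilinear_conv_bounded_bilinear by blast

lemma bo_mult: "bo I f g \<Longrightarrow> bo I f' g' \<Longrightarrow> bo I (\<lambda>i. f i * f' i :: real) (\<lambda>i. g i * g' i)"
  by (rule bo_bilinear[OF bounded_bilinear_mult])

lemma bo_scaleR: "bo I f g \<Longrightarrow> bo I f' g' \<Longrightarrow> bo I (\<lambda>i. f i *\<^sub>R f' i) (\<lambda>i. g i * g' i)"
  by (rule bo_bilinear[OF bounded_bilinear_scaleR])

lemma bo_inner: "bo I f g \<Longrightarrow> bo I f' g' \<Longrightarrow> bo I (\<lambda>i. f i \<bullet> f' i) (\<lambda>i. g i * g' i)"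
  by (rule bo_bilinear[OF bounded_bilinear_inner])

lemma bo_mult_left: "bo I f (\<lambda>_. 1) \<Longrightarrow> bo I g h \<Longrightarrow> bo I (\<lambda>i. f i * g i :: real) h"
  using bo_mult[of I f "\<lambda>_. 1" g h] by simp

text \<open>
  \<open>slow I s m f g\<close>: the families \<open>f\<close> and \<open>g\<close>, thought of as one quantity before and after a
  step of size \<open>m\<close>, are of size \<open>s\<close> and differ by \<open>O(s m)\<close>, uniformly in \<open>I\<close>.
\<close>

definition slow ::
  "'i set \<Rightarrow> ('i \<Rightarrow> real) \<Rightarrow> ('i \<Rightarrow> real) \<Rightarrow> ('i \<Rightarrow> 'a::real_normed_vector) \<Rightarrow> ('i \<Rightarrow> 'a) \<Rightarrow> bool" where
  "slow I s m f g \<longleftrightarrow> bo I f s \<and> bo I g s \<and> bo I (\<lambda>i. g i - f i) (\<lambda>i. s i * m i)"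

abbreviation slow1 where "slow1 I \<equiv> slow I (\<lambda>_. 1)"

lemma slowD:
  assumes "slow I s m f g"
  shows "bo I f s" "bo I g s" "bo I (\<lambda>i. g i - f i) (\<lambda>i. s i * m i)"
  using assms by (simp_all add: slow_def)

lemma slow_const: "bo I f s \<Longrightarrow> slow I s m f f"
  by (simp add: slow_def)

lemma slow_add:
  assumes "slow I s m f g" "slow I s m f' g'"
  shows "slow I s m (\<lambda>i. f i + f' i) (\<lambda>i. g i + g' i)"
  using assms bo_add[OF slowD(3)[OF assms(1)] slowD(3)[OF assms(2)]]
  by (simp add: slow_def bo_add add_diff_add)

lemma slow_minus: "slow I s m f g \<Longrightarrow> slow I s m (\<lambda>i. - f i) (\<lambda>i. - g i)"
  using bo_minus[of I "\<lambda>i. g i - f i" "\<lambda>i. s i * m i"] by (simp add: slow_def bo_minus)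

lemma slow_diff:
  "slow I s m f g \<Longrightarrow> slow I s m f' g' \<Longrightarrow> slow I s m (\<lambda>i. f i - f' i) (\<lambda>i. g i - g' i)"
  using slow_add[OF _ slow_minus, of I s m f g f' g'] by simp

lemma slow_sum:
  "finite J \<Longrightarrow> (\<And>j. j \<in> J \<Longrightarrow> slow I s m (f j) (g j)) \<Longrightarrow>
   slow I s m (\<lambda>i. \<Sum>j\<in>J. f j i) (\<lambda>i. \<Sum>j\<in>J. g j i)"
  by (induction J rule: finite_induct) (auto intro: slow_add slow_const)

text \<open>Product rule for differences. Only one factor has size s and the other is O(1), so that
  the product has size s again.\<close>

lemma slow_bilinear:
  assumes pr: "bounded_bilinear pr" and f: "slow I s m f g" and f': "slow1 I m f' g'"
  shows "slow I s m (\<lambda>i. pr (f i) (f' i)) (\<lambda>i. pr (g i) (g' i))"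
proof -
  interpret pr: bounded_bilinear pr by (rule pr)
  have eq: "pr (g i) (g' i) - pr (f i) (f' i) = pr (g i - f i) (g' i) + pr (f i) (g' i - f' i)" for i
    by (simp add: pr.diff_left pr.diff_right)
  have "bo I (\<lambda>i. pr (g i - f i) (g' i)) (\<lambda>i. s i * m i)" "bo I (\<lambda>i. pr (f i) (g' i - f' i)) (\<lambda>i. s i * m i)"
    using bo_bilinear[OF pr slowD(3)[OF f] slowD(2)[OF f']]
      bo_bilinear[OF pr slowD(1)[OF f] slowD(3)[OF f']] by simp_all
  then show ?thesis
    using bo_bilinear[OF pr slowD(1)[OF f] slowD(1)[OF f']] bo_bilinear[OF pr slowD(2)[OF f] slowD(2)[OF f']]
    unfolding slow_def eq by (simp add: bo_add)
qed

lemma slow_bilinear':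
  assumes pr: "bounded_bilinear pr" and f: "slow1 I m f g" and f': "slow I s m f' g'"
  shows "slow I s m (\<lambda>i. pr (f i) (f' i)) (\<lambda>i. pr (g i) (g' i))"
  using slow_bilinear[OF bounded_bilinear.flip[OF pr] f' f] .

lemmas slow_mult = slow_bilinear[OF bounded_bilinear_mult]
  and slow_inner = slow_bilinear[OF bounded_bilinear_inner]
  and slow_scaleR = slow_bilinear[OF bounded_bilinear_scaleR]
  and slow_scaleR' = slow_bilinear'[OF bounded_bilinear_scaleR]
  and slow_mult' = slow_bilinear'[OF bounded_bilinear_mult]
  and slow_inner' = slow_bilinear'[OF bounded_bilinear_inner]
  and slow_cross3 = slow_bilinear[OF bounded_bilinear_cross3]
  and slow_blinfun' = slow_bilinear'[OF bounded_bilinear_blinfun_apply]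

lemma slow_divide_const: "slow I s m f g \<Longrightarrow> slow I s m (\<lambda>i. f i / (c::real)) (\<lambda>i. g i / c)"
  using slow_mult[of I s m f g "\<lambda>_. inverse c" "\<lambda>_. inverse c"] by (simp add: divide_inverse slow_const)

lemma slow_const1: "slow1 I m (\<lambda>_. c) (\<lambda>_. c)"
  by (simp add: slow_const)

lemma slow_norm:
  assumes "slow I s m f g"
  shows "slow I s m (\<lambda>i. norm (f i)) (\<lambda>i. norm (g i))"
proof -
  obtain C where C: "\<And>i. i \<in> I \<Longrightarrow> norm (g i - f i) \<le> C * \<bar>s i * m i\<bar>"
    using slowD(3)[OF assms] unfolding bo_def by blast
  have "bo I (\<lambda>i. norm (g i) - norm (f i)) (\<lambda>i. s i * m i)"
  proof (rule boI[where C = C])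
    show "norm (norm (g i) - norm (f i)) \<le> C * \<bar>s i * m i\<bar>" if "i \<in> I" for i
      using C[OF that] norm_triangle_ineq3[of "g i" "f i"] by simp
  qed
  then show ?thesis using slowD(1,2)[OF assms] by (simp add: slow_def bo_def)
qed

lemma slow_inverse:
  fixes f g :: "'i \<Rightarrow> real"
  assumes fg: "slow1 I m f g" and \<beta>: "\<beta> > 0" "\<And>i. i \<in> I \<Longrightarrow> \<beta> \<le> f i" "\<And>i. i \<in> I \<Longrightarrow> \<beta> \<le> g i"
  shows "slow1 I m (\<lambda>i. inverse (f i)) (\<lambda>i. inverse (g i))"
proof -
  have inv: "bo I (\<lambda>i. inverse (f i)) (\<lambda>_. 1)" "bo I (\<lambda>i. inverse (g i)) (\<lambda>_. 1)"
    by (rule bo_1I[where C = "inverse \<beta>"], use \<beta> in \<open>force intro!: le_imp_inverse_le\<close>)+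
  have "bo I (\<lambda>i. - (inverse (g i) * (inverse (f i) * (g i - f i)))) m"
    using bo_minus[OF bo_mult_left[OF inv(2) bo_mult_left[OF inv(1) slowD(3)[OF fg]]]] by simp
  moreover have "- (inverse (g i) * (inverse (f i) * (g i - f i))) = inverse (g i) - inverse (f i)" if "i \<in> I" for i
    using \<beta>(1) \<beta>(2,3)[OF that] by (simp add: field_simps)
  ultimately have "bo I (\<lambda>i. inverse (g i) - inverse (f i)) m"
    by (subst bo_cong) auto
  with inv show ?thesis by (simp add: slow_def)
qed


section \<open>The direction of the magnetic field\<close>

text \<open>The derivative as an element of a normed space, so that it can be bounded, compared at
  two points and fed to the bilinear rules for \<open>slow\<close>.\<close>

definition blin_deriv :: "(real^3 \<Rightarrow> real^3) \<Rightarrow> real^3 \<Rightarrow> (real^3) \<Rightarrow>\<^sub>L (real^3)" where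
  "blin_deriv f x = Blinfun (frechet_derivative f (at x))"

text \<open>The derivative of B/|B|: DB/|B| followed by projection onto the plane orthogonal to b.
  The projection yields the orthogonality required by \<open>osc2_rot\<close>.\<close>

definition unit_jacobian :: "(real^3 \<Rightarrow> real^3) \<Rightarrow> real^3 \<Rightarrow> real^3 \<Rightarrow> real^3" where
  "unit_jacobian B x w = inverse (norm (B x)) *\<^sub>R
     (blinfun_apply (blin_deriv B x) w - (unit_field B x \<bullet> blinfun_apply (blin_deriv B x) w) *\<^sub>R unit_field B x)"

text \<open>Smoothness enters the step estimates only through this predicate. It is local, on a
  convex S, because it will be used on small balls around points of the exact solution; the lower
  bound on |B| is assumed on K and extends only to points nearby.\<close>

definition regular ::
  "real \<Rightarrow> real \<Rightarrow> (real^3) set \<Rightarrow> (real^3 \<Rightarrow> real^3) \<Rightarrow> (real^3 \<Rightarrow> real^3) \<Rightarrow> bool" where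
  "regular L \<beta> S B E \<longleftrightarrow> convex S \<and>
     (\<forall>y\<in>S. B differentiable (at y) \<and> norm (B y) \<le> L \<and> \<beta> \<le> norm (B y) \<and>
        norm (blin_deriv B y) \<le> L \<and> norm (E y) \<le> L) \<and>
     (\<forall>y\<in>S. \<forall>z\<in>S. norm (B z - B y) \<le> L * norm (z - y) \<and>
        norm (blin_deriv B z - blin_deriv B y) \<le> L * norm (z - y) \<and> norm (E z - E y) \<le> L * norm (z - y))"

lemma regularD:
  assumes "regular L \<beta> S B E" "y \<in> S"
  shows "B differentiable (at y)" "\<beta> \<le> norm (B y)" "0 < \<beta> \<Longrightarrow> B y \<noteq> 0"
proof -
  show "B differentiable (at y)" and *: "\<beta> \<le> norm (B y)"
    using assms unfolding regular_def by blast+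
  show "B y \<noteq> 0" if "0 < \<beta>" using * that by auto
qed

lemma blinfun_apply_blin_deriv:
  "f differentiable (at x) \<Longrightarrow> blinfun_apply (blin_deriv f x) = frechet_derivative f (at x)"
  unfolding blin_deriv_def
  by (intro bounded_linear_Blinfun_apply linear_conv_bounded_linear[THEN iffD1] linear_frechet_derivative)

lemma has_derivative_blin_deriv:
  "f differentiable (at x) \<Longrightarrow> (f has_derivative blinfun_apply (blin_deriv f x)) (at x)"
  by (simp add: blinfun_apply_blin_deriv flip: frechet_derivative_works)

lemma linear_unit_jacobian: "linear (unit_jacobian B x)"
  by (intro linearI) (simp_all add: unit_jacobian_def blinfun.add_right blinfun.scaleR_right
      inner_add_right algebra_simps)

lemma inner_unit_jacobian: "B x \<noteq> 0 \<Longrightarrow> unit_field B x \<bullet> unit_jacobian B x w = 0"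
  by (simp add: unit_jacobian_def inner_diff_right norm_unit_field inner_unit)

lemma has_derivative_unit_field:
  assumes "B differentiable (at x)" "B x \<noteq> 0"
  shows "(unit_field B has_derivative unit_jacobian B x) (at x)"
proof -
  note D = has_derivative_blin_deriv[OF assms(1)]
  have N: "((\<lambda>x. norm (B x)) has_derivative (\<lambda>h. blinfun_apply (blin_deriv B x) h \<bullet> sgn (B x))) (at x)"
    using has_derivative_compose[OF D has_derivative_norm[OF assms(2)]] .
  have "((\<lambda>x. inverse (norm (B x)) *\<^sub>R B x) has_derivative
      (\<lambda>h. inverse (norm (B x)) *\<^sub>R blinfun_apply (blin_deriv B x) h +
         (- (inverse (norm (B x)) * (blinfun_apply (blin_deriv B x) h \<bullet> sgn (B x)) * inverse (norm (B x)))) *\<^sub>R B x)) (at x)"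
    by (rule has_derivative_scaleR[OF Deriv.has_derivative_inverse[OF _ N] D]) (simp add: assms(2))
  moreover have "unit_field B = (\<lambda>x. inverse (norm (B x)) *\<^sub>R B x)"
    by (simp add: unit_field_def fun_eq_iff)
  moreover have "(\<lambda>h. inverse (norm (B x)) *\<^sub>R blinfun_apply (blin_deriv B x) h +
         (- (inverse (norm (B x)) * (blinfun_apply (blin_deriv B x) h \<bullet> sgn (B x)) * inverse (norm (B x)))) *\<^sub>R B x)
      = unit_jacobian B x"
    by (simp add: unit_jacobian_def unit_field_def sgn_div_norm fun_eq_iff scaleR_diff_right inner_commute divide_inverse mult_ac)
  ultimately show ?thesis by simp
qed

text \<open>Used with m = h for the two ends of a step, and with m equal to a distance, in which
  case slowness is Lipschitz continuity.\<close>

locale field_family =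
  fixes I :: "'i set" and B E :: "'i \<Rightarrow> real^3 \<Rightarrow> real^3" and S :: "'i \<Rightarrow> (real^3) set"
    and x y :: "'i \<Rightarrow> real^3" and m :: "'i \<Rightarrow> real" and L \<beta> :: real
  assumes \<beta>: "0 < \<beta>"
    and reg: "i \<in> I \<Longrightarrow> regular L \<beta> (S i) (B i) (E i)"
    and xS: "i \<in> I \<Longrightarrow> x i \<in> S i" and yS: "i \<in> I \<Longrightarrow> y i \<in> S i"
    and xy: "bo I (\<lambda>i. y i - x i) m"
begin

lemma nz: "i \<in> I \<Longrightarrow> B i (x i) \<noteq> 0" "i \<in> I \<Longrightarrow> B i (y i) \<noteq> 0"
  using regularD(3)[OF reg xS \<beta>] regularD(3)[OF reg yS \<beta>] by blast+

lemma slow_lipschitz: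
  assumes "\<And>i. i \<in> I \<Longrightarrow> norm (f i) \<le> L" "\<And>i. i \<in> I \<Longrightarrow> norm (g i) \<le> L"
    and "\<And>i. i \<in> I \<Longrightarrow> norm (g i - f i) \<le> L * norm (y i - x i)"
  shows "slow1 I m f g"
proof -
  have "bo I (\<lambda>i. g i - f i) (\<lambda>i. norm (y i - x i))"
    by (rule boI[where C = L]) (simp add: assms(3))
  moreover have "bo I (\<lambda>i. norm (y i - x i)) m" using xy by (simp add: bo_def)
  ultimately show ?thesis unfolding slow_def using assms(1,2) by (auto intro: bo_1I bo_trans)
qed

lemma slow_B: "slow1 I m (\<lambda>i. B i (x i)) (\<lambda>i. B i (y i))"
  and slow_E: "slow1 I m (\<lambda>i. E i (x i)) (\<lambda>i. E i (y i))"
  and slow_blin_deriv: "slow1 I m (\<lambda>i. blin_deriv (B i) (x i)) (\<lambda>i. blin_deriv (B i) (y i))"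
  using reg xS yS unfolding regular_def by (intro slow_lipschitz; blast)+

lemma slow_inverse_norm: "slow1 I m (\<lambda>i. inverse (norm (B i (x i)))) (\<lambda>i. inverse (norm (B i (y i))))"
  using slow_norm[OF slow_B] \<beta>
  by (rule slow_inverse) (use reg xS yS in \<open>unfold regular_def, blast+\<close>)

lemma slow_unit_field: "slow1 I m (\<lambda>i. unit_field (B i) (x i)) (\<lambda>i. unit_field (B i) (y i))"
  unfolding unit_field_def by (rule slow_scaleR[OF slow_inverse_norm slow_B])

lemma slow_unit_jacobian:
  assumes w: "slow I s m w w'"
  shows "slow I s m (\<lambda>i. unit_jacobian (B i) (x i) (w i)) (\<lambda>i. unit_jacobian (B i) (y i) (w' i))"
proof -
  note J = slow_blinfun'[OF slow_blin_deriv w]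
  show ?thesis unfolding unit_jacobian_def
    by (rule slow_scaleR'[OF slow_inverse_norm slow_diff[OF J
          slow_scaleR[OF slow_inner'[OF slow_unit_field J] slow_unit_field]]])
qed

lemma slow_tr: "slow1 I m (\<lambda>i. tr3 (unit_jacobian (B i) (x i))) (\<lambda>i. tr3 (unit_jacobian (B i) (y i)))"
proof -
  have eq: "tr3 D = (\<Sum>k\<in>UNIV. D (axis k 1) \<bullet> axis k 1)" for D
    by (simp add: tr3_def inner_axis)
  show ?thesis unfolding eq
    by (intro slow_sum slow_inner slow_unit_jacobian slow_const1 finite)
qed

end

text \<open>The index set consists of all admissible tuples of fields, points and vectors at once,
  so the constant behind \<open>slow\<close> is uniform over them.\<close>

lemma unit_jacobian_lipschitz:
  assumes "0 < \<beta>"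
  obtains \<Lambda> where "\<Lambda> > 0" "\<And>S B E x y w. regular L \<beta> S B E \<Longrightarrow> x \<in> S \<Longrightarrow> y \<in> S \<Longrightarrow>
    norm (unit_jacobian B y w - unit_jacobian B x w) \<le> \<Lambda> * norm (y - x) * norm w"
proof -
  define I where "I = {(B, E, S, x, y, w::real^3). regular L \<beta> S B E \<and> x \<in> S \<and> y \<in> S}"
  let ?x = "\<lambda>(B, E, S, x, y, w). x" and ?y = "\<lambda>(B, E, S, x, y, w). y" and ?w = "\<lambda>(B, E, S, x, y, w). w"
  interpret field_family I "\<lambda>(B, E, S, x, y, w). B" "\<lambda>(B, E, S, x, y, w). E" "\<lambda>(B, E, S, x, y, w). S"
      ?x ?y "\<lambda>i. norm (?y i - ?x i)" L \<beta>
    by unfold_locales (use assms in \<open>auto simp: I_def bo_def intro!: exI[of _ 1]\<close>)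
  have "slow I (\<lambda>i. norm (?w i)) (\<lambda>i. norm (?y i - ?x i)) ?w ?w"
    by (intro slow_const boI[where C = 1]) simp
  from slowD(3)[OF slow_unit_jacobian[OF this]]
  obtain C where C: "C > 0" "\<And>i. i \<in> I \<Longrightarrow> norm (unit_jacobian ((\<lambda>(B, E, S, x, y, w). B) i) (?y i) (?w i)
      - unit_jacobian ((\<lambda>(B, E, S, x, y, w). B) i) (?x i) (?w i)) \<le> C * \<bar>norm (?w i) * norm (?y i - ?x i)\<bar>"
    by (rule boE) blast
  show thesis
  proof (rule that[OF C(1)])
    fix S B E x y and w :: "real^3"
    assume "regular L \<beta> S B E" "x \<in> S" "y \<in> S"
    then have "(B, E, S, x, y, w) \<in> I" by (simp add: I_def)
    from C(2)[OF this] show "norm (unit_jacobian B y w - unit_jacobian B x w) \<le> C * norm (y - x) * norm w"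
      by (simp add: mult_ac)
  qed
qed

text \<open>Mean value inequality on the segment for \<open>unit_field B\<close> minus its linear
  part at x, whose derivative is O(|y - x|) there.\<close>

lemma unit_field_taylor:
  assumes "0 < \<beta>"
  obtains \<Lambda> where "\<Lambda> > 0" "\<And>S B E x y. regular L \<beta> S B E \<Longrightarrow> x \<in> S \<Longrightarrow> y \<in> S \<Longrightarrow>
    norm (unit_field B y - unit_field B x - unit_jacobian B x (y - x)) \<le> \<Lambda> * (norm (y - x))\<^sup>2"
proof -
  obtain \<Lambda> where \<Lambda>: "\<Lambda> > 0" "\<And>S B E x y w. regular L \<beta> S B E \<Longrightarrow> x \<in> S \<Longrightarrow> y \<in> S \<Longrightarrow>
    norm (unit_jacobian B y w - unit_jacobian B x w) \<le> \<Lambda> * norm (y - x) * norm w"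
    using unit_jacobian_lipschitz[OF assms] by blast
  show thesis
  proof (rule that[OF \<Lambda>(1)])
    fix S B E x y
    assume R: "regular L \<beta> S B E" and xS: "x \<in> S" and yS: "y \<in> S"
    define T where "T = closed_segment x y"
    have TS: "T \<subseteq> S"
      using R xS yS unfolding T_def regular_def by (simp add: closed_segment_subset)
    define f where "f = (\<lambda>z. unit_field B z - unit_jacobian B x z)"
    have "norm (f y - f x) \<le> (\<Lambda> * norm (y - x)) * norm (y - x)"
    proof (rule differentiable_bound[where S = T and f' = "\<lambda>z w. unit_jacobian B z w - unit_jacobian B x w"])
      fix z assume z: "z \<in> T"
      then have zS: "z \<in> S" using TS by blast
      have "B differentiable (at z)" "B z \<noteq> 0"
        using regularD[OF R zS] assms by blast+
      then have "(unit_field B has_derivative unit_jacobian B z) (at z within T)"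
        by (rule has_derivative_at_withinI[OF has_derivative_unit_field])
      moreover have "(unit_jacobian B x has_derivative unit_jacobian B x) (at z within T)"
        by (intro linear_imp_has_derivative linear_unit_jacobian)
      ultimately show "(f has_derivative (\<lambda>w. unit_jacobian B z w - unit_jacobian B x w)) (at z within T)"
        unfolding f_def by (rule has_derivative_diff)
      have "norm (z - x) \<le> norm (y - x)"
        using segment_bound(1)[of z x y] z by (simp add: T_def)
      then have "\<Lambda> * norm (z - x) * norm w \<le> \<Lambda> * norm (y - x) * norm w" for w :: "real^3"
        using \<Lambda>(1) by (intro mult_right_mono mult_left_mono) auto
      then show "onorm (\<lambda>w. unit_jacobian B z w - unit_jacobian B x w) \<le> \<Lambda> * norm (y - x)"
        using \<Lambda>(2)[OF R xS zS] by (intro onorm_le) (meson order_trans)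
    qed (auto simp: T_def)
    then show "norm (unit_field B y - unit_field B x - unit_jacobian B x (y - x)) \<le> \<Lambda> * (norm (y - x))\<^sup>2"
      by (simp add: f_def linear_diff[OF linear_unit_jacobian] power2_eq_square algebra_simps)
  qed
qed

section \<open>Regularity from bounds on the derivatives up to order two\<close>

lemma derivs_bounded_mono:
  "derivs_bounded k L S f \<Longrightarrow> S' \<subseteq> S \<Longrightarrow> L \<le> L' \<Longrightarrow> derivs_bounded k L' S' f"
proof (induction k arbitrary: f)
  case 0
  then show ?case by force
next
  case (Suc k)
  then show ?case by (simp) (meson order_trans subsetD)
qed

lemma lipschitz_on_derivs_bounded:
  fixes f :: "real^3 \<Rightarrow> real^3"
  assumes f: "\<And>x. f differentiable (at x)" and L: "0 \<le> L" and S: "convex S"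
    and d: "\<And>u x. norm u \<le> 1 \<Longrightarrow> x \<in> S \<Longrightarrow> norm (frechet_derivative f (at x) u) \<le> L"
  shows "x \<in> S \<Longrightarrow> norm (frechet_derivative f (at x) w) \<le> L * norm w"
    and "x \<in> S \<Longrightarrow> y \<in> S \<Longrightarrow> norm (f y - f x) \<le> L * norm (y - x)"
proof -
  have lin: "linear (frechet_derivative f (at x))" for x
    using f by (rule linear_frechet_derivative)
  have *: "norm (frechet_derivative f (at x) w) \<le> L * norm w" if "x \<in> S" for x w
  proof (cases "w = 0")
    case True
    then show ?thesis using linear_0[OF lin] by simp
  next
    case False
    then have "frechet_derivative f (at x) w = norm w *\<^sub>R frechet_derivative f (at x) (w /\<^sub>R norm w)"
      by (simp add: linear_cmul[OF lin])
    moreover have "norm (frechet_derivative f (at x) (w /\<^sub>R norm w)) \<le> L"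
      using False that by (intro d) auto
    ultimately show ?thesis by (simp add: mult.commute[of "norm w"] mult_right_mono)
  qed
  then show "x \<in> S \<Longrightarrow> norm (frechet_derivative f (at x) w) \<le> L * norm w" .
  show "norm (f y - f x) \<le> L * norm (y - x)" if "x \<in> S" "y \<in> S"
  proof (rule differentiable_bound[OF S _ _ that(2,1)])
    show "(f has_derivative frechet_derivative f (at z)) (at z within S)" for z
      using f frechet_derivative_works has_derivative_at_withinI by blast
    show "onorm (frechet_derivative f (at z)) \<le> L" if "z \<in> S" for z
      by (intro onorm_le *[OF that])
  qed
qed

text \<open>The bound of order two on B makes DB Lipschitz: first x -> DB(x) u for each fixed u in
  the unit ball, then, by homogeneity in u, DB in the operator norm.\<close>

lemma regularI:
  assumes "C_order 2 B" "C_order 2 E" "derivs_bounded 2 L S B" "derivs_bounded 2 L S E"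
    and "\<And>y. y \<in> S \<Longrightarrow> \<beta> \<le> norm (B y)" and "convex S" and "0 \<le> L"
  shows "regular L \<beta> S B E"
proof -
  have dB: "B differentiable (at x)" and dE: "E differentiable (at x)"
    and dB2: "(\<lambda>x. frechet_derivative B (at x) u) differentiable (at x)" for x u
    using assms(1,2) by (auto simp: numeral_2_eq_2)
  have bB: "norm (B x) \<le> L" and bE: "norm (E x) \<le> L" if "x \<in> S" for x
    using assms(3,4) that by (auto simp: numeral_2_eq_2)
  have b1: "norm (frechet_derivative B (at x) u) \<le> L" "norm (frechet_derivative E (at x) u) \<le> L"
    if "norm u \<le> 1" "x \<in> S" for u x
    using assms(3,4) that by (auto simp: numeral_2_eq_2)
  have b2: "norm (frechet_derivative (\<lambda>x. frechet_derivative B (at x) u) (at x) w) \<le> L"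
    if "norm u \<le> 1" "norm w \<le> 1" "x \<in> S" for u w x
    using assms(3) that by (auto simp: numeral_2_eq_2)
  note lB = lipschitz_on_derivs_bounded[OF dB assms(7,6) b1(1)]
  note lE = lipschitz_on_derivs_bounded[OF dE assms(7,6) b1(2)]
  have lB2: "norm (frechet_derivative B (at y) u - frechet_derivative B (at x) u) \<le> L * norm (y - x)"
    if "norm u \<le> 1" "x \<in> S" "y \<in> S" for u x y
    using lipschitz_on_derivs_bounded(2)[OF dB2 assms(7,6) b2[OF that(1)] that(2,3)] .
  have "norm (blin_deriv B y - blin_deriv B x) \<le> L * norm (y - x)" if "x \<in> S" "y \<in> S" for x y
  proof (rule norm_blinfun_bound)
    fix w
    show "norm (blinfun_apply (blin_deriv B y - blin_deriv B x) w) \<le> L * norm (y - x) * norm w"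
    proof (cases "w = 0")
      case False
      then have "blinfun_apply (blin_deriv B y - blin_deriv B x) w
        = norm w *\<^sub>R blinfun_apply (blin_deriv B y - blin_deriv B x) (w /\<^sub>R norm w)"
        by (simp add: blinfun.scaleR_right)
      moreover have "norm (blinfun_apply (blin_deriv B y - blin_deriv B x) (w /\<^sub>R norm w)) \<le> L * norm (y - x)"
        using lB2[of "w /\<^sub>R norm w" x y] that False by (simp add: blinfun.diff_left blinfun_apply_blin_deriv[OF dB])
      ultimately show ?thesis by (simp add: mult.commute[of "norm w"] mult_right_mono)
    qed simp
  qed (use assms(7) in simp)
  moreover have "norm (blin_deriv B x) \<le> L" if "x \<in> S" for x
    by (rule norm_blinfun_bound[OF assms(7)]) (simp add: blinfun_apply_blin_deriv[OF dB] lB(1)[OF _ _ that])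
  ultimately show ?thesis
    unfolding regular_def using dB bB bE lB(2) lE(2) assms(5,6) by blast
qed


section \<open>One step in the slow variables\<close>

definition angle :: "(real^3 \<Rightarrow> real^3) \<Rightarrow> real \<Rightarrow> real \<Rightarrow> real^3 \<Rightarrow> real" where
  "angle B \<epsilon> h x = h / \<epsilon> * norm (B x)"

definition turned :: "(real^3 \<Rightarrow> real^3) \<Rightarrow> real \<Rightarrow> real \<Rightarrow> real^3 \<Rightarrow> real^3 \<Rightarrow> real^3" where
  "turned B \<epsilon> h x v = rot (angle B \<epsilon> h x) (unit_field B x) v"

text \<open>
  The flag \<open>exact\<close> is true when the full force \<open>E x\<close> acts after the rotation (S1-AVF, S1-SV and small
  steps of the exact flow) and false for S1-VP, where the force is filtered by \<open>\<phi>\<^sub>1\<close>.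
\<close>

definition forcing ::
  "bool \<Rightarrow> (real^3 \<Rightarrow> real^3) \<Rightarrow> (real^3 \<Rightarrow> real^3) \<Rightarrow> real \<Rightarrow> real \<Rightarrow> real^3 \<Rightarrow> real^3" where
  "forcing exact B E \<epsilon> h x =
     (if exact then E x else rot_phi1 (angle B \<epsilon> h x) (unit_field B x) (E x))"

definition nonresonant :: "(real^3 \<Rightarrow> real^3) \<Rightarrow> real \<Rightarrow> real \<Rightarrow> real \<Rightarrow> real^3 \<Rightarrow> bool" where
  "nonresonant B \<epsilon> h \<gamma> x \<longleftrightarrow> \<gamma> * (h / \<epsilon>) \<le> \<bar>sin (angle B \<epsilon> h x / 2)\<bar> \<and> \<gamma> * (h / \<epsilon>) \<le> \<bar>sin (angle B \<epsilon> h x)\<bar>"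

text \<open>An error of h \<epsilon> per step is what a sum over T/h steps can absorb. It covers the
  O(h^2) errors of the schemes, because h <= C \<epsilon>, and the substeps of the exact flow, whose
  error will only be known to be at most \<epsilon> times the substep.\<close>

definition split_step ::
  "real \<Rightarrow> real \<Rightarrow> real \<Rightarrow> real \<Rightarrow> real \<Rightarrow> real \<Rightarrow> bool \<Rightarrow> (real^3 \<Rightarrow> real^3) \<Rightarrow> (real^3 \<Rightarrow> real^3) \<Rightarrow>
   (real^3) set \<Rightarrow> real \<Rightarrow> real \<Rightarrow> real^3 \<Rightarrow> real^3 \<Rightarrow> real^3 \<Rightarrow> real^3 \<Rightarrow> bool" where
  "split_step L \<beta> M C \<gamma> \<Lambda> exact B E S \<epsilon> h x v y w \<longleftrightarrow>
     regular L \<beta> S B E \<and> x \<in> S \<and> y \<in> S \<and> 0 < \<epsilon> \<and> \<epsilon> \<le> 1 \<and> 0 < h \<and> h \<le> C * \<epsilon> \<and> norm v \<le> M \<and>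
     nonresonant B \<epsilon> h \<gamma> x \<and> nonresonant B \<epsilon> h \<gamma> y \<and>
     norm (y - x - h *\<^sub>R turned B \<epsilon> h x v) \<le> \<Lambda> * (h * \<epsilon>) \<and>
     norm (w - turned B \<epsilon> h x v - h *\<^sub>R forcing exact B E \<epsilon> h x) \<le> \<Lambda> * (h * \<epsilon>)"

definition corr1 :: "(real^3 \<Rightarrow> real^3) \<Rightarrow> real \<Rightarrow> real \<Rightarrow> real^3 \<Rightarrow> real^3 \<Rightarrow> real^3" where
  "corr1 B \<epsilon> h x v = osc1 h (angle B \<epsilon> h x) (unit_field B x) v"

definition corr2 :: "(real^3 \<Rightarrow> real^3) \<Rightarrow> real \<Rightarrow> real \<Rightarrow> real^3 \<Rightarrow> real^3 \<Rightarrow> real" where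
  "corr2 B \<epsilon> h x v = osc2 h (angle B \<epsilon> h x) (unit_field B x) (unit_jacobian B x) v"

text \<open>In the filtered case this is the difference term of \<open>inner_rot_phi1\<close>
  multiplied by h, where h/\<theta> = \<epsilon>/|B|.\<close>

definition corr3 ::
  "bool \<Rightarrow> (real^3 \<Rightarrow> real^3) \<Rightarrow> (real^3 \<Rightarrow> real^3) \<Rightarrow> real \<Rightarrow> real \<Rightarrow> real^3 \<Rightarrow> real^3 \<Rightarrow> real" where
  "corr3 exact B E \<epsilon> h x v =
     (if exact then E x \<bullet> corr1 B \<epsilon> h x v
      else - (\<epsilon> * inverse (norm (B x)) * (E x \<bullet> cross3 v (unit_field B x))))"

lemma cot_diff:
  fixes a b :: real
  assumes "sin a \<noteq> 0" "sin b \<noteq> 0"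
  shows "cos b / sin b - cos a / sin a = sin (a - b) / (sin a * sin b)"
  using assms by (simp add: sin_diff field_simps)

lemma abs_sin_le: "\<bar>sin x\<bar> \<le> \<bar>x\<bar>" for x :: real
  using abs_sin_x_le_abs_x by blast

text \<open>Division by a sine of size h/\<epsilon> turns the prefactor h into \<epsilon>. A
  difference of cotangents divides by two sines, which leaves \<epsilon>^2/h times the change of the
  angle; between neighbouring positions the angle changes by O(h^2/\<epsilon>), hence the cotangent
  term by O(h \<epsilon>).\<close>

lemma half_cot_bounds:
  assumes \<gamma>: "0 < \<gamma>" and e: "0 < \<epsilon>" "0 < h"
    and s: "\<gamma> * (h / \<epsilon>) \<le> \<bar>sin \<phi>\<bar>" "\<gamma> * (h / \<epsilon>) \<le> \<bar>sin \<psi>\<bar>"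
  shows "\<bar>half_cot h \<phi>\<bar> \<le> inverse \<gamma> * \<epsilon>"
    and "\<bar>half_cot h \<psi> - half_cot h \<phi>\<bar> \<le> (inverse \<gamma>)\<^sup>2 * (\<epsilon>\<^sup>2 * \<bar>\<psi> - \<phi>\<bar> / h)"
proof -
  define \<sigma> where "\<sigma> = \<gamma> * (h / \<epsilon>)"
  have \<sigma>: "0 < \<sigma>" using \<gamma> e by (simp add: \<sigma>_def)
  note s = s[folded \<sigma>_def]
  have nz: "sin \<phi> \<noteq> 0" "sin \<psi> \<noteq> 0" using s \<sigma> by auto
  have "\<bar>half_cot h \<phi>\<bar> = (h / 2) * (\<bar>cos \<phi>\<bar> / \<bar>sin \<phi>\<bar>)"
    using e by (simp add: half_cot_def abs_mult)
  also have "\<dots> \<le> h * (1 / \<sigma>)"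
    using e s \<sigma> abs_cos_le_one[of \<phi>] by (intro mult_mono frac_le) auto
  also have "\<dots> = inverse \<gamma> * \<epsilon>" using e \<gamma> by (simp add: \<sigma>_def field_simps)
  finally show "\<bar>half_cot h \<phi>\<bar> \<le> inverse \<gamma> * \<epsilon>" .
  have "half_cot h \<psi> - half_cot h \<phi> = (h / 2) * (sin (\<phi> - \<psi>) / (sin \<phi> * sin \<psi>))"
    unfolding half_cot_def by (simp add: cot_diff[OF nz, symmetric] right_diff_distrib)
  then have "\<bar>half_cot h \<psi> - half_cot h \<phi>\<bar> = (h / 2) * (\<bar>sin (\<phi> - \<psi>)\<bar> / (\<bar>sin \<phi>\<bar> * \<bar>sin \<psi>\<bar>))"
    using e by (simp add: abs_mult)
  also have "\<dots> \<le> h * (\<bar>\<psi> - \<phi>\<bar> / (\<sigma> * \<sigma>))"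
    using e s \<sigma> abs_sin_le[of "\<phi> - \<psi>"] by (intro mult_mono frac_le) (auto simp: abs_minus_commute)
  also have "\<dots> = (inverse \<gamma>)\<^sup>2 * (\<epsilon>\<^sup>2 * \<bar>\<psi> - \<phi>\<bar> / h)"
    using e \<gamma> by (simp add: \<sigma>_def field_simps power2_eq_square)
  finally show "\<bar>half_cot h \<psi> - half_cot h \<phi>\<bar> \<le> (inverse \<gamma>)\<^sup>2 * (\<epsilon>\<^sup>2 * \<bar>\<psi> - \<phi>\<bar> / h)" .
qed

lemma bo_if:
  assumes "bo I f h" "bo I g h"
  shows "bo I (\<lambda>i. if P i then f i else g i) h"
proof -
  obtain C where C: "C > 0" "\<And>i. i \<in> I \<Longrightarrow> norm (f i) \<le> C * \<bar>h i\<bar>"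
    using assms(1) by (rule boE) blast
  obtain D where D: "D > 0" "\<And>i. i \<in> I \<Longrightarrow> norm (g i) \<le> D * \<bar>h i\<bar>"
    using assms(2) by (rule boE) blast
  show ?thesis
  proof (rule boI[where C = "C + D"])
    fix i assume "i \<in> I"
    then show "norm (if P i then f i else g i) \<le> (C + D) * \<bar>h i\<bar>"
      using C(2)[of i] D(2)[of i] C(1) D(1)
      by (simp add: distrib_right add_increasing add_increasing2)
  qed
qed

lemma slow_if:
  assumes "slow I s m f f'" "slow I s m g g'"
  shows "slow I s m (\<lambda>i. if P i then f i else g i) (\<lambda>i. if P i then f' i else g' i)"
proof -
  have eq: "(if P i then f' i else g' i) - (if P i then f i else g i) = (if P i then f' i - f i else g' i - g i)" for i
    by simp
  show ?thesis using assms unfolding slow_def eq by (auto intro: bo_if)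
qed

lemma abs_sin_div_le: "\<bar>sin z / z\<bar> \<le> 1" "\<bar>(1 - cos z) / z\<bar> \<le> 1" for z :: real
proof -
  show "\<bar>sin z / z\<bar> \<le> 1" using abs_sin_le[of z] by (cases "z = 0") (auto simp: field_simps)
  have "\<bar>1 - cos z\<bar> = 2 * \<bar>sin (z/2)\<bar> * \<bar>sin (z/2)\<bar>"
    using cos_double_sin[of "z/2"] by (simp add: power2_eq_square abs_mult)
  also have "\<dots> \<le> 2 * \<bar>z/2\<bar> * 1"
    using abs_sin_le[of "z/2"] by (intro mult_mono) auto
  finally show "\<bar>(1 - cos z) / z\<bar> \<le> 1" by (cases "z = 0") (auto simp: field_simps)
qed

locale step_family =
  fixes I :: "'i set" and exact :: "'i \<Rightarrow> bool" and B E :: "'i \<Rightarrow> real^3 \<Rightarrow> real^3" and S :: "'i \<Rightarrow> (real^3) set"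
    and \<epsilon> h :: "'i \<Rightarrow> real" and x v y w :: "'i \<Rightarrow> real^3" and L \<beta> M C \<gamma> \<Lambda> :: real
  assumes \<beta>: "0 < \<beta>" and \<gamma>: "0 < \<gamma>"
    and step: "i \<in> I \<Longrightarrow> split_step L \<beta> M C \<gamma> \<Lambda> (exact i) (B i) (E i) (S i) (\<epsilon> i) (h i) (x i) (v i) (y i) (w i)"
begin

abbreviation "b i \<equiv> unit_field (B i) (x i)"
abbreviation "\<theta> i \<equiv> angle (B i) (\<epsilon> i) (h i) (x i)"
abbreviation "\<theta>' i \<equiv> angle (B i) (\<epsilon> i) (h i) (y i)"
abbreviation "vt i \<equiv> turned (B i) (\<epsilon> i) (h i) (x i) (v i)"
abbreviation "F i \<equiv> forcing (exact i) (B i) (E i) (\<epsilon> i) (h i) (x i)"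
abbreviation "he i \<equiv> h i * \<epsilon> i"

lemma pos: "i \<in> I \<Longrightarrow> 0 < \<epsilon> i" "i \<in> I \<Longrightarrow> \<epsilon> i \<le> 1" "i \<in> I \<Longrightarrow> 0 < h i" "i \<in> I \<Longrightarrow> h i \<le> C * \<epsilon> i"
  using step unfolding split_step_def by auto

lemma regx: "i \<in> I \<Longrightarrow> regular L \<beta> (S i) (B i) (E i)" "i \<in> I \<Longrightarrow> x i \<in> S i" "i \<in> I \<Longrightarrow> y i \<in> S i"
  using step unfolding split_step_def by auto

lemma Bx: "i \<in> I \<Longrightarrow> \<beta> \<le> norm (B i (x i))" "i \<in> I \<Longrightarrow> B i (x i) \<noteq> 0"
  using regularD(2,3)[OF regx(1,2)] \<beta> by blast+

lemma unit_b: "i \<in> I \<Longrightarrow> norm (b i) = 1"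
  using Bx by (simp add: norm_unit_field)

lemma bo_h: "bo I h \<epsilon>" and bo_\<epsilon>: "bo I \<epsilon> (\<lambda>_. 1)"
  by (rule boI[where C = C], use pos in force) (rule bo_1I[where C = 1], use pos in force)

lemma bo_h1: "bo I h (\<lambda>_. 1)"
  using bo_trans[OF bo_h bo_\<epsilon>] .

lemma bo_he: "bo I he h"
  using bo_mult_left[OF bo_\<epsilon> bo_refl[of I h]] by (simp add: mult.commute)

lemma bo_hh: "bo I (\<lambda>i. h i * h i) he"
  using bo_mult[OF bo_refl bo_h] .

lemma norm_turned: "i \<in> I \<Longrightarrow> norm (vt i) = norm (v i)"
  by (simp add: turned_def norm_rot unit_b)

lemma bo_v: "bo I v (\<lambda>_. 1)" and bo_turned: "bo I vt (\<lambda>_. 1)"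
  by (rule bo_1I[where C = M], use step norm_turned in \<open>force simp: split_step_def\<close>)+

lemma err_x: "bo I (\<lambda>i. y i - x i - h i *\<^sub>R vt i) he"
  and err_v: "bo I (\<lambda>i. w i - vt i - h i *\<^sub>R F i) he"
  by (rule boI[where C = \<Lambda>], use step pos in \<open>force simp: split_step_def\<close>)+

lemma bo_yx: "bo I (\<lambda>i. y i - x i) h"
  using bo_add[OF bo_trans[OF err_x bo_he] bo_scaleR[OF bo_refl[of I h] bo_turned, simplified]] by simp

sublocale field_family I B E S x y h L \<beta>
  using \<beta> regx bo_yx by unfold_locales auto

lemma \<theta>_nz: "i \<in> I \<Longrightarrow> \<theta> i \<noteq> 0" 
  using pos[of i] Bx[of i] by (simp add: angle_def)

lemma sin_nz: assumes "i \<in> I" shows "sin (\<theta> i / 2) \<noteq> 0" "sin (\<theta> i) \<noteq> 0"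
proof -
  have "0 < \<gamma> * (h i / \<epsilon> i)" using pos[OF assms] \<gamma> by simp
  then show "sin (\<theta> i / 2) \<noteq> 0" "sin (\<theta> i) \<noteq> 0"
    using step[OF assms] unfolding split_step_def nonresonant_def by auto
qed

lemma bo_E: "bo I (\<lambda>i. E i (x i)) (\<lambda>_. 1)"
  using slowD(1)[OF slow_E] .

lemma bo_b: "bo I b (\<lambda>_. 1)"
  using slowD(1)[OF slow_unit_field] .

lemma bo_perp: "bo I (\<lambda>i. perp (b i) (E i (x i))) (\<lambda>_. 1)"
  unfolding perp_def using bo_diff[OF bo_E bo_scaleR[OF bo_inner[OF bo_b bo_E] bo_b, simplified]] .

lemma bo_F: "bo I F (\<lambda>_. 1)"
proof -
  have 1: "bo I (\<lambda>i. sin (\<theta> i) / \<theta> i) (\<lambda>_. 1)" "bo I (\<lambda>i. (1 - cos (\<theta> i)) / \<theta> i) (\<lambda>_. 1)"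
    by (rule bo_1I[where C = 1], use abs_sin_div_le in simp)+
  have "bo I (\<lambda>i. rot_phi1 (\<theta> i) (b i) (E i (x i))) (\<lambda>_. 1)"
    unfolding rot_phi1_def
    using bo_scaleR[OF bo_inner[OF bo_b bo_E] bo_b] bo_scaleR[OF 1(1) bo_perp]
      bo_scaleR[OF 1(2) bo_bilinear[OF bounded_bilinear_cross3 bo_E bo_b]] by (simp add: bo_add)
  then show ?thesis unfolding forcing_def by (intro bo_if bo_E)
qed

lemma bo_wv: "bo I (\<lambda>i. w i - vt i) h"
  using bo_add[OF bo_trans[OF err_v bo_he] bo_scaleR[OF bo_refl[of I h] bo_F, simplified]] by simp

text \<open>The state before the step is represented by the turned velocity. The original
  \<open>v\<close> may differ from \<open>w\<close> by O(1), and that difference is left to the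
  exact rotation identities of the correctors.\<close>

lemma slow_v: "slow1 I h vt w"
proof -
  have "bo I w (\<lambda>_. 1)" using bo_add[OF bo_trans[OF bo_wv bo_h1] bo_turned] by simp
  then show ?thesis using bo_wv bo_turned by (simp add: slow_def)
qed

lemma slow_half_cot:
  assumes "0 \<le> a" and s: "\<And>i. i \<in> I \<Longrightarrow> \<gamma> * (h i / \<epsilon> i) \<le> \<bar>sin (a * \<theta> i)\<bar>"
    "\<And>i. i \<in> I \<Longrightarrow> \<gamma> * (h i / \<epsilon> i) \<le> \<bar>sin (a * \<theta>' i)\<bar>"
  shows "slow I \<epsilon> h (\<lambda>i. half_cot (h i) (a * \<theta> i)) (\<lambda>i. half_cot (h i) (a * \<theta>' i))"
proof -
  obtain K where K: "K > 0" "\<And>i. i \<in> I \<Longrightarrow> \<bar>norm (B i (y i)) - norm (B i (x i))\<bar> \<le> K * \<bar>h i\<bar>"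
    using boE[OF slowD(3)[OF slow_norm[OF slow_B]]] by auto
  have "bo I (\<lambda>i. half_cot (h i) (a * \<theta> i)) \<epsilon>" "bo I (\<lambda>i. half_cot (h i) (a * \<theta>' i)) \<epsilon>"
    by (rule boI[where C = "inverse \<gamma>"],
        use half_cot_bounds(1)[OF \<gamma> pos(1,3) s(1) s(2)] half_cot_bounds(1)[OF \<gamma> pos(1,3) s(2) s(1)] pos(1)
        in \<open>simp add: abs_of_pos\<close>)+
  moreover have "bo I (\<lambda>i. half_cot (h i) (a * \<theta>' i) - half_cot (h i) (a * \<theta> i)) (\<lambda>i. \<epsilon> i * h i)"
  proof (rule boI[where C = "(inverse \<gamma>)\<^sup>2 * (a * K)"])
    fix i assume i: "i \<in> I"
    note p = pos(1,3)[OF i]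
    have "\<bar>a * \<theta>' i - a * \<theta> i\<bar> = a * (h i / \<epsilon> i * \<bar>norm (B i (y i)) - norm (B i (x i))\<bar>)"
    proof -
      have "a * \<theta>' i - a * \<theta> i = a * (h i / \<epsilon> i * (norm (B i (y i)) - norm (B i (x i))))"
        by (simp add: angle_def diff_divide_distrib right_diff_distrib)
      then show ?thesis using p assms(1) by (simp add: abs_mult)
    qed
    also have "\<dots> \<le> a * (h i / \<epsilon> i * (K * h i))"
      using K(2)[OF i] p assms(1) by (intro mult_left_mono) auto
    finally have "\<epsilon> i * \<epsilon> i * \<bar>a * \<theta>' i - a * \<theta> i\<bar> / h i \<le> \<epsilon> i * \<epsilon> i * (a * (h i / \<epsilon> i * (K * h i))) / h i"
      using p by (intro divide_right_mono mult_left_mono) auto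
    also have "\<dots> = a * K * (\<epsilon> i * h i)" using p by (simp add: field_simps)
    finally have "(inverse \<gamma>)\<^sup>2 * ((\<epsilon> i)\<^sup>2 * \<bar>a * \<theta>' i - a * \<theta> i\<bar> / h i) \<le> (inverse \<gamma>)\<^sup>2 * (a * K * (\<epsilon> i * h i))"
      by (intro mult_left_mono) (auto simp: power2_eq_square)
    with half_cot_bounds(2)[OF \<gamma> p s(1)[OF i] s(2)[OF i]] p
    show "norm (half_cot (h i) (a * \<theta>' i) - half_cot (h i) (a * \<theta> i)) \<le> (inverse \<gamma>)\<^sup>2 * (a * K) * \<bar>\<epsilon> i * h i\<bar>"
      by (simp add: abs_mult mult_ac)
  qed
  ultimately show ?thesis by (simp add: slow_def)
qed

lemma slow_hc1: "slow I \<epsilon> h (\<lambda>i. half_cot (h i) (\<theta> i / 2)) (\<lambda>i. half_cot (h i) (\<theta>' i / 2))"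
  using slow_half_cot[of "1/2"] step unfolding split_step_def nonresonant_def by simp

lemma slow_hc2: "slow I \<epsilon> h (\<lambda>i. half_cot (h i) (\<theta> i)) (\<lambda>i. half_cot (h i) (\<theta>' i))"
  using slow_half_cot[of "1"] step unfolding split_step_def nonresonant_def by simp

lemma slow_h: "slow I \<epsilon> h (\<lambda>i. h i / 2) (\<lambda>i. h i / 2)"
  by (intro slow_divide_const slow_const bo_h)

lemma slow_u: "slow1 I h (\<lambda>i. b i \<bullet> vt i) (\<lambda>i. unit_field (B i) (y i) \<bullet> w i)"
  by (rule slow_inner[OF slow_unit_field slow_v])

lemma slow_p: "slow1 I h (\<lambda>i. perp (b i) (vt i)) (\<lambda>i. perp (unit_field (B i) (y i)) (w i))"
  unfolding perp_def by (rule slow_diff[OF slow_v slow_scaleR[OF slow_u slow_unit_field]])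

lemma slow_q: "slow1 I h (\<lambda>i. cross3 (vt i) (b i)) (\<lambda>i. cross3 (w i) (unit_field (B i) (y i)))"
  by (rule slow_cross3[OF slow_v slow_unit_field])

lemma slow_corr1:
  "slow I \<epsilon> h (\<lambda>i. corr1 (B i) (\<epsilon> i) (h i) (x i) (vt i)) (\<lambda>i. corr1 (B i) (\<epsilon> i) (h i) (y i) (w i))"
  unfolding corr1_def osc1_def
  by (rule slow_diff[OF slow_scaleR[OF slow_h slow_p] slow_scaleR[OF slow_hc1 slow_q]])

lemma slow_corr2:
  "slow I \<epsilon> h (\<lambda>i. corr2 (B i) (\<epsilon> i) (h i) (x i) (vt i)) (\<lambda>i. corr2 (B i) (\<epsilon> i) (h i) (y i) (w i))"
  unfolding corr2_def osc2_def dev2_def mix2_def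
  using slow_corr1[unfolded corr1_def]
  by (intro slow_diff slow_add slow_mult'[OF slow_u] slow_inner'[OF slow_unit_jacobian[OF slow_unit_field]]
      slow_mult[OF slow_h] slow_mult[OF slow_hc2] slow_divide_const slow_inner[OF slow_p]
      slow_inner[OF slow_q] slow_unit_jacobian slow_p slow_q)

lemma slow_corr3:
  "slow I \<epsilon> h (\<lambda>i. corr3 (exact i) (B i) (E i) (\<epsilon> i) (h i) (x i) (vt i))
     (\<lambda>i. corr3 (exact i) (B i) (E i) (\<epsilon> i) (h i) (y i) (w i))"
  unfolding corr3_def
  by (intro slow_if slow_minus slow_inner'[OF slow_E slow_corr1] slow_mult[OF slow_mult[OF slow_const[OF bo_refl]
      slow_inverse_norm]] slow_inner[OF slow_E slow_q])

end


section \<open>Increments of the corrected slow variables\<close>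

definition slow_pos :: "(real^3 \<Rightarrow> real^3) \<Rightarrow> real \<Rightarrow> real \<Rightarrow> real^3 \<Rightarrow> real^3 \<Rightarrow> real^3" where
  "slow_pos B \<epsilon> h x v = x - corr1 B \<epsilon> h x v"

definition slow_par :: "(real^3 \<Rightarrow> real^3) \<Rightarrow> real \<Rightarrow> real \<Rightarrow> real^3 \<Rightarrow> real^3 \<Rightarrow> real" where
  "slow_par B \<epsilon> h x v = unit_field B x \<bullet> v - corr2 B \<epsilon> h x v"

definition slow_en ::
  "bool \<Rightarrow> (real^3 \<Rightarrow> real^3) \<Rightarrow> (real^3 \<Rightarrow> real^3) \<Rightarrow> real \<Rightarrow> real \<Rightarrow> real^3 \<Rightarrow> real^3 \<Rightarrow> real" where
  "slow_en exact B E \<epsilon> h x v = (norm v)\<^sup>2 / 2 - corr3 exact B E \<epsilon> h x v"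

definition avg_pos :: "(real^3 \<Rightarrow> real^3) \<Rightarrow> real^3 \<Rightarrow> real \<Rightarrow> real^3" where
  "avg_pos B x u = u *\<^sub>R unit_field B x"

text \<open>The first term, perpendicular kinetic energy times the divergence of b, is the magnetic
  mirror force; it is the mean of v . Db v over the rotation, with e = |v|^2/2.\<close>

definition avg_par ::
  "(real^3 \<Rightarrow> real^3) \<Rightarrow> (real^3 \<Rightarrow> real^3) \<Rightarrow> real^3 \<Rightarrow> real \<Rightarrow> real \<Rightarrow> real" where
  "avg_par B E x u e = (e - u * u / 2) * tr3 (unit_jacobian B x) + unit_field B x \<bullet> E x"

definition avg_en :: "(real^3 \<Rightarrow> real^3) \<Rightarrow> (real^3 \<Rightarrow> real^3) \<Rightarrow> real^3 \<Rightarrow> real \<Rightarrow> real" where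
  "avg_en B E x u = u * (unit_field B x \<bullet> E x)"

lemma bo_divide_const: "bo I f g \<Longrightarrow> bo I (\<lambda>i. f i / (c::real)) g"
  using bo_mult_left[OF bo_const, of I f g "inverse c"] by (simp add: divide_inverse mult.commute)

context step_family
begin

abbreviation "u i \<equiv> b i \<bullet> v i"
abbreviation "en i \<equiv> (norm (v i))\<^sup>2 / 2"

lemma inner_b_turned: "i \<in> I \<Longrightarrow> b i \<bullet> vt i = u i"
  by (simp add: turned_def inner_rot unit_b)

lemma corr1_turned:
  "i \<in> I \<Longrightarrow> corr1 (B i) (\<epsilon> i) (h i) (x i) (vt i) - corr1 (B i) (\<epsilon> i) (h i) (x i) (v i)
     = h i *\<^sub>R vt i - (h i * u i) *\<^sub>R b i"
  unfolding corr1_def turned_def by (rule osc1_rot[OF unit_b sin_nz(1)])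

lemma corr2_turned:
  assumes i: "i \<in> I"
  shows "corr2 (B i) (\<epsilon> i) (h i) (x i) (vt i) - corr2 (B i) (\<epsilon> i) (h i) (x i) (v i)
     = h i * (vt i \<bullet> unit_jacobian (B i) (x i) (vt i))
       - h i * ((en i - u i * u i / 2) * tr3 (unit_jacobian (B i) (x i)))"
  unfolding corr2_def turned_def
  using osc2_rot[OF unit_b[OF i] linear_unit_jacobian[of "B i" "x i"] inner_unit_jacobian[of "B i" "x i", OF Bx(2)[OF i]]
      sin_nz[OF i], of "h i" "v i"]
  by (simp add: power2_eq_square diff_divide_distrib)

lemma corr3_turned:
  assumes i: "i \<in> I"
  shows "corr3 (exact i) (B i) (E i) (\<epsilon> i) (h i) (x i) (vt i) - corr3 (exact i) (B i) (E i) (\<epsilon> i) (h i) (x i) (v i)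
     = h i * (F i \<bullet> vt i) - h i * (u i * (b i \<bullet> E i (x i)))"
proof (cases "exact i")
  case True
  have "h i * (E i (x i) \<bullet> vt i) = h i * (u i * (b i \<bullet> E i (x i)))
    + E i (x i) \<bullet> corr1 (B i) (\<epsilon> i) (h i) (x i) (vt i) - E i (x i) \<bullet> corr1 (B i) (\<epsilon> i) (h i) (x i) (v i)"
    unfolding corr1_def turned_def by (rule inner_rot_osc1[OF unit_b[OF i] sin_nz(1)[OF i]])
  with True show ?thesis by (simp add: corr3_def forcing_def)
next
  case False
  have \<theta>: "h i / \<theta> i = \<epsilon> i * inverse (norm (B i (x i)))"
    using pos[OF i] by (simp add: angle_def field_simps)
  have "h i * (F i \<bullet> vt i) = h i * (u i * (b i \<bullet> E i (x i))
    + (E i (x i) \<bullet> cross3 (v i) (b i)) / \<theta> i - (E i (x i) \<bullet> cross3 (vt i) (b i)) / \<theta> i)"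
    using False inner_rot_phi1[OF unit_b[OF i] \<theta>_nz[OF i], of "E i (x i)" "v i"]
    by (simp add: forcing_def turned_def)
  also have "\<dots> = h i * (u i * (b i \<bullet> E i (x i)))
    + (h i / \<theta> i) * (E i (x i) \<bullet> cross3 (v i) (b i)) - (h i / \<theta> i) * (E i (x i) \<bullet> cross3 (vt i) (b i))"
    by (simp add: right_diff_distrib distrib_left)
  finally show ?thesis using False unfolding \<theta> by (simp add: corr3_def)
qed

lemma slow_he: "slow I \<epsilon> h f g \<Longrightarrow> bo I (\<lambda>i. g i - f i) he"
  using slowD(3)[of I \<epsilon> h f g] by (simp add: mult.commute)

text \<open>The change of the corrector is split at the intermediate state (x, \<open>vt\<close>).
  From (x, v) to that state it is known exactly and removes the oscillation; from there to (y, w) it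
  is O(h \<epsilon>) by slowness. The other two increments follow the same pattern.\<close>

lemma increment_pos:
  "bo I (\<lambda>i. slow_pos (B i) (\<epsilon> i) (h i) (y i) (w i) - slow_pos (B i) (\<epsilon> i) (h i) (x i) (v i)
      - h i *\<^sub>R avg_pos (B i) (x i) (u i)) he"
proof -
  have "bo I (\<lambda>i. (y i - x i - h i *\<^sub>R vt i)
     - (corr1 (B i) (\<epsilon> i) (h i) (y i) (w i) - corr1 (B i) (\<epsilon> i) (h i) (x i) (vt i))) he"
    by (intro bo_diff err_x slow_he slow_corr1)
  then show ?thesis
    by (rule bo_cong[THEN iffD1, rotated])
       (use corr1_turned in \<open>simp add: slow_pos_def avg_pos_def algebra_simps\<close>)
qed

lemma taylor: "bo I (\<lambda>i. unit_field (B i) (y i) - b i - unit_jacobian (B i) (x i) (y i - x i)) he"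
proof -
  obtain \<Lambda>' where \<Lambda>': "\<Lambda>' > 0" "\<And>S B E x y. regular L \<beta> S B E \<Longrightarrow> x \<in> S \<Longrightarrow> y \<in> S \<Longrightarrow>
    norm (unit_field B y - unit_field B x - unit_jacobian B x (y - x)) \<le> \<Lambda>' * (norm (y - x))\<^sup>2"
    using unit_field_taylor[OF \<beta>] by blast
  have "bo I (\<lambda>i. unit_field (B i) (y i) - b i - unit_jacobian (B i) (x i) (y i - x i))
     (\<lambda>i. (y i - x i) \<bullet> (y i - x i))"
    by (rule boI[where C = \<Lambda>']) (use \<Lambda>'(2)[OF regx] in \<open>simp add: power2_norm_eq_inner\<close>)
  also have "bo I (\<lambda>i. (y i - x i) \<bullet> (y i - x i)) (\<lambda>i. h i * h i)"
    by (rule bo_inner[OF bo_yx bo_yx])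
  finally (bo_trans) show ?thesis using bo_hh bo_trans by blast
qed

lemma bo_unit_jacobian: "bo I f g \<Longrightarrow> bo I (\<lambda>i. unit_jacobian (B i) (x i) (f i)) g"
  using slowD(1)[OF slow_unit_jacobian[OF slow_const]] .

lemma increment_par:
  "bo I (\<lambda>i. slow_par (B i) (\<epsilon> i) (h i) (y i) (w i) - slow_par (B i) (\<epsilon> i) (h i) (x i) (v i)
      - h i * avg_par (B i) (E i) (x i) (u i) (en i)) he"
proof -
  let ?D = "\<lambda>i. unit_jacobian (B i) (x i)"
  \<comment> \<open>The filter phi_1 acts as the identity along b, so the parallel force is the same
    for all schemes.\<close>
  have bF: "b i \<bullet> F i = b i \<bullet> E i (x i)" if "i \<in> I" for i
    using unit_b[OF that] by (simp add: forcing_def rot_phi1_def inner_add_right inner_unit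
        perp_orthogonal dot_cross_self)
  have 1: "bo I (\<lambda>i. (unit_field (B i) (y i) - b i - ?D i (y i - x i)) \<bullet> w i) he"
    using bo_inner[OF taylor slowD(2)[OF slow_v]] by simp
  have 2: "bo I (\<lambda>i. ?D i (y i - x i - h i *\<^sub>R vt i) \<bullet> w i) he"
    using bo_inner[OF bo_unit_jacobian[OF err_x] slowD(2)[OF slow_v]] by simp
  have "bo I (\<lambda>i. (h i *\<^sub>R ?D i (vt i)) \<bullet> (w i - vt i)) (\<lambda>i. h i * h i)"
    using bo_inner[OF bo_scaleR[OF bo_refl[of I h] bo_unit_jacobian[OF bo_turned]] bo_wv] by simp
  then have 3: "bo I (\<lambda>i. (h i *\<^sub>R ?D i (vt i)) \<bullet> (w i - vt i)) he"
    using bo_hh bo_trans by blast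
  have 4: "bo I (\<lambda>i. b i \<bullet> (w i - vt i - h i *\<^sub>R F i)) he"
    using bo_inner[OF bo_b err_v] by simp
  \<comment> \<open>Product rule for b . v. The errors are, in this order: the Taylor remainder of
    b, the position error, the replacement of \<open>w\<close> by \<open>vt\<close> in the quadratic
    term, the velocity error, and the slow change of the corrector.\<close>
  have "bo I (\<lambda>i. (unit_field (B i) (y i) - b i - ?D i (y i - x i)) \<bullet> w i
     + ?D i (y i - x i - h i *\<^sub>R vt i) \<bullet> w i + (h i *\<^sub>R ?D i (vt i)) \<bullet> (w i - vt i)
     + b i \<bullet> (w i - vt i - h i *\<^sub>R F i)
     - (corr2 (B i) (\<epsilon> i) (h i) (y i) (w i) - corr2 (B i) (\<epsilon> i) (h i) (x i) (vt i))) he"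
    by (intro bo_diff bo_add 1 2 3 4 slow_he slow_corr2)
  then show ?thesis
  proof (rule bo_cong[THEN iffD1, rotated])
    fix i assume i: "i \<in> I"
    show "(unit_field (B i) (y i) - b i - ?D i (y i - x i)) \<bullet> w i
     + ?D i (y i - x i - h i *\<^sub>R vt i) \<bullet> w i + (h i *\<^sub>R ?D i (vt i)) \<bullet> (w i - vt i)
     + b i \<bullet> (w i - vt i - h i *\<^sub>R F i)
     - (corr2 (B i) (\<epsilon> i) (h i) (y i) (w i) - corr2 (B i) (\<epsilon> i) (h i) (x i) (vt i))
     = slow_par (B i) (\<epsilon> i) (h i) (y i) (w i) - slow_par (B i) (\<epsilon> i) (h i) (x i) (v i)
      - h i * avg_par (B i) (E i) (x i) (u i) (en i)"
      using corr2_turned[OF i] inner_b_turned[OF i] bF[OF i]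
      by (simp add: slow_par_def avg_par_def linear_diff[OF linear_unit_jacobian]
          linear_add[OF linear_unit_jacobian] linear_cmul[OF linear_unit_jacobian] inner_diff_left inner_diff_right inner_commute[of "vt i"]
          algebra_simps)
  qed
qed

text \<open>The rotation preserves |v|, so |w|^2/2 can be expanded about \<open>vt\<close>: the
  linear term is the work of the force and the quadratic one is O(h^2).\<close>

lemma increment_en:
  "bo I (\<lambda>i. slow_en (exact i) (B i) (E i) (\<epsilon> i) (h i) (y i) (w i)
      - slow_en (exact i) (B i) (E i) (\<epsilon> i) (h i) (x i) (v i)
      - h i * avg_en (B i) (E i) (x i) (u i)) he"
proof -
  have 1: "bo I (\<lambda>i. (w i - vt i - h i *\<^sub>R F i) \<bullet> vt i) he"
    using bo_inner[OF err_v bo_turned] by simp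
  have 2: "bo I (\<lambda>i. (1/2) * ((w i - vt i) \<bullet> (w i - vt i))) he"
    using bo_mult_left[OF bo_const bo_trans[OF bo_inner[OF bo_wv bo_wv] bo_hh]] .
  have "bo I (\<lambda>i. (w i - vt i - h i *\<^sub>R F i) \<bullet> vt i + (1/2) * ((w i - vt i) \<bullet> (w i - vt i))
     - (corr3 (exact i) (B i) (E i) (\<epsilon> i) (h i) (y i) (w i) - corr3 (exact i) (B i) (E i) (\<epsilon> i) (h i) (x i) (vt i))) he"
    by (intro bo_diff bo_add 1 2 slow_he slow_corr3)
  then show ?thesis
  proof (rule bo_cong[THEN iffD1, rotated])
    fix i assume i: "i \<in> I"
    have v: "(norm (v i))\<^sup>2 = vt i \<bullet> vt i"
      using norm_turned[OF i] by (simp flip: power2_norm_eq_inner)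
    show "(w i - vt i - h i *\<^sub>R F i) \<bullet> vt i + (1/2) * ((w i - vt i) \<bullet> (w i - vt i))
     - (corr3 (exact i) (B i) (E i) (\<epsilon> i) (h i) (y i) (w i) - corr3 (exact i) (B i) (E i) (\<epsilon> i) (h i) (x i) (vt i))
     = slow_en (exact i) (B i) (E i) (\<epsilon> i) (h i) (y i) (w i)
      - slow_en (exact i) (B i) (E i) (\<epsilon> i) (h i) (x i) (v i) - h i * avg_en (B i) (E i) (x i) (u i)"
      using corr3_turned[OF i]
      by (simp add: slow_en_def avg_en_def v power2_norm_eq_inner[of "w i"] inner_diff_left inner_diff_right inner_add_left
          inner_commute[of "vt i" "w i"] field_simps)
  qed
qed

text \<open>Transferred from (x, \<open>vt\<close>), where slowness includes the bound: the exact
  difference between the two values is O(h), hence O(\<epsilon>). The same argument serves the other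
  two correctors.\<close>

lemma bo_corr1: "bo I (\<lambda>i. corr1 (B i) (\<epsilon> i) (h i) (x i) (v i)) \<epsilon>"
proof -
  have "bo I (\<lambda>i. corr1 (B i) (\<epsilon> i) (h i) (x i) (vt i) - (h i *\<^sub>R vt i - (h i * (b i \<bullet> vt i)) *\<^sub>R b i)) \<epsilon>"
    using bo_scaleR[OF bo_h bo_turned] bo_scaleR[OF bo_mult[OF bo_h bo_inner[OF bo_b bo_turned]] bo_b]
    by (intro bo_diff slowD(1)[OF slow_corr1]) simp_all
  then show ?thesis
    by (rule bo_cong[THEN iffD1, rotated]) (use corr1_turned inner_b_turned in \<open>simp add: algebra_simps\<close>)
qed

lemma bo_u: "bo I u (\<lambda>_. 1)"
  using bo_inner[OF bo_b bo_v] by simp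

lemma bo_en: "bo I en (\<lambda>_. 1)"
proof -
  have "bo I (\<lambda>i. (v i \<bullet> v i) / 2) (\<lambda>_. 1)"
    using bo_divide_const[OF bo_inner[OF bo_v bo_v]] by simp
  then show ?thesis by (simp add: power2_norm_eq_inner)
qed

lemma bo_corr2: "bo I (\<lambda>i. corr2 (B i) (\<epsilon> i) (h i) (x i) (v i)) \<epsilon>"
proof -
  have 1: "bo I (\<lambda>i. h i * (vt i \<bullet> unit_jacobian (B i) (x i) (vt i))) \<epsilon>"
    using bo_mult[OF bo_h bo_inner[OF bo_turned bo_unit_jacobian[OF bo_turned]]] by simp
  have "bo I (\<lambda>i. (en i - u i * u i / 2) * tr3 (unit_jacobian (B i) (x i))) (\<lambda>_. 1)"
    using bo_mult[OF bo_diff[OF bo_en bo_divide_const[OF bo_mult[OF bo_u bo_u, simplified]]] slowD(1)[OF slow_tr]]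
    by simp
  from bo_mult[OF bo_h this] have 2: "bo I (\<lambda>i. h i * ((en i - u i * u i / 2) * tr3 (unit_jacobian (B i) (x i)))) \<epsilon>"
    by simp
  have "bo I (\<lambda>i. corr2 (B i) (\<epsilon> i) (h i) (x i) (vt i) - (h i * (vt i \<bullet> unit_jacobian (B i) (x i) (vt i))
     - h i * ((en i - u i * u i / 2) * tr3 (unit_jacobian (B i) (x i))))) \<epsilon>"
    by (intro bo_diff slowD(1)[OF slow_corr2] 1 2)
  then show ?thesis
    by (rule bo_cong[THEN iffD1, rotated]) (simp add: corr2_turned[symmetric])
qed

lemma bo_corr3: "bo I (\<lambda>i. corr3 (exact i) (B i) (E i) (\<epsilon> i) (h i) (x i) (v i)) \<epsilon>"
proof -
  have 1: "bo I (\<lambda>i. h i * (F i \<bullet> vt i)) \<epsilon>"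
    using bo_mult[OF bo_h bo_inner[OF bo_F bo_turned]] by simp
  have 2: "bo I (\<lambda>i. h i * (u i * (b i \<bullet> E i (x i)))) \<epsilon>"
    using bo_mult[OF bo_h bo_mult[OF bo_u bo_inner[OF bo_b bo_E]]] by simp
  have "bo I (\<lambda>i. corr3 (exact i) (B i) (E i) (\<epsilon> i) (h i) (x i) (vt i) - (h i * (F i \<bullet> vt i)
     - h i * (u i * (b i \<bullet> E i (x i))))) \<epsilon>"
    by (intro bo_diff slowD(1)[OF slow_corr3] 1 2)
  then show ?thesis
    by (rule bo_cong[THEN iffD1, rotated]) (simp add: corr3_turned[symmetric])
qed

lemma diff_par: "bo I (\<lambda>i. unit_field (B i) (y i) \<bullet> w i - u i) h"
  using slowD(3)[OF slow_u] by (subst bo_cong[where f' = "\<lambda>i. unit_field (B i) (y i) \<bullet> w i - b i \<bullet> vt i"])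
    (auto simp: inner_b_turned)

lemma diff_en: "bo I (\<lambda>i. (norm (w i))\<^sup>2 / 2 - en i) h"
proof -
  have "bo I (\<lambda>i. (w i \<bullet> w i) / 2 - (vt i \<bullet> vt i) / 2) h"
    using slowD(3)[OF slow_divide_const[OF slow_inner[OF slow_v slow_v]]] by simp
  then show ?thesis
    by (rule bo_cong[THEN iffD1, rotated]) (simp add: norm_turned flip: power2_norm_eq_inner)
qed

end

lemma bo_Pair: "bo I f h \<Longrightarrow> bo I g h \<Longrightarrow> bo I (\<lambda>i. (f i, g i)) h"
proof -
  assume "bo I f h" "bo I g h"
  then obtain C D where *: "\<And>i. i \<in> I \<Longrightarrow> norm (f i) \<le> C * \<bar>h i\<bar>" "\<And>i. i \<in> I \<Longrightarrow> norm (g i) \<le> D * \<bar>h i\<bar>"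
    unfolding bo_def by metis
  show ?thesis
  proof (rule boI[where C = "C + D"])
    fix i assume "i \<in> I"
    then show "norm (f i, g i) \<le> (C + D) * \<bar>h i\<bar>"
      using norm_Pair_le[of "f i" "g i"] *[of i] by (simp add: distrib_right)
  qed
qed

lemma slow_Pair: "slow I s m f g \<Longrightarrow> slow I s m f' g' \<Longrightarrow> slow I s m (\<lambda>i. (f i, f' i)) (\<lambda>i. (g i, g' i))"
  by (simp add: slow_def bo_Pair)

text \<open>Since every larger constant works too, finitely many bounds get a common constant by
  intersecting eventualities.\<close>

lemma bo_eventually:
  assumes "bo I f g"
  shows "\<forall>\<^sub>F A in at_top. \<forall>i\<in>I. norm (f i) \<le> A * \<bar>g i\<bar>"
proof -
  obtain C where C: "\<forall>i\<in>I. norm (f i) \<le> C * \<bar>g i\<bar>" using assms unfolding bo_def by blast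
  show ?thesis
    using eventually_ge_at_top[of C]
  proof eventually_elim
    case (elim A)
    show ?case
    proof
      fix i assume "i \<in> I"
      then show "norm (f i) \<le> A * \<bar>g i\<bar>"
        using C mult_right_mono[OF elim, of "\<bar>g i\<bar>"] by force
    qed
  qed
qed

definition slow_vars :: "(real^3 \<Rightarrow> real^3) \<Rightarrow> real^3 \<Rightarrow> real^3 \<Rightarrow> (real^3) \<times> real \<times> real" where
  "slow_vars B x v = (x, unit_field B x \<bullet> v, (norm v)\<^sup>2 / 2)"

definition correctors ::
  "bool \<Rightarrow> (real^3 \<Rightarrow> real^3) \<Rightarrow> (real^3 \<Rightarrow> real^3) \<Rightarrow> real \<Rightarrow> real \<Rightarrow> real^3 \<Rightarrow> real^3 \<Rightarrow> (real^3) \<times> real \<times> real" where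
  "correctors exact B E \<epsilon> h x v = (corr1 B \<epsilon> h x v, corr2 B \<epsilon> h x v, corr3 exact B E \<epsilon> h x v)"

definition averaged ::
  "(real^3 \<Rightarrow> real^3) \<Rightarrow> (real^3 \<Rightarrow> real^3) \<Rightarrow> (real^3) \<times> real \<times> real \<Rightarrow> (real^3) \<times> real \<times> real" where
  "averaged B E Y = (case Y of (x, u, e) \<Rightarrow> (avg_pos B x u, avg_par B E x u e, avg_en B E x u))"

record step_data =
  sd_exact :: bool
  sd_B :: "real^3 \<Rightarrow> real^3"
  sd_E :: "real^3 \<Rightarrow> real^3"
  sd_S :: "(real^3) set"
  sd_eps :: real
  sd_h :: real
  sd_x :: "real^3"
  sd_v :: "real^3"
  sd_y :: "real^3"
  sd_w :: "real^3"

text \<open>With all admissible steps as the index set, the implied constants become one number A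
  that depends on the parameters of \<open>split_step\<close> only. The correctors are bounded at
  both ends, because the last state of a sequence need not be the start of another step.\<close>

lemma split_step_averaging:
  assumes "0 < \<beta>" "0 < \<gamma>"
  obtains A where "A > 0" "\<And>exact B E S \<epsilon> h x v y w. split_step L \<beta> M C \<gamma> \<Lambda> exact B E S \<epsilon> h x v y w \<Longrightarrow>
     norm (slow_vars B y w - correctors exact B E \<epsilon> h y w - (slow_vars B x v - correctors exact B E \<epsilon> h x v)
       - h *\<^sub>R averaged B E (slow_vars B x v)) \<le> A * (h * \<epsilon>) \<and>
     norm (correctors exact B E \<epsilon> h x v) \<le> A * \<epsilon> \<and> norm (correctors exact B E \<epsilon> h y w) \<le> A * \<epsilon> \<and>
     norm (slow_vars B y w - slow_vars B x v) \<le> A * h"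
proof -
  define I where "I = {r :: step_data. split_step L \<beta> M C \<gamma> \<Lambda> (sd_exact r) (sd_B r) (sd_E r) (sd_S r) (sd_eps r) (sd_h r)
    (sd_x r) (sd_v r) (sd_y r) (sd_w r)}"
  interpret step_family I sd_exact sd_B sd_E sd_S sd_eps sd_h sd_x sd_v sd_y sd_w L \<beta> M C \<gamma> \<Lambda>
    by unfold_locales (use assms in \<open>auto simp: I_def\<close>)
  note 1 = bo_Pair[OF increment_pos bo_Pair[OF increment_par increment_en]]
  note 2 = bo_Pair[OF bo_corr1 bo_Pair[OF bo_corr2 bo_corr3]]
  note 3 = bo_Pair[OF bo_yx bo_Pair[OF diff_par diff_en]]
  note 4 = bo_Pair[OF slowD(2)[OF slow_corr1] bo_Pair[OF slowD(2)[OF slow_corr2] slowD(2)[OF slow_corr3]]]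
  obtain A where A: "A > 0"
    "\<forall>i\<in>I. norm (slow_pos (sd_B i) (sd_eps i) (sd_h i) (sd_y i) (sd_w i) - slow_pos (sd_B i) (sd_eps i) (sd_h i) (sd_x i) (sd_v i)
      - sd_h i *\<^sub>R avg_pos (sd_B i) (sd_x i) (u i),
      slow_par (sd_B i) (sd_eps i) (sd_h i) (sd_y i) (sd_w i) - slow_par (sd_B i) (sd_eps i) (sd_h i) (sd_x i) (sd_v i)
      - sd_h i * avg_par (sd_B i) (sd_E i) (sd_x i) (u i) (en i),
      slow_en (sd_exact i) (sd_B i) (sd_E i) (sd_eps i) (sd_h i) (sd_y i) (sd_w i)
      - slow_en (sd_exact i) (sd_B i) (sd_E i) (sd_eps i) (sd_h i) (sd_x i) (sd_v i)
      - sd_h i * avg_en (sd_B i) (sd_E i) (sd_x i) (u i)) \<le> A * \<bar>sd_h i * sd_eps i\<bar>"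
    "\<forall>i\<in>I. norm (corr1 (sd_B i) (sd_eps i) (sd_h i) (sd_x i) (sd_v i), corr2 (sd_B i) (sd_eps i) (sd_h i) (sd_x i) (sd_v i),
      corr3 (sd_exact i) (sd_B i) (sd_E i) (sd_eps i) (sd_h i) (sd_x i) (sd_v i)) \<le> A * \<bar>sd_eps i\<bar>"
    "\<forall>i\<in>I. norm (sd_y i - sd_x i, unit_field (sd_B i) (sd_y i) \<bullet> sd_w i - u i, (norm (sd_w i))\<^sup>2 / 2 - en i) \<le> A * \<bar>sd_h i\<bar>"
    "\<forall>i\<in>I. norm (corr1 (sd_B i) (sd_eps i) (sd_h i) (sd_y i) (sd_w i), corr2 (sd_B i) (sd_eps i) (sd_h i) (sd_y i) (sd_w i),
      corr3 (sd_exact i) (sd_B i) (sd_E i) (sd_eps i) (sd_h i) (sd_y i) (sd_w i)) \<le> A * \<bar>sd_eps i\<bar>"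
    using eventually_happens'[OF trivial_limit_at_top_linorder eventually_conj[OF eventually_gt_at_top[of 0] eventually_conj[OF bo_eventually[OF 1]
      eventually_conj[OF bo_eventually[OF 2] eventually_conj[OF bo_eventually[OF 3] bo_eventually[OF 4]]]]]] by blast
  show thesis
  proof (rule that[OF A(1)])
    fix exact B E S \<epsilon> h x v y w
    assume *: "split_step L \<beta> M C \<gamma> \<Lambda> exact B E S \<epsilon> h x v y w"
    then have pos: "0 < \<epsilon>" "0 < h" unfolding split_step_def by auto
    define r where "r = \<lparr>sd_exact = exact, sd_B = B, sd_E = E, sd_S = S, sd_eps = \<epsilon>, sd_h = h, sd_x = x, sd_v = v, sd_y = y, sd_w = w\<rparr>"
    have "r \<in> I" using * by (simp add: I_def r_def)
    with A(2-) pos show "norm (slow_vars B y w - correctors exact B E \<epsilon> h y w - (slow_vars B x v - correctors exact B E \<epsilon> h x v)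
       - h *\<^sub>R averaged B E (slow_vars B x v)) \<le> A * (h * \<epsilon>) \<and>
     norm (correctors exact B E \<epsilon> h x v) \<le> A * \<epsilon> \<and> norm (correctors exact B E \<epsilon> h y w) \<le> A * \<epsilon> \<and>
     norm (slow_vars B y w - slow_vars B x v) \<le> A * h"
      by (auto simp: r_def slow_vars_def correctors_def averaged_def slow_pos_def slow_par_def slow_en_def dest!: bspec[of I _ r])
  qed
qed

record state_pair =
  sp_B :: "real^3 \<Rightarrow> real^3"
  sp_E :: "real^3 \<Rightarrow> real^3"
  sp_S :: "(real^3) set"
  sp_Y :: "(real^3) \<times> real \<times> real"
  sp_Z :: "(real^3) \<times> real \<times> real"

lemma norm_fst_le': "norm (fst p) \<le> norm p"
  using norm_fst_le[of "fst p" "snd p"] by simp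

lemma norm_snd_le': "norm (snd p) \<le> norm p"
  using norm_snd_le[of "snd p" "fst p"] by simp

text \<open>The averaged field is polynomial in u and e, so it is Lipschitz only where these are
  bounded; this is the purpose of R.\<close>

lemma averaged_lipschitz:
  assumes "0 < \<beta>"
  obtains A where "A > 0" "\<And>B E S Y Z. regular L \<beta> S B E \<Longrightarrow> fst Y \<in> S \<Longrightarrow> fst Z \<in> S \<Longrightarrow> norm (snd Y) \<le> R \<Longrightarrow>
    norm (snd Z) \<le> R \<Longrightarrow> norm (averaged B E Z - averaged B E Y) \<le> A * norm (Z - Y)"
proof -
  define I where "I = {r :: state_pair. regular L \<beta> (sp_S r) (sp_B r) (sp_E r) \<and> fst (sp_Y r) \<in> sp_S r
    \<and> fst (sp_Z r) \<in> sp_S r \<and> norm (snd (sp_Y r)) \<le> R \<and> norm (snd (sp_Z r)) \<le> R}"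
  let ?m = "\<lambda>i. norm (sp_Z i - sp_Y i)"
  have diff: "\<bar>fst (snd (sp_Z i)) - fst (snd (sp_Y i))\<bar> \<le> norm (sp_Z i - sp_Y i)"
    "\<bar>snd (snd (sp_Z i)) - snd (snd (sp_Y i))\<bar> \<le> norm (sp_Z i - sp_Y i)"
    "norm (fst (sp_Z i) - fst (sp_Y i)) \<le> norm (sp_Z i - sp_Y i)" for i
    using order_trans[OF norm_fst_le' norm_snd_le'[of "sp_Z i - sp_Y i"]]
      order_trans[OF norm_snd_le' norm_snd_le'[of "sp_Z i - sp_Y i"]] norm_fst_le'[of "sp_Z i - sp_Y i"]
    by (simp_all add: fst_diff snd_diff)
  have d: "bo I (\<lambda>i. fst (sp_Z i) - fst (sp_Y i)) ?m" "bo I (\<lambda>i. fst (snd (sp_Z i)) - fst (snd (sp_Y i))) ?m"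
    "bo I (\<lambda>i. snd (snd (sp_Z i)) - snd (snd (sp_Y i))) ?m"
    by (rule boI[where C = 1]; simp add: diff)+
  have R: "norm (snd (sp_Y i)) \<le> R" "norm (snd (sp_Z i)) \<le> R" if "i \<in> I" for i
    using that by (auto simp: I_def)
  have "bo I (\<lambda>i. fst (snd (sp_Y i))) (\<lambda>_. 1)" "bo I (\<lambda>i. fst (snd (sp_Z i))) (\<lambda>_. 1)"
    "bo I (\<lambda>i. snd (snd (sp_Y i))) (\<lambda>_. 1)" "bo I (\<lambda>i. snd (snd (sp_Z i))) (\<lambda>_. 1)"
    by (rule bo_1I[where C = R], use R norm_fst_le' norm_snd_le' order_trans in blast)+
  then have u: "slow1 I ?m (\<lambda>i. fst (snd (sp_Y i))) (\<lambda>i. fst (snd (sp_Z i)))"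
    and e: "slow1 I ?m (\<lambda>i. snd (snd (sp_Y i))) (\<lambda>i. snd (snd (sp_Z i)))"
    using d by (simp_all add: slow_def)
  interpret field_family I sp_B sp_E sp_S "\<lambda>i. fst (sp_Y i)" "\<lambda>i. fst (sp_Z i)" ?m L \<beta>
    by unfold_locales (use assms d(1) in \<open>auto simp: I_def\<close>)
  have bE: "slow1 I ?m (\<lambda>i. unit_field (sp_B i) (fst (sp_Y i)) \<bullet> sp_E i (fst (sp_Y i)))
      (\<lambda>i. unit_field (sp_B i) (fst (sp_Z i)) \<bullet> sp_E i (fst (sp_Z i)))"
    by (rule slow_inner[OF slow_unit_field slow_E])
  have "slow1 I ?m (\<lambda>i. averaged (sp_B i) (sp_E i) (sp_Y i)) (\<lambda>i. averaged (sp_B i) (sp_E i) (sp_Z i))"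
    unfolding averaged_def case_prod_beta avg_pos_def avg_par_def avg_en_def
    by (intro slow_Pair slow_scaleR[OF u slow_unit_field] slow_add slow_mult slow_diff slow_divide_const u e slow_tr bE)
  from boE[OF slowD(3)[OF this]]
  obtain A where A: "A > 0" "\<And>i. i \<in> I \<Longrightarrow> norm (averaged (sp_B i) (sp_E i) (sp_Z i) - averaged (sp_B i) (sp_E i) (sp_Y i)) \<le> A * norm (sp_Z i - sp_Y i)"
    by auto
  show thesis
  proof (rule that[OF A(1)])
    fix B E S and Y Z :: "(real^3) \<times> real \<times> real"
    assume "regular L \<beta> S B E" "fst Y \<in> S" "fst Z \<in> S" "norm (snd Y) \<le> R" "norm (snd Z) \<le> R"
    then have "\<lparr>sp_B = B, sp_E = E, sp_S = S, sp_Y = Y, sp_Z = Z\<rparr> \<in> I" by (simp add: I_def)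
    from A(2)[OF this] show "norm (averaged B E Z - averaged B E Y) \<le> A * norm (Z - Y)"
      by simp
  qed
qed


section \<open>The schemes and the exact flow as perturbed rotations\<close>

lemma norm_rot_phi1:
  assumes b: "norm b = 1"
  shows "norm (rot_phi1 \<theta> b e) \<le> 3 * norm e"
proof -
  have 1: "norm ((b \<bullet> e) *\<^sub>R b) \<le> norm e"
    using Cauchy_Schwarz_ineq2[of b e] b by simp
  have "norm (perp b e) \<le> norm e" "norm (cross3 e b) \<le> norm e"
    by (rule power2_le_imp_le; simp add: norm_perp[OF b] norm_cross3_unit[OF b])+
  then have 2: "norm ((sin \<theta> / \<theta>) *\<^sub>R perp b e) \<le> 1 * norm e" "norm (((1 - cos \<theta>) / \<theta>) *\<^sub>R cross3 e b) \<le> 1 * norm e"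
    unfolding norm_scaleR by (intro mult_mono abs_sin_div_le; simp)+
  show ?thesis unfolding rot_phi1_def
    using norm_triangle_ineq[of "(b \<bullet> e) *\<^sub>R b + (sin \<theta> / \<theta>) *\<^sub>R perp b e" "((1 - cos \<theta>) / \<theta>) *\<^sub>R cross3 e b"]
      norm_triangle_ineq[of "(b \<bullet> e) *\<^sub>R b" "(sin \<theta> / \<theta>) *\<^sub>R perp b e"] 1 2 by linarith
qed

lemma convex_mean_mem:
  fixes x y :: "'a::real_vector"
  assumes "convex S" "x \<in> S" "y \<in> S" "t \<in> {0..1::real}"
  shows "t *\<^sub>R x + (1 - t) *\<^sub>R y \<in> S"
  using assms convexD[of S x y t "1 - t"] by auto

lemma continuous_on_mean:
  fixes E :: "real^3 \<Rightarrow> real^3"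
  assumes "continuous_on UNIV E"
  shows "continuous_on {0..1::real} (\<lambda>t. E (t *\<^sub>R x + (1 - t) *\<^sub>R y))"
  by (rule continuous_on_compose2[OF assms]) (auto intro!: continuous_intros)

lemma norm_avf_mean:
  assumes "continuous_on UNIV E" "convex S" "x \<in> S" "y \<in> S" "\<And>z. z \<in> S \<Longrightarrow> norm (E z) \<le> L"
  shows "norm (avf_mean E x y) \<le> L"
  using integral_bound[OF _ continuous_on_mean[OF assms(1), of x y], where B = L] assms(5) convex_mean_mem[OF assms(2,3,4)]
  by (simp add: avf_mean_def)

lemma avf_mean_self: "avf_mean E x x = E x"
  by (simp add: avf_mean_def flip: scaleR_left_distrib)

lemma avf_mean_lipschitz:
  assumes E: "continuous_on UNIV E" and S: "convex S" "x \<in> S" "y \<in> S" "z \<in> S" and "0 \<le> L"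
    and lip: "\<And>p q. p \<in> S \<Longrightarrow> q \<in> S \<Longrightarrow> norm (E q - E p) \<le> L * norm (q - p)"
  shows "norm (avf_mean E x z - avf_mean E x y) \<le> L * norm (z - y)"
proof -
  note c = continuous_on_mean[OF E]
  have "avf_mean E x z - avf_mean E x y
      = integral {0..1} (\<lambda>t. E (t *\<^sub>R x + (1 - t) *\<^sub>R z) - E (t *\<^sub>R x + (1 - t) *\<^sub>R y))"
    unfolding avf_mean_def by (rule integral_diff[symmetric]; rule integrable_continuous_real[OF c])
  moreover have "norm (integral {0..1} (\<lambda>t. E (t *\<^sub>R x + (1 - t) *\<^sub>R z) - E (t *\<^sub>R x + (1 - t) *\<^sub>R y)))
      \<le> (L * norm (z - y)) * (1 - 0)"
  proof (rule integral_bound)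
    fix t :: real assume t: "t \<in> {0..1}"
    have eq: "(t *\<^sub>R x + (1 - t) *\<^sub>R z) - (t *\<^sub>R x + (1 - t) *\<^sub>R y) = (1 - t) *\<^sub>R (z - y)"
      by (simp add: algebra_simps)
    have "norm (E (t *\<^sub>R x + (1 - t) *\<^sub>R z) - E (t *\<^sub>R x + (1 - t) *\<^sub>R y)) \<le> L * norm ((1 - t) *\<^sub>R (z - y))"
      using lip[OF convex_mean_mem[OF S(1,2,3) t] convex_mean_mem[OF S(1,2,4) t]] unfolding eq .
    also have "\<dots> \<le> L * (1 * norm (z - y))"
      unfolding norm_scaleR using t \<open>0 \<le> L\<close> by (intro mult_left_mono mult_right_mono) auto
    finally show "norm (E (t *\<^sub>R x + (1 - t) *\<^sub>R z) - E (t *\<^sub>R x + (1 - t) *\<^sub>R y)) \<le> L * norm (z - y)" by simp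
  qed (auto intro!: continuous_on_diff c)
  ultimately show ?thesis by simp
qed

text \<open>All three schemes have the form x' = x + h vt + h^2 P, v' = vt + h Q with P and Q
  bounded by 3 L and Q = F + O(h); the factor 3 comes from \<open>norm_rot_phi1\<close>. A step then
  has length at most h (M + 3 C L), because h <= C. The real work is to locate the implicit position
  of S1-AVF.\<close>

lemma scheme_consistent:
  fixes B E :: "real^3 \<Rightarrow> real^3"
  assumes reg: "regular L \<beta> S B E" and \<beta>: "0 < \<beta>" and L: "0 \<le> L" and E: "continuous_on UNIV E"
    and e: "0 < \<epsilon>" "\<epsilon> \<le> 1" and h: "0 < h" "h \<le> C * \<epsilon>" "h\<^sup>2 * L \<le> 1" and v: "norm v \<le> M"
    and S: "cball x (h * (M + 3 * C * L)) \<subseteq> S"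
    and step: "step \<in> {S1_AVF B E \<epsilon> h, S1_SV B E \<epsilon> h, S1_VP B E \<epsilon> h}" "step x v x' v'"
    and ex: "exact \<longleftrightarrow> step \<in> {S1_AVF B E \<epsilon> h, S1_SV B E \<epsilon> h}"
  defines "\<Lambda> \<equiv> 3 * C * L + C * L * (M + 3 * C * L)"
  shows "norm (x' - x) \<le> h * (M + 3 * C * L)" and "norm v' \<le> norm v + h * (3 * L)"
    and "norm (x' - x - h *\<^sub>R turned B \<epsilon> h x v) \<le> \<Lambda> * (h * \<epsilon>)"
    and "norm (v' - turned B \<epsilon> h x v - h *\<^sub>R forcing exact B E \<epsilon> h x) \<le> \<Lambda> * (h * \<epsilon>)"
proof -
  define R where "R = M + 3 * C * L"
  have \<Lambda>_eq: "\<Lambda> = 3 * C * L + C * L * R" by (simp add: \<Lambda>_def R_def)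
  have M: "0 \<le> M" using v norm_ge_zero order_trans by blast
  have C: "0 < C" using e h zero_less_mult_pos2[of C \<epsilon>] by linarith
  have "C * \<epsilon> \<le> C * 1" using e C by (intro mult_left_mono) auto
  with h(2) have hC: "h \<le> C" by simp
  have R: "0 \<le> R" using M C L by (simp add: R_def)
  have xS: "x \<in> S" using S h R by (auto simp: R_def)
  have convS: "convex S" and EL: "\<And>y. y \<in> S \<Longrightarrow> norm (E y) \<le> L"
    and lip: "\<And>p q. p \<in> S \<Longrightarrow> q \<in> S \<Longrightarrow> norm (E q - E p) \<le> L * norm (q - p)"
    using reg unfolding regular_def by blast+
  note bx = regularD(3)[OF reg xS \<beta>]
  define vt where "vt = turned B \<epsilon> h x v"
  have vt: "mat_exp ((h / \<epsilon>) *\<^sub>R hat (B x)) *v v = vt"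
    unfolding vt_def turned_def angle_def by (rule mat_exp_hat[of B x, OF bx])
  have nvt: "norm vt = norm v"
    unfolding vt_def turned_def by (rule norm_rot[OF norm_unit_field[of B x, OF bx]])
  have hP: "norm ((h * h) *\<^sub>R P) \<le> (h * h) * (3 * L)" if "norm P \<le> 3 * L" for P :: "real^3"
    using that h by (simp add: mult_left_mono)
  have pos_bound: "norm (h *\<^sub>R vt + (h * h) *\<^sub>R P) \<le> h * R" if "norm P \<le> 3 * L" for P
  proof -
    have "norm (h *\<^sub>R vt + (h * h) *\<^sub>R P) \<le> norm (h *\<^sub>R vt) + norm ((h * h) *\<^sub>R P)"
      by (rule norm_triangle_ineq)
    also have "\<dots> \<le> h * M + h * (C * (3 * L))"
    proof (rule add_mono)
      show "norm (h *\<^sub>R vt) \<le> h * M" using nvt v h by (simp add: mult_left_mono)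
      have "h * (h * (3 * L)) \<le> h * (C * (3 * L))"
        using hC h L by (intro mult_left_mono mult_right_mono) auto
      then show "norm ((h * h) *\<^sub>R P) \<le> h * (C * (3 * L))"
        using hP[OF that] by (simp only: mult.assoc)
    qed
    finally show ?thesis by (simp add: R_def algebra_simps)
  qed
  \<comment> \<open>Q may involve E at x', so its bounds are only required once x' is known to lie
    in the ball; that follows from the bound on P alone.\<close>
  have core: "norm (x' - x) \<le> h * R \<and> norm v' \<le> norm v + h * (3 * L) \<and>
      norm (x' - x - h *\<^sub>R vt) \<le> \<Lambda> * (h * \<epsilon>) \<and> norm (v' - vt - h *\<^sub>R F) \<le> \<Lambda> * (h * \<epsilon>)"
    if x': "x' = x + h *\<^sub>R vt + (h * h) *\<^sub>R P" and v': "v' = vt + h *\<^sub>R Q" and P: "norm P \<le> 3 * L"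
      and Q: "norm (x' - x) \<le> h * R \<Longrightarrow> norm Q \<le> 3 * L \<and> norm (Q - F) \<le> L * (h * R)" for P Q F
  proof -
    have hh: "h * h \<le> C * (h * \<epsilon>)" using mult_left_mono[OF h(2), of h] h by (simp add: mult_ac)
    have a: "norm (x' - x) \<le> h * R" using pos_bound[OF P] by (simp add: x' add.assoc)
    from Q[OF this] have Q1: "norm Q \<le> 3 * L" and Q2: "norm (Q - F) \<le> L * (h * R)" by auto
    have b: "norm v' \<le> norm v + h * (3 * L)"
    proof -
      have "norm (h *\<^sub>R Q) \<le> h * (3 * L)" using Q1 h(1) by (simp add: mult_left_mono)
      then show ?thesis unfolding v' using norm_triangle_ineq[of vt "h *\<^sub>R Q"] nvt by linarith
    qed
    have "norm (x' - x - h *\<^sub>R vt) \<le> (h * h) * (3 * L)" using hP[OF P] by (simp add: x')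
    also have "\<dots> \<le> (C * (h * \<epsilon>)) * (3 * L)" using hh L by (intro mult_right_mono) auto
    also have "\<dots> \<le> \<Lambda> * (h * \<epsilon>)"
      using mult_nonneg_nonneg[of "C * L * R" "h * \<epsilon>"] C L R e h by (simp add: \<Lambda>_eq algebra_simps)
    finally have c: "norm (x' - x - h *\<^sub>R vt) \<le> \<Lambda> * (h * \<epsilon>)" .
    have "norm (v' - vt - h *\<^sub>R F) = h * norm (Q - F)"
      using h by (simp add: v' flip: scaleR_diff_right)
    also have "\<dots> \<le> h * (L * (h * R))" using Q2 h by (intro mult_left_mono) auto
    also have "\<dots> = (h * h) * (L * R)" by (simp add: mult_ac)
    also have "\<dots> \<le> (C * (h * \<epsilon>)) * (L * R)" using hh L R by (intro mult_right_mono) auto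
    also have "\<dots> \<le> \<Lambda> * (h * \<epsilon>)"
      using mult_nonneg_nonneg[of "3 * C * L" "h * \<epsilon>"] C L e h by (simp add: \<Lambda>_eq algebra_simps)
    finally show ?thesis using a b c by blast
  qed
  have inS: "y \<in> S" if "norm (y - x) \<le> h * R" for y
    using that S by (auto simp: R_def dist_norm norm_minus_commute)
  have core2: "norm (x' - x) \<le> h * R \<and> norm v' \<le> norm v + h * (3 * L) \<and>
      norm (x' - x - h *\<^sub>R vt) \<le> \<Lambda> * (h * \<epsilon>) \<and> norm (v' - vt - h *\<^sub>R forcing exact B E \<epsilon> h x) \<le> \<Lambda> * (h * \<epsilon>)"
  proof -
    consider "step = S1_AVF B E \<epsilon> h" exact | "step = S1_SV B E \<epsilon> h" exact | "step = S1_VP B E \<epsilon> h" "\<not> exact"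
      using step(1) ex by blast
    then show ?thesis
    proof cases
      case 1
      let ?m = "avf_mean E x"
      have pos: "avf_position B E \<epsilon> h x v y \<longleftrightarrow> y = x + h *\<^sub>R vt + (h\<^sup>2 / 2) *\<^sub>R ?m y" for y
        by (simp add: avf_position_def vt)
      have s: "avf_position B E \<epsilon> h x v x'" "v' = vt + h *\<^sub>R ?m x'"
        and near: "\<And>y. avf_position B E \<epsilon> h x v y \<Longrightarrow> dist x x' \<le> dist x y"
        using step(2) 1 by (auto simp: S1_AVF_def vt)
      \<comment> \<open>The fixed point map contracts by 1/2 because h^2 L <= 1, so the ball
        contains a root. The root selected by the scheme is no farther from x and therefore lies in
        the same ball.\<close>
      have "\<exists>!y. y \<in> cball x (h * R) \<and> x + h *\<^sub>R vt + (h\<^sup>2 / 2) *\<^sub>R ?m y = y"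
      proof (rule Banach_fix[where c = "1/2"])
        show "cball x (h * R) \<noteq> {}" using mult_nonneg_nonneg[of h R] R h(1) by (simp add: not_less)
        show "(\<lambda>y. x + h *\<^sub>R vt + (h\<^sup>2 / 2) *\<^sub>R ?m y) ` cball x (h * R) \<subseteq> cball x (h * R)"
        proof (rule image_subsetI)
          fix y assume "y \<in> cball x (h * R)"
          then have y: "y \<in> S" using S by (auto simp: R_def)
          have "norm (?m y) \<le> L" using norm_avf_mean[OF E convS xS y EL] .
          then have "norm ((1/2::real) *\<^sub>R ?m y) \<le> 3 * L" using L by simp
          from pos_bound[OF this] show "x + h *\<^sub>R vt + (h\<^sup>2 / 2) *\<^sub>R ?m y \<in> cball x (h * R)"
            by (simp add: mem_cball dist_commute[of x]) (simp add: dist_norm add.assoc power2_eq_square)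
        qed
        show "dist (x + h *\<^sub>R vt + (h\<^sup>2 / 2) *\<^sub>R ?m y) (x + h *\<^sub>R vt + (h\<^sup>2 / 2) *\<^sub>R ?m z) \<le> 1/2 * dist y z"
          if "y \<in> cball x (h * R)" "z \<in> cball x (h * R)" for y z
        proof -
          have yz: "y \<in> S" "z \<in> S" using that S by (auto simp: R_def)
          have "norm (?m y - ?m z) \<le> L * norm (y - z)"
            by (rule avf_mean_lipschitz[OF E convS xS yz(2,1) L lip])
          then have "(h\<^sup>2 / 2) * norm (?m y - ?m z) \<le> (h\<^sup>2 / 2) * (L * norm (y - z))"
            by (intro mult_left_mono) auto
          also have "\<dots> = (h\<^sup>2 * L) * norm (y - z) / 2" by simp
          also have "\<dots> \<le> 1 * norm (y - z) / 2" using h(3) by (intro divide_right_mono mult_right_mono) auto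
          finally show ?thesis by (simp add: dist_norm flip: scaleR_diff_right)
        qed
      qed (auto simp: complete_eq_closed)
      then obtain y where y: "y \<in> cball x (h * R)" "avf_position B E \<epsilon> h x v y"
        unfolding pos by metis
      then have "norm (x' - x) \<le> h * R" using near[OF y(2)] by (simp add: dist_norm norm_minus_commute)
      then have x'S: "x' \<in> S" by (rule inS)
      have m: "norm (?m x') \<le> L" using norm_avf_mean[OF E convS xS x'S EL] .
      have "norm (?m x' - E x) \<le> L * norm (x' - x)"
        using avf_mean_lipschitz[OF E convS xS xS x'S L lip] by (simp add: avf_mean_self)
      also have "\<dots> \<le> L * (h * R)" using \<open>norm (x' - x) \<le> h * R\<close> L by (intro mult_left_mono)
      finally have "norm (?m x' - E x) \<le> L * (h * R)" .
      moreover have "x' = x + h *\<^sub>R vt + (h * h) *\<^sub>R ((1/2) *\<^sub>R ?m x')"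
        using s(1) unfolding pos by (simp add: power2_eq_square)
      ultimately show ?thesis using m L s(2) 1
        by (intro core[where P = "(1/2) *\<^sub>R ?m x'" and Q = "?m x'"]) (auto simp: forcing_def)
    next
      case 2
      then have s: "x' = x + h *\<^sub>R vt + (h * h) *\<^sub>R ((1/2) *\<^sub>R E x)" "v' = vt + h *\<^sub>R ((1/2) *\<^sub>R (E x + E x'))"
        using step(2) by (auto simp: S1_SV_def vt power2_eq_square)
      have nE: "norm (E x) \<le> L" using EL[OF xS] .
      show ?thesis
      proof (rule core[OF s])
        show "norm ((1/2::real) *\<^sub>R E x) \<le> 3 * L" using nE L by simp
        assume a: "norm (x' - x) \<le> h * R"
        have E': "norm (E x') \<le> L" using EL[OF inS[OF a]] .
        have "norm ((1/2::real) *\<^sub>R (E x + E x')) \<le> 3 * L"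
          using norm_triangle_ineq[of "E x" "E x'"] nE E' L by simp
        moreover have "(1/2::real) *\<^sub>R (E x + E x') - E x = (1/2) *\<^sub>R (E x' - E x)"
          by (simp add: vec_eq_iff field_simps)
        moreover have "norm (E x' - E x) \<le> L * (h * R)"
          using lip[OF xS inS[OF a]] mult_left_mono[OF a L] by linarith
        moreover have "0 \<le> L * (h * R)" using L h R by simp
        ultimately show "norm ((1/2::real) *\<^sub>R (E x + E x')) \<le> 3 * L \<and>
            norm ((1/2::real) *\<^sub>R (E x + E x') - forcing exact B E \<epsilon> h x) \<le> L * (h * R)"
          using 2 by (simp add: forcing_def)
      qed
    next
      case 3
      define F where "F = rot_phi1 (angle B \<epsilon> h x) (unit_field B x) (E x)"
      have "mat_phi1 ((h / \<epsilon>) *\<^sub>R hat (B x)) *v E x = F"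
        unfolding F_def angle_def using h e by (intro mat_phi1_hat[of B x, OF bx]) auto
      then have s: "x' = x + h *\<^sub>R vt + (h * h) *\<^sub>R F" "v' = vt + h *\<^sub>R F"
        using step(2) 3 by (auto simp: S1_VP_def vt algebra_simps)
      have "norm F \<le> 3 * L"
        unfolding F_def using norm_rot_phi1[OF norm_unit_field[of B x, OF bx]] EL[OF xS] by (meson mult_left_mono order_trans zero_le_numeral)
      moreover have "F = forcing exact B E \<epsilon> h x" using 3 by (simp add: forcing_def F_def)
      moreover have "0 \<le> L * (h * R)" using L h R by simp
      ultimately show ?thesis using core[OF s, of F] by simp
    qed
  qed
  then show "norm (x' - x) \<le> h * (M + 3 * C * L)" "norm v' \<le> norm v + h * (3 * L)"
    "norm (x' - x - h *\<^sub>R turned B \<epsilon> h x v) \<le> \<Lambda> * (h * \<epsilon>)"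
    "norm (v' - turned B \<epsilon> h x v - h *\<^sub>R forcing exact B E \<epsilon> h x) \<le> \<Lambda> * (h * \<epsilon>)"
    by (auto simp: vt_def R_def)
qed


section \<open>Local error of the exact flow on short substeps\<close>

text \<open>Uniform continuity of f' on the compact interval makes the o(k) in the definition of the
  derivative uniform in t. There is no rate in k, but \<eta> can be chosen afterwards as
  \<epsilon>.\<close>

lemma uniform_increment:
  fixes f f' :: "real \<Rightarrow> 'a::real_normed_vector"
  assumes d: "\<And>t. t \<in> {0..T} \<Longrightarrow> (f has_vector_derivative f' t) (at t within {0..T})"
    and c: "continuous_on {0..T} f'" and "0 < \<eta>"
  obtains d where "0 < d" "\<And>t k. 0 \<le> t \<Longrightarrow> 0 < k \<Longrightarrow> k \<le> d \<Longrightarrow> t + k \<le> T \<Longrightarrow>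
    norm (f (t + k) - f t - k *\<^sub>R f' t) \<le> \<eta> * k"
proof -
  have "uniformly_continuous_on {0..T} f'"
    using c by (rule compact_uniformly_continuous) simp
  then obtain d where d0: "d > 0" and dd: "\<And>s t. s \<in> {0..T} \<Longrightarrow> t \<in> {0..T} \<Longrightarrow> dist s t < d \<Longrightarrow> dist (f' s) (f' t) < \<eta>"
    unfolding uniformly_continuous_on_def using \<open>0 < \<eta>\<close> by metis
  show thesis
  proof (rule that[of "d / 2"])
    fix t k :: real
    assume *: "0 \<le> t" "0 < k" "k \<le> d / 2" "t + k \<le> T"
    have "norm (f (t + k) - f t - ((t + k) - t) *\<^sub>R f' t) \<le> norm ((t + k) - t) * \<eta>"
    proof (rule vector_differentiable_bound_linearization[where S = "{t..t+k}"])
      show "(f has_vector_derivative f' s) (at s within {t..t + k})" if "s \<in> {t..t + k}" for s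
        by (rule has_vector_derivative_within_subset[OF d]) (use * that in auto)
      show "norm (f' s - f' t) \<le> \<eta>" if "s \<in> {t..t + k}" for s
        using dd[of s t] that * d0 by (auto simp: dist_norm)
    qed (use * in \<open>auto simp: closed_segment_eq_real_ivl\<close>)
    then show "norm (f (t + k) - f t - k *\<^sub>R f' t) \<le> \<eta> * k"
      using * by (simp add: mult.commute)
  qed (use d0 in simp)
qed

lemma sin_minus_self_le: "\<bar>sin z - z\<bar> \<le> z\<^sup>2" if "0 \<le> z" for z :: real
proof (cases "z = 0")
  case False
  with that have "0 < z" by simp
  have "((\<lambda>x. sin x - x) has_real_derivative (cos w - 1)) (at w)" for w :: real
    by (auto intro!: derivative_eq_intros)
  from MVT2[OF \<open>0 < z\<close> this]
  obtain y where y: "0 < y" "y < z" "sin z - z = z * (cos y - 1)" by auto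
  have "\<bar>1 - cos y\<bar> \<le> y"
    using abs_sin_div_le(2)[of y] y(1) by (simp add: abs_divide field_simps)
  then have "z * \<bar>cos y - 1\<bar> \<le> z * z" using y that by (intro mult_left_mono) auto
  then show ?thesis using y(3) that by (simp add: abs_mult power2_eq_square)
qed simp

lemma one_minus_cos_le: "\<bar>cos z - 1\<bar> \<le> z\<^sup>2" for z :: real
proof -
  have "\<bar>cos z - 1\<bar> = 2 * (\<bar>sin (z/2)\<bar> * \<bar>sin (z/2)\<bar>)"
    using cos_double_sin[of "z/2"] by (simp add: power2_eq_square flip: abs_mult)
  also have "\<dots> \<le> 2 * (\<bar>z/2\<bar> * \<bar>z/2\<bar>)"
    using abs_sin_le[of "z/2"] by (intro mult_left_mono mult_mono) auto
  also have "\<dots> \<le> z\<^sup>2" by (simp add: power2_eq_square flip: abs_mult)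
  finally show ?thesis .
qed

lemma turned_expansion:
  assumes "B x \<noteq> 0" "0 < \<epsilon>" "0 \<le> k"
  shows "norm (turned B \<epsilon> k x v - v) \<le> 2 * angle B \<epsilon> k x * norm v"
    and "norm (turned B \<epsilon> k x v - v - k *\<^sub>R cross3 v ((1 / \<epsilon>) *\<^sub>R B x)) \<le> 2 * (angle B \<epsilon> k x)\<^sup>2 * norm v"
proof -
  define b \<theta> where "b = unit_field B x" and "\<theta> = angle B \<epsilon> k x"
  have b: "norm b = 1" unfolding b_def by (rule norm_unit_field[of B x, OF assms(1)])
  have \<theta>: "0 \<le> \<theta>" using assms by (simp add: \<theta>_def angle_def)
  have n: "norm (perp b v) \<le> norm v" "norm (cross3 v b) \<le> norm v"
    by (rule power2_le_imp_le; simp add: norm_perp[OF b] norm_cross3_unit[OF b])+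
  have t: "turned B \<epsilon> k x v - v = (cos \<theta> - 1) *\<^sub>R perp b v + sin \<theta> *\<^sub>R cross3 v b"
    by (simp add: turned_def rot_def b_def[symmetric] \<theta>_def[symmetric] perp_def algebra_simps)
  have c: "k *\<^sub>R cross3 v ((1 / \<epsilon>) *\<^sub>R B x) = \<theta> *\<^sub>R cross3 v b"
    using assms(1) by (simp add: b_def unit_field_def \<theta>_def angle_def cross_mult_right)
  have "\<bar>cos \<theta> - 1\<bar> \<le> \<theta>"
    using abs_sin_div_le(2)[of \<theta>] \<theta> by (cases "\<theta> = 0") (auto simp: abs_divide field_simps)
  then have "\<bar>cos \<theta> - 1\<bar> * norm (perp b v) \<le> \<theta> * norm v" "\<bar>sin \<theta>\<bar> * norm (cross3 v b) \<le> \<theta> * norm v"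
    using n \<theta> abs_sin_le[of \<theta>] by (auto intro!: mult_mono)
  then show "norm (turned B \<epsilon> k x v - v) \<le> 2 * angle B \<epsilon> k x * norm v"
    unfolding t \<theta>_def[symmetric]
    using norm_triangle_ineq[of "(cos \<theta> - 1) *\<^sub>R perp b v" "sin \<theta> *\<^sub>R cross3 v b"] by simp
  have "\<bar>cos \<theta> - 1\<bar> * norm (perp b v) \<le> \<theta>\<^sup>2 * norm v" "\<bar>sin \<theta> - \<theta>\<bar> * norm (cross3 v b) \<le> \<theta>\<^sup>2 * norm v"
    using n one_minus_cos_le[of \<theta>] sin_minus_self_le[OF \<theta>] by (auto intro!: mult_mono)
  moreover have "turned B \<epsilon> k x v - v - \<theta> *\<^sub>R cross3 v b
      = (cos \<theta> - 1) *\<^sub>R perp b v + (sin \<theta> - \<theta>) *\<^sub>R cross3 v b"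
    unfolding t by (simp add: scaleR_diff_left)
  ultimately show "norm (turned B \<epsilon> k x v - v - k *\<^sub>R cross3 v ((1 / \<epsilon>) *\<^sub>R B x)) \<le> 2 * (angle B \<epsilon> k x)\<^sup>2 * norm v"
    unfolding c \<theta>_def[symmetric]
    using norm_triangle_ineq[of "(cos \<theta> - 1) *\<^sub>R perp b v" "(sin \<theta> - \<theta>) *\<^sub>R cross3 v b"] by simp
qed

lemma exact_local_error:
  assumes sol: "cpd_solution B E \<epsilon> T x0 v0 x v" and \<epsilon>: "0 < \<epsilon>"
    and cB: "continuous_on UNIV B" and cE: "continuous_on UNIV E"
    and nz: "\<And>t. t \<in> {0..T} \<Longrightarrow> B (x t) \<noteq> 0" and \<eta>: "0 < \<eta>"
  obtains d where "0 < d" "\<And>t k. 0 \<le> t \<Longrightarrow> 0 < k \<Longrightarrow> k \<le> d \<Longrightarrow> t + k \<le> T \<Longrightarrow>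
      norm (x (t + k) - x t - k *\<^sub>R turned B \<epsilon> k (x t) (v t)) \<le> \<eta> * k \<and>
      norm (v (t + k) - turned B \<epsilon> k (x t) (v t) - k *\<^sub>R E (x t)) \<le> \<eta> * k"
proof -
  define a where "a t = cross3 (v t) ((1 / \<epsilon>) *\<^sub>R B (x t)) + E (x t)" for t
  have dx: "(x has_vector_derivative v t) (at t within {0..T})"
    and dv: "(v has_vector_derivative a t) (at t within {0..T})" if "t \<in> {0..T}" for t
    using sol that unfolding cpd_solution_def a_def by auto
  have cx: "continuous_on {0..T} x" and cv: "continuous_on {0..T} v"
    using has_vector_derivative_continuous[OF dx] has_vector_derivative_continuous[OF dv]
    by (simp_all add: continuous_on_eq_continuous_within)
  have cBx: "continuous_on {0..T} (\<lambda>t. B (x t))" and cEx: "continuous_on {0..T} (\<lambda>t. E (x t))"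
    using continuous_on_compose2[OF cB cx] continuous_on_compose2[OF cE cx] by auto
  have ca: "continuous_on {0..T} a"
    unfolding a_def by (intro continuous_on_add continuous_on_cross cv cEx continuous_intros cBx)
  obtain b0 where b0: "b0 > 0" "\<And>t. t \<in> {0..T} \<Longrightarrow> norm (B (x t)) \<le> b0"
    using compact_imp_bounded[OF compact_continuous_image[OF cBx compact_Icc]] bounded_pos by (metis image_eqI)
  obtain V where V: "V > 0" "\<And>t. t \<in> {0..T} \<Longrightarrow> norm (v t) \<le> V"
    using compact_imp_bounded[OF compact_continuous_image[OF cv compact_Icc]] bounded_pos by (metis image_eqI)
  have "0 < \<eta> / 2" using \<eta> by simp
  obtain d1 where d1: "0 < d1" "\<And>t k. 0 \<le> t \<Longrightarrow> 0 < k \<Longrightarrow> k \<le> d1 \<Longrightarrow> t + k \<le> T \<Longrightarrow>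
    norm (x (t + k) - x t - k *\<^sub>R v t) \<le> \<eta> / 2 * k" using uniform_increment[OF dx cv \<open>0 < \<eta> / 2\<close>] by blast
  obtain d2 where d2: "0 < d2" "\<And>t k. 0 \<le> t \<Longrightarrow> 0 < k \<Longrightarrow> k \<le> d2 \<Longrightarrow> t + k \<le> T \<Longrightarrow>
    norm (v (t + k) - v t - k *\<^sub>R a t) \<le> \<eta> / 2 * k" using uniform_increment[OF dv ca \<open>0 < \<eta> / 2\<close>] by blast
  define \<Theta> where "\<Theta> = b0 / \<epsilon>"
  have \<Theta>: "0 < \<Theta>" using b0 \<epsilon> by (simp add: \<Theta>_def)
  \<comment> \<open>Half of \<eta> k is reserved for the increments of x and v. The two quotients
    keep the rotation errors 2 k \<theta> |v| and 2 \<theta>^2 |v|, where \<theta> <= k \<Theta>,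
    within the other half.\<close>
  define d where "d = min (min d1 d2) (min (\<eta> / (4 * \<Theta> * V)) (\<eta> / (4 * \<Theta>\<^sup>2 * V)))"
  show thesis
  proof (rule that[of d])
    show "0 < d" using d1 d2 \<eta> \<Theta> V by (simp add: d_def)
    fix t k :: real
    assume *: "0 \<le> t" "0 < k" "k \<le> d" "t + k \<le> T"
    then have t: "t \<in> {0..T}" by auto
    have k: "k * (4 * \<Theta> * V) \<le> \<eta>" "k * (4 * \<Theta>\<^sup>2 * V) \<le> \<eta>"
      using *(3) \<Theta> V by (simp_all add: d_def pos_le_divide_eq)
    define \<theta> where "\<theta> = angle B \<epsilon> k (x t)"
    have \<theta>: "0 \<le> \<theta>" "\<theta> \<le> k * \<Theta>"
      using b0(2)[OF t] * \<epsilon> by (simp_all add: \<theta>_def angle_def \<Theta>_def mult_left_mono divide_right_mono)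
    note e = turned_expansion[of B "x t" \<epsilon> k "v t", OF nz[OF t] \<epsilon> less_imp_le[OF *(2)], folded \<theta>_def]
    have "2 * \<theta> * norm (v t) \<le> 2 * (k * \<Theta>) * V" using \<theta> V(2)[OF t] V(1) by (intro mult_mono) auto
    then have "norm (turned B \<epsilon> k (x t) (v t) - v t) \<le> \<eta> / 2" using e(1) k(1) by simp
    then have "k * norm (turned B \<epsilon> k (x t) (v t) - v t) \<le> k * (\<eta> / 2)" using * by (intro mult_left_mono) auto
    then have 1: "norm (k *\<^sub>R (turned B \<epsilon> k (x t) (v t) - v t)) \<le> \<eta> / 2 * k" using * by (simp add: mult.commute)
    have 2: "norm (x (t + k) - x t - k *\<^sub>R v t) \<le> \<eta> / 2 * k" using d1(2) * by (simp add: d_def)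
    have "x (t + k) - x t - k *\<^sub>R turned B \<epsilon> k (x t) (v t)
        = (x (t + k) - x t - k *\<^sub>R v t) - k *\<^sub>R (turned B \<epsilon> k (x t) (v t) - v t)"
      by (simp add: scaleR_diff_right)
    then have A: "norm (x (t + k) - x t - k *\<^sub>R turned B \<epsilon> k (x t) (v t)) \<le> \<eta> * k"
      using norm_triangle_ineq4[of "x (t + k) - x t - k *\<^sub>R v t" "k *\<^sub>R (turned B \<epsilon> k (x t) (v t) - v t)"] 1 2
      by (simp add: field_simps)
    have "2 * \<theta>\<^sup>2 * norm (v t) \<le> 2 * (k * \<Theta>)\<^sup>2 * V"
      using \<theta> V(2)[OF t] V(1) by (intro mult_mono power_mono) auto
    also have "\<dots> = (k * (4 * \<Theta>\<^sup>2 * V)) * k / 2" by (simp add: power_mult_distrib power2_eq_square)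
    also have "\<dots> \<le> \<eta> * k / 2" using k(2) * by (intro divide_right_mono mult_right_mono) auto
    finally have 3: "norm (turned B \<epsilon> k (x t) (v t) - v t - k *\<^sub>R cross3 (v t) ((1 / \<epsilon>) *\<^sub>R B (x t))) \<le> \<eta> / 2 * k"
      using e(2) by simp
    have 4: "norm (v (t + k) - v t - k *\<^sub>R a t) \<le> \<eta> / 2 * k" using d2(2) * by (simp add: d_def)
    have "v (t + k) - turned B \<epsilon> k (x t) (v t) - k *\<^sub>R E (x t) = (v (t + k) - v t - k *\<^sub>R a t)
        - (turned B \<epsilon> k (x t) (v t) - v t - k *\<^sub>R cross3 (v t) ((1 / \<epsilon>) *\<^sub>R B (x t)))"
      by (simp add: a_def scaleR_add_right)
    then have "norm (v (t + k) - turned B \<epsilon> k (x t) (v t) - k *\<^sub>R E (x t)) \<le> \<eta> * k"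
      using norm_triangle_ineq4[of "v (t + k) - v t - k *\<^sub>R a t"
          "turned B \<epsilon> k (x t) (v t) - v t - k *\<^sub>R cross3 (v t) ((1 / \<epsilon>) *\<^sub>R B (x t))"] 3 4
      by (simp add: field_simps)
    with A show "norm (x (t + k) - x t - k *\<^sub>R turned B \<epsilon> k (x t) (v t)) \<le> \<eta> * k \<and>
      norm (v (t + k) - turned B \<epsilon> k (x t) (v t) - k *\<^sub>R E (x t)) \<le> \<eta> * k" by blast
  qed
qed

lemma sin_ge_half:
  fixes z :: real
  assumes "0 \<le> z" "z \<le> 1"
  shows "z / 2 \<le> sin z"
proof (cases "z = 0")
  case False
  with assms have "0 < z" by simp
  from MVT2[OF this, of sin cos] obtain y where y: "0 < y" "y < z" "sin z = z * cos y"
    by (auto intro!: derivative_eq_intros)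
  have "2 * (\<bar>sin (y/2)\<bar> * \<bar>sin (y/2)\<bar>) \<le> 2 * (\<bar>y/2\<bar> * \<bar>y/2\<bar>)"
    using abs_sin_le[of "y/2"] by (intro mult_left_mono mult_mono) auto
  also have "\<dots> = y * y / 2" by (simp flip: abs_mult)
  also have "\<dots> \<le> 1 * 1 / 2" using y assms by (intro divide_right_mono mult_mono) auto
  finally have "1/2 \<le> cos y" using cos_double_sin[of "y/2"] by (simp add: power2_eq_square flip: abs_mult)
  then have "z * (1/2) \<le> z * cos y" using assms by (intro mult_left_mono) auto
  then show ?thesis using y by simp
qed simp

text \<open>For angles in [0,1] the sine is at least half its argument, and the angle is at least
  \<beta> k/\<epsilon>; hence the constant \<beta>/4, independent of k.\<close>

lemma nonresonant_small:
  assumes "0 < \<epsilon>" "0 < k" "\<beta> \<le> norm (B x)" "0 < \<beta>" "k / \<epsilon> * norm (B x) \<le> 1"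
  shows "nonresonant B \<epsilon> k (\<beta> / 4) x"
proof -
  define \<theta> where "\<theta> = angle B \<epsilon> k x"
  have \<theta>: "0 \<le> \<theta>" "\<theta> \<le> 1" using assms by (simp_all add: \<theta>_def angle_def)
  have "k / \<epsilon> * \<beta> \<le> \<theta>" unfolding \<theta>_def angle_def using assms by (intro mult_left_mono) auto
  then have "\<beta> / 4 * (k / \<epsilon>) \<le> \<theta> / 4" by (simp add: mult.commute)
  moreover have "\<theta> / 4 \<le> sin (\<theta> / 2)" "\<theta> / 2 \<le> sin \<theta>"
    using sin_ge_half[of "\<theta>/2"] sin_ge_half[of \<theta>] \<theta> by auto
  ultimately show ?thesis unfolding nonresonant_def \<theta>_def[symmetric] using \<theta> by linarith
qed


lemma norm_snd_slow_vars:
  assumes "B x \<noteq> 0" "norm v \<le> V"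
  shows "norm (snd (slow_vars B x v)) \<le> V + V\<^sup>2"
proof -
  have "\<bar>unit_field B x \<bullet> v\<bar> \<le> norm v"
    using Cauchy_Schwarz_ineq2[of "unit_field B x" v] norm_unit_field[of B x, OF assms(1)] by simp
  moreover have "(norm v)\<^sup>2 \<le> V\<^sup>2" using assms(2) by (intro power_mono) auto
  moreover have "norm ((norm v)\<^sup>2 / 2) = (norm v)\<^sup>2 / 2" by simp
  ultimately show ?thesis
    using norm_Pair_le[of "unit_field B x \<bullet> v" "(norm v)\<^sup>2 / 2"] assms(2) zero_le_power2[of V]
    unfolding slow_vars_def snd_conv real_norm_def by linarith
qed

section \<open>Averaging along the exact flow\<close>

text \<open>The witness for \<phi> uses the correctors for the substep h/m rather than for h. The
  comparison needs only that \<phi> is O(\<epsilon>) away from the slow variables and that its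
  increments are h times the averaged field up to O(h \<epsilon>), so no non-resonance for h itself
  is needed along the exact flow.\<close>

lemma exact_averaging:
  fixes M T :: real
  assumes \<beta>: "0 < \<beta>" and \<sigma>: "0 < \<sigma>" and L: "1 \<le> L" and T: "0 < T" and M: "0 \<le> M"
  obtains A where "A > 0" "\<And>B E \<epsilon> h x0 v0 x v. continuous_on UNIV B \<Longrightarrow> continuous_on UNIV E \<Longrightarrow>
    0 < \<epsilon> \<Longrightarrow> \<epsilon> \<le> 1 \<Longrightarrow> 0 < h \<Longrightarrow> h \<le> C * \<epsilon> \<Longrightarrow> A * h < \<sigma> \<Longrightarrow> norm v0 \<le> M \<Longrightarrow> cpd_solution B E \<epsilon> T x0 v0 x v \<Longrightarrow>
    (\<And>t. t \<in> {0..T} \<Longrightarrow> regular L \<beta> (ball (x t) \<sigma>) B E) \<Longrightarrow>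
    (\<forall>n. real n * h \<le> T \<longrightarrow> norm (v (real n * h)) \<le> M + T * (L + 1)) \<and>
    (\<exists>\<phi>. \<forall>n. real (Suc n) * h \<le> T \<longrightarrow>
       norm (\<phi> n - slow_vars B (x (real n * h)) (v (real n * h))) \<le> A * \<epsilon> \<and>
       norm (\<phi> (Suc n) - slow_vars B (x (real (Suc n) * h)) (v (real (Suc n) * h))) \<le> A * \<epsilon> \<and>
       norm (\<phi> (Suc n) - \<phi> n - h *\<^sub>R averaged B E (slow_vars B (x (real n * h)) (v (real n * h)))) \<le> A * (h * \<epsilon>) \<and>
       norm (slow_vars B (x (real (Suc n) * h)) (v (real (Suc n) * h)) - slow_vars B (x (real n * h)) (v (real n * h))) \<le> A * h)"
proof -
  define V where "V = M + T * (L + 1)"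
  have V: "0 \<le> V" using M T L by (simp add: V_def)
  have "0 < \<beta> / 4" using \<beta> by simp
  from split_step_averaging[OF \<beta> this, where L = L and M = V and C = 1 and \<Lambda> = 1]
  obtain A1 where A1: "A1 > 0" "\<And>exact B E S \<epsilon> h x v y w. split_step L \<beta> V 1 (\<beta> / 4) 1 exact B E S \<epsilon> h x v y w \<Longrightarrow>
     norm (slow_vars B y w - correctors exact B E \<epsilon> h y w - (slow_vars B x v - correctors exact B E \<epsilon> h x v)
       - h *\<^sub>R averaged B E (slow_vars B x v)) \<le> A1 * (h * \<epsilon>) \<and>
     norm (correctors exact B E \<epsilon> h x v) \<le> A1 * \<epsilon> \<and> norm (correctors exact B E \<epsilon> h y w) \<le> A1 * \<epsilon> \<and>
     norm (slow_vars B y w - slow_vars B x v) \<le> A1 * h" by blast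
  obtain AL where AL: "AL > 0" "\<And>B E S Y Z. regular L \<beta> S B E \<Longrightarrow> fst Y \<in> S \<Longrightarrow> fst Z \<in> S \<Longrightarrow> norm (snd Y) \<le> V + V\<^sup>2 \<Longrightarrow>
    norm (snd Z) \<le> V + V\<^sup>2 \<Longrightarrow> norm (averaged B E Z - averaged B E Y) \<le> AL * norm (Z - Y)"
    using averaged_lipschitz[OF \<beta>] by blast
  \<comment> \<open>A1 collects the errors of the substeps; the second summand is the price of
    freezing the averaged field over a whole step of length h <= C \<epsilon>.\<close>
  define A where "A = A1 + AL * A1 * \<bar>C\<bar>"
  have AA1: "A1 \<le> A" using A1 AL by (simp add: A_def)
  show thesis
  proof (rule that)
    show "A > 0" using A1(1) AA1 by linarith
    fix B E \<epsilon> h x0 v0 x v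
    assume cB: "continuous_on UNIV B" and cE: "continuous_on UNIV E" and \<epsilon>: "0 < \<epsilon>" "\<epsilon> \<le> 1" and h: "0 < h" "h \<le> C * \<epsilon>"
      and Ah: "A * h < \<sigma>" and v0: "norm v0 \<le> M" and sol: "cpd_solution B E \<epsilon> T x0 v0 x v"
      and reg: "\<And>t. t \<in> {0..T} \<Longrightarrow> regular L \<beta> (ball (x t) \<sigma>) B E"
    have here: "x t \<in> ball (x t) \<sigma>" for t using \<sigma> by simp
    have nz: "B (x t) \<noteq> 0" and \<beta>B: "\<beta> \<le> norm (B (x t))" if "t \<in> {0..T}" for t
      using regularD(2,3)[OF reg[OF that] here] \<beta> by auto
    have BL: "norm (B (x t)) \<le> L" and EL: "norm (E (x t)) \<le> L" if "t \<in> {0..T}" for t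
      using reg[OF that] here[of t] unfolding regular_def by blast+
    obtain d where d: "0 < d" "\<And>t k. 0 \<le> t \<Longrightarrow> 0 < k \<Longrightarrow> k \<le> d \<Longrightarrow> t + k \<le> T \<Longrightarrow>
      norm (x (t + k) - x t - k *\<^sub>R turned B \<epsilon> k (x t) (v t)) \<le> \<epsilon> * k \<and>
      norm (v (t + k) - turned B \<epsilon> k (x t) (v t) - k *\<^sub>R E (x t)) \<le> \<epsilon> * k"
      using exact_local_error[OF sol \<epsilon>(1) cB cE nz \<epsilon>(1)] by blast
    \<comment> \<open>The bound on the substep depends on the solution through \<open>d\<close>, but no constant below depends on it.\<close>
    define \<kappa> where "\<kappa> = min d (min (\<epsilon> / L) (\<sigma> / (2 * (V + 1))))"
    have \<kappa>: "0 < \<kappa>" using d \<epsilon> L \<sigma> V by (simp add: \<kappa>_def)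
    obtain m :: nat where m: "h / \<kappa> < real m" using reals_Archimedean2 by blast
    then have m0: "0 < m" using h \<kappa> by (metis divide_pos_pos of_nat_0_less_iff order_less_trans)
    define k where "k = h / real m"
    have k0: "0 < k" using h m0 by (simp add: k_def)
    have km: "real m * k = h" using m0 by (simp add: k_def)
    have k\<kappa>: "k \<le> \<kappa>" using m \<kappa> m0 by (simp add: k_def field_simps)
    have kd: "k \<le> d" and k\<epsilon>: "k * L \<le> \<epsilon>" and k\<sigma>: "k * (2 * (V + 1)) \<le> \<sigma>"
      using k\<kappa> L V by (simp_all add: \<kappa>_def pos_le_divide_eq)
    have k\<epsilon>': "k \<le> \<epsilon>" 
    proof -
      have "k * 1 \<le> k * L" using k0 L by (intro mult_left_mono) auto
      then show ?thesis using k\<epsilon> by simp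
    qed
    define xj vj where "xj j = x (real j * k)" and "vj j = v (real j * k)" for j
    \<comment> \<open>The rotation preserves the norm, so a substep adds at most k L through E and k
      through the local error \<epsilon> k.\<close>
    have node: "norm (vj j) \<le> M + real j * k * (L + 1)" if "real j * k \<le> T" for j
      using that
    proof (induction j)
      case 0
      show ?case using sol v0 by (simp add: vj_def cpd_solution_def)
    next
      case (Suc j)
      have j: "real j * k + k \<le> T" using Suc.prems by (simp add: algebra_simps)
      have jT: "real j * k \<in> {0..T}" using j k0 by auto
      have eq: "real (Suc j) * k = real j * k + k" by (simp add: algebra_simps)
      have "norm (vj (Suc j) - turned B \<epsilon> k (xj j) (vj j) - k *\<^sub>R E (xj j)) \<le> \<epsilon> * k"
        unfolding vj_def xj_def eq using d(2)[of "real j * k" k] j k0 kd by simp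
      moreover have "norm (turned B \<epsilon> k (xj j) (vj j)) = norm (vj j)"
        unfolding turned_def xj_def by (rule norm_rot[OF norm_unit_field[of B "x (real j * k)", OF nz[OF jT]]])
      moreover have "norm (k *\<^sub>R E (xj j)) \<le> k * L" using EL[OF jT] k0 by (simp add: xj_def)
      moreover have "\<epsilon> * k \<le> 1 * k" using \<epsilon> k0 by (intro mult_right_mono) auto
      ultimately have "norm (vj (Suc j)) \<le> norm (vj j) + k * L + k"
        using norm_triangle_ineq[of "vj (Suc j) - turned B \<epsilon> k (xj j) (vj j) - k *\<^sub>R E (xj j)"
            "turned B \<epsilon> k (xj j) (vj j) + k *\<^sub>R E (xj j)"]
          norm_triangle_ineq[of "turned B \<epsilon> k (xj j) (vj j)" "k *\<^sub>R E (xj j)"] by simp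
      also have "\<dots> \<le> (M + real j * k * (L + 1)) + k * L + k"
        using Suc.IH j k0 by simp
      finally show ?case by (simp add: algebra_simps)
    qed
    have vV: "norm (vj j) \<le> V" if "real j * k \<le> T" for j
    proof -
      have "real j * k * (L + 1) \<le> T * (L + 1)" using that L by (intro mult_right_mono) auto
      then show ?thesis using node[OF that] by (simp add: V_def)
    qed
    have micro: "split_step L \<beta> V 1 (\<beta> / 4) 1 True B E (ball (xj j) \<sigma>) \<epsilon> k (xj j) (vj j) (xj (Suc j)) (vj (Suc j))"
      if "real (Suc j) * k \<le> T" for j
    proof -
      have eq: "real (Suc j) * k = real j * k + k" by (simp add: algebra_simps)
      have j: "real j * k + k \<le> T" using that by (simp add: algebra_simps)
      have jT: "real j * k \<in> {0..T}" "real (Suc j) * k \<in> {0..T}" using j k0 that by auto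
      have e: "norm (xj (Suc j) - xj j - k *\<^sub>R turned B \<epsilon> k (xj j) (vj j)) \<le> \<epsilon> * k"
        "norm (vj (Suc j) - turned B \<epsilon> k (xj j) (vj j) - k *\<^sub>R E (xj j)) \<le> \<epsilon> * k"
        unfolding vj_def xj_def eq using d(2)[of "real j * k" k] j k0 kd by simp_all
      have "norm (turned B \<epsilon> k (xj j) (vj j)) = norm (vj j)"
        unfolding turned_def xj_def by (rule norm_rot[OF norm_unit_field[of B "x (real j * k)", OF nz[OF jT(1)]]])
      then have "norm (k *\<^sub>R turned B \<epsilon> k (xj j) (vj j)) \<le> k * V" using vV[of j] jT k0 by simp
      moreover have "\<epsilon> * k \<le> 1 * k" using \<epsilon> k0 by (intro mult_right_mono) auto
      ultimately have "norm (xj (Suc j) - xj j) \<le> k * V + k"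
        using e(1) norm_triangle_ineq[of "xj (Suc j) - xj j - k *\<^sub>R turned B \<epsilon> k (xj j) (vj j)" "k *\<^sub>R turned B \<epsilon> k (xj j) (vj j)"]
        by simp
      also have "\<dots> < k * (2 * (V + 1))"
      proof -
        have "0 \<le> k * V" using k0 V by (intro mult_nonneg_nonneg) auto
        moreover have "k * (2 * (V + 1)) = 2 * (k * V) + 2 * k" by (simp add: algebra_simps)
        ultimately show ?thesis using k0 by linarith
      qed
      finally have "norm (xj (Suc j) - xj j) < \<sigma>" using k\<sigma> by linarith
      then have yS: "xj (Suc j) \<in> ball (xj j) \<sigma>" by (simp add: dist_norm norm_minus_commute)
      have nr: "nonresonant B \<epsilon> k (\<beta> / 4) (x t)" if "t \<in> {0..T}" for t
      proof (rule nonresonant_small[of \<epsilon> k \<beta> B "x t", OF \<epsilon>(1) k0 \<beta>B[OF that] \<beta>])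
        have "k * norm (B (x t)) \<le> k * L" using BL[OF that] k0 by simp
        then show "k / \<epsilon> * norm (B (x t)) \<le> 1" using k\<epsilon> \<epsilon> by (simp add: field_simps)
      qed
      show ?thesis
        unfolding split_step_def forcing_def
        using reg[OF jT(1)] here yS \<epsilon> k0 k\<epsilon>' vV[of j] jT nr[OF jT(1)] nr[OF jT(2)] e
        by (simp add: xj_def mult.commute)
    qed
    define z where "z j = slow_vars B (xj j) (vj j)" for j
    define f where "f j = z j - correctors True B E \<epsilon> k (xj j) (vj j)" for j
    note mf = A1(2)[OF micro, folded z_def, folded f_def]
    have zS: "norm (snd (z j)) \<le> V + V\<^sup>2" if "real j * k \<le> T" for j
      unfolding z_def xj_def using nz[of "real j * k"] vV[OF that] that k0
      by (intro norm_snd_slow_vars) auto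
    \<comment> \<open>Sum over the first i substeps of a full step, with the averaged field frozen
      at the start of that step. The bound on z together with A h < \<sigma> keeps the position in
      the ball around the start, where the field is Lipschitz.\<close>
    have macro: "norm (z (n * m + i) - z (n * m)) \<le> A1 * (real i * k) \<and>
        norm (f (n * m + i) - f (n * m) - (real i * k) *\<^sub>R averaged B E (z (n * m))) \<le> (real i * k) * (A * \<epsilon>)"
      if n: "real (Suc n) * h \<le> T" and i: "i \<le> m" for n i
      using i
    proof (induction i)
      case 0
      show ?case by simp
    next
      case (Suc i)
      define j where "j = n * m + i"
      have "real (Suc j) * k \<le> real (n * m + m) * k" using Suc.prems k0 by (intro mult_right_mono) (auto simp: j_def)
      also have "\<dots> = real (Suc n) * h" using km by (simp add: algebra_simps)
      finally have jT: "real (Suc j) * k \<le> T" using n by simp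
      then have jT': "real j * k \<le> T" using k0 by (simp add: algebra_simps)
      have nT: "real (n * m) * k \<le> T"
      proof -
        have "real (n * m) * k \<le> real j * k" using k0 by (intro mult_right_mono) (auto simp: j_def)
        then show ?thesis using jT' by linarith
      qed
      have IH: "norm (z j - z (n * m)) \<le> A1 * (real i * k)"
        "norm (f j - f (n * m) - (real i * k) *\<^sub>R averaged B E (z (n * m))) \<le> (real i * k) * (A * \<epsilon>)"
        using Suc by (auto simp: j_def)
      note s = mf[OF jT]
      have "A1 * (real i * k) \<le> A1 * (real m * k)" using Suc.prems A1 k0 by (intro mult_left_mono mult_right_mono) auto
      then have zh: "norm (z j - z (n * m)) \<le> A1 * h" using IH(1) km by simp
      have "norm (fst (z j) - fst (z (n * m))) \<le> norm (z j - z (n * m))"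
        using norm_fst_le'[of "z j - z (n * m)"] by simp
      also have "\<dots> \<le> A * h" using zh mult_right_mono[OF AA1, of h] h by linarith
      finally have "norm (xj j - xj (n * m)) < \<sigma>" using Ah by (simp add: z_def slow_vars_def)
      then have jS: "fst (z j) \<in> ball (xj (n * m)) \<sigma>" by (simp add: z_def slow_vars_def dist_norm norm_minus_commute)
      have rn: "regular L \<beta> (ball (xj (n * m)) \<sigma>) B E" unfolding xj_def using nT k0 by (intro reg) auto
      have "norm (averaged B E (z j) - averaged B E (z (n * m))) \<le> AL * norm (z j - z (n * m))"
        using \<sigma> jS zS[OF jT'] zS[OF nT] by (intro AL(2)[OF rn]) (auto simp: z_def slow_vars_def)
      also have "\<dots> \<le> AL * (A1 * (\<bar>C\<bar> * \<epsilon>))"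
      proof (intro mult_left_mono order_trans[OF zh])
        have "C * \<epsilon> \<le> \<bar>C\<bar> * \<epsilon>" using \<epsilon> by (intro mult_right_mono) auto
        then show "h \<le> \<bar>C\<bar> * \<epsilon>" using h by linarith
      qed (use AL A1 in auto)
      finally have "norm (k *\<^sub>R (averaged B E (z j) - averaged B E (z (n * m)))) \<le> k * (AL * (A1 * (\<bar>C\<bar> * \<epsilon>)))"
        using k0 by simp
      then have avg: "norm (k *\<^sub>R (averaged B E (z j) - averaged B E (z (n * m)))) \<le> k * (AL * (A1 * (\<bar>C\<bar> * \<epsilon>)))" .
      have eqn: "f (Suc j) - f (n * m) - (real (Suc i) * k) *\<^sub>R averaged B E (z (n * m))
        = (f (Suc j) - f j - k *\<^sub>R averaged B E (z j)) + k *\<^sub>R (averaged B E (z j) - averaged B E (z (n * m)))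
          + (f j - f (n * m) - (real i * k) *\<^sub>R averaged B E (z (n * m)))"
        by (simp add: algebra_simps)
      have "norm (f (Suc j) - f (n * m) - (real (Suc i) * k) *\<^sub>R averaged B E (z (n * m)))
        \<le> A1 * (k * \<epsilon>) + k * (AL * (A1 * (\<bar>C\<bar> * \<epsilon>))) + (real i * k) * (A * \<epsilon>)"
        unfolding eqn using avg s IH(2) norm_triangle_ineq[of "(f (Suc j) - f j - k *\<^sub>R averaged B E (z j)) + k *\<^sub>R (averaged B E (z j) - averaged B E (z (n * m)))"
            "f j - f (n * m) - (real i * k) *\<^sub>R averaged B E (z (n * m))"]
          norm_triangle_ineq[of "f (Suc j) - f j - k *\<^sub>R averaged B E (z j)" "k *\<^sub>R (averaged B E (z j) - averaged B E (z (n * m)))"]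
        by linarith
      also have "\<dots> = (real (Suc i) * k) * (A * \<epsilon>)" by (simp add: A_def algebra_simps)
      finally have 2: "norm (f (Suc j) - f (n * m) - (real (Suc i) * k) *\<^sub>R averaged B E (z (n * m))) \<le> (real (Suc i) * k) * (A * \<epsilon>)" .
      have "norm (z (Suc j) - z (n * m)) \<le> A1 * k + A1 * (real i * k)"
        using norm_triangle_ineq[of "z (Suc j) - z j" "z j - z (n * m)"] s IH(1) by simp
      then show ?case using 2 by (simp add: j_def algebra_simps)
    qed
    have nm: "real (n * m) * k = real n * h" for n using km by (simp add: mult.assoc)
    have Zn: "slow_vars B (x (real n * h)) (v (real n * h)) = z (n * m)" for n
      by (simp only: z_def xj_def vj_def nm)
    have "norm (v (real n * h)) \<le> V" if "real n * h \<le> T" for n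
      using vV[of "n * m"] that unfolding vj_def nm .
    moreover have "norm (f (n * m) - z (n * m)) \<le> A * \<epsilon> \<and> norm (f (Suc n * m) - z (Suc n * m)) \<le> A * \<epsilon> \<and>
       norm (f (Suc n * m) - f (n * m) - h *\<^sub>R averaged B E (z (n * m))) \<le> A * (h * \<epsilon>) \<and>
       norm (z (Suc n * m) - z (n * m)) \<le> A * h" if n: "real (Suc n) * h \<le> T" for n
    proof -
      \<comment> \<open>The corrector at the right end is bounded as the end of substep m - 1, since
        a substep starting there may leave [0,T].\<close>
      have last: "Suc (n * m + (m - 1)) = Suc n * m" using m0 by simp
      have "real (Suc (n * m)) * k \<le> real (Suc n * m) * k" using m0 k0 by (intro mult_right_mono) auto
      then have n0: "real (Suc (n * m)) * k \<le> T" using n nm[of "Suc n"] by linarith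
      have n1: "real (Suc (n * m + (m - 1))) * k \<le> T" using n nm[of "Suc n"] unfolding last by linarith
      have c: "A1 * \<epsilon> \<le> A * \<epsilon>" "A1 * h \<le> A * h" using AA1 \<epsilon> h by (auto intro!: mult_right_mono)
      have a: "norm (f (n * m) - z (n * m)) \<le> A1 * \<epsilon>" using mf[OF n0] by (simp add: f_def)
      have b: "norm (f (Suc n * m) - z (Suc n * m)) \<le> A1 * \<epsilon>"
        using mf[OF n1] unfolding last f_def by simp
      have nm': "Suc n * m = n * m + m" by simp
      have "norm (z (Suc n * m) - z (n * m)) \<le> A1 * h"
        "norm (f (Suc n * m) - f (n * m) - h *\<^sub>R averaged B E (z (n * m))) \<le> h * (A * \<epsilon>)"
        using macro[OF n order_refl] unfolding km nm' by blast+
      then show ?thesis using a b c by (auto simp: mult.left_commute[of h])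
    qed
    ultimately show "(\<forall>n. real n * h \<le> T \<longrightarrow> norm (v (real n * h)) \<le> M + T * (L + 1)) \<and>
    (\<exists>\<phi>. \<forall>n. real (Suc n) * h \<le> T \<longrightarrow>
       norm (\<phi> n - slow_vars B (x (real n * h)) (v (real n * h))) \<le> A * \<epsilon> \<and>
       norm (\<phi> (Suc n) - slow_vars B (x (real (Suc n) * h)) (v (real (Suc n) * h))) \<le> A * \<epsilon> \<and>
       norm (\<phi> (Suc n) - \<phi> n - h *\<^sub>R averaged B E (slow_vars B (x (real n * h)) (v (real n * h)))) \<le> A * (h * \<epsilon>) \<and>
       norm (slow_vars B (x (real (Suc n) * h)) (v (real (Suc n) * h)) - slow_vars B (x (real n * h)) (v (real n * h))) \<le> A * h)"
      unfolding Zn V_def by (intro conjI allI impI exI[of _ "\<lambda>n. f (n * m)"]) blast+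
  qed
qed

section \<open>Comparison of the numerical and the exact solution\<close>

lemma discrete_gronwall:
  fixes d :: "nat \<Rightarrow> real"
  assumes "\<And>n. n < N \<Longrightarrow> d (Suc n) \<le> d n + h * (\<mu> * d n + b)" and "0 \<le> h" "0 \<le> \<mu>" "0 \<le> b" "0 \<le> d 0" and "n \<le> N"
  shows "d n \<le> (d 0 + real n * h * b) * exp (\<mu> * (real n * h))"
  using \<open>n \<le> N\<close>
proof (induction n)
  case (Suc n)
  define e where "e = exp (\<mu> * (real n * h))"
  define e' where "e' = exp (\<mu> * (real (Suc n) * h))"
  have ee: "e' = exp (\<mu> * h) * e" by (simp add: e_def e'_def algebra_simps flip: exp_add)
  have e1: "1 \<le> e'" using assms by (simp add: e'_def)
  have D: "0 \<le> d 0 + real n * h * b" using assms by simp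
  have "d (Suc n) \<le> (1 + \<mu> * h) * d n + h * b" using assms(1)[of n] Suc.prems by (simp add: algebra_simps)
  also have "\<dots> \<le> (1 + \<mu> * h) * ((d 0 + real n * h * b) * e) + h * b"
    using Suc assms by (intro add_right_mono mult_left_mono) (auto simp: e_def)
  also have "\<dots> \<le> exp (\<mu> * h) * ((d 0 + real n * h * b) * e) + h * b * e'"
  proof (rule add_mono)
    show "(1 + \<mu> * h) * ((d 0 + real n * h * b) * e) \<le> exp (\<mu> * h) * ((d 0 + real n * h * b) * e)"
      using D exp_ge_add_one_self[of "\<mu> * h"] by (intro mult_right_mono) (auto simp: e_def)
    show "h * b \<le> h * b * e'" using e1 assms mult_left_mono[of 1 e' "h * b"] by simp
  qed
  also have "\<dots> = (d 0 + real (Suc n) * h * b) * e'" by (simp add: ee algebra_simps)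
  finally show ?case by (simp add: e'_def)
qed simp

text \<open>Gronwall is applied to f - g, because only the corrected sequences have increments with
  error O(h \<epsilon>). Passing between corrected and original variables costs 2 a \<epsilon> three
  times: at the start, inside the Lipschitz bound (the term with \<mu>), and at the end. The
  remaining 2 a comes from the increments.\<close>

lemma averaged_comparison:
  fixes f g Y Z :: "nat \<Rightarrow> 'a::real_normed_vector"
  assumes nonneg: "0 \<le> a" "0 \<le> \<mu>" "0 \<le> \<epsilon>" "0 \<le> h" "0 \<le> T" and N: "real N * h \<le> T" and init: "Y 0 = Z 0"
    and fY: "\<And>n. n < N \<Longrightarrow> norm (f n - Y n) \<le> a * \<epsilon>" "\<And>n. n < N \<Longrightarrow> norm (f (Suc n) - Y (Suc n)) \<le> a * \<epsilon>"
    and f: "\<And>n. n < N \<Longrightarrow> norm (f (Suc n) - f n - h *\<^sub>R G (Y n)) \<le> a * (h * \<epsilon>)"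
    and gZ: "\<And>n. n < N \<Longrightarrow> norm (g n - Z n) \<le> a * \<epsilon>" "\<And>n. n < N \<Longrightarrow> norm (g (Suc n) - Z (Suc n)) \<le> a * \<epsilon>"
    and g: "\<And>n. n < N \<Longrightarrow> norm (g (Suc n) - g n - h *\<^sub>R G (Z n)) \<le> a * (h * \<epsilon>)"
    and lip: "\<And>n. n < N \<Longrightarrow> norm (G (Y n) - G (Z n)) \<le> \<mu> * norm (Y n - Z n)"
  shows "norm (Y N - Z N) \<le> ((2 * a + T * (2 * a * \<mu> + 2 * a)) * exp (\<mu> * T) + 2 * a) * \<epsilon>"
proof (cases N)
  \<comment> \<open>For N = 0 the hypotheses say nothing about f and g.\<close>
  case 0
  then show ?thesis using init nonneg by simp
next
  case (Suc N')
  define d where "d n = norm (f n - g n)" for n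
  define b where "b = (2 * a * \<mu> + 2 * a) * \<epsilon>"
  have YZ: "norm (Y n - Z n) \<le> d n + 2 * (a * \<epsilon>)" if "norm (f n - Y n) \<le> a * \<epsilon>" "norm (g n - Z n) \<le> a * \<epsilon>" for n
  proof -
    have "Y n - Z n = (f n - g n) + ((g n - Z n) - (f n - Y n))" by simp
    then show ?thesis using norm_triangle_ineq[of "f n - g n" "(g n - Z n) - (f n - Y n)"]
        norm_triangle_ineq4[of "g n - Z n" "f n - Y n"] that by (simp add: d_def)
  qed
  have d0: "d 0 \<le> 2 * (a * \<epsilon>)"
  proof -
    have "f 0 - g 0 = (f 0 - Y 0) - (g 0 - Z 0)" using init by simp
    then show ?thesis using norm_triangle_ineq4[of "f 0 - Y 0" "g 0 - Z 0"] fY(1)[of 0] gZ(1)[of 0] Suc by (simp add: d_def)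
  qed
  have "d N \<le> (d 0 + real N * h * b) * exp (\<mu> * (real N * h))"
  proof (rule discrete_gronwall[where N = N])
    fix n assume n: "n < N"
    have eqn: "f (Suc n) - g (Suc n) = (f n - g n) + ((f (Suc n) - f n - h *\<^sub>R G (Y n)) - (g (Suc n) - g n - h *\<^sub>R G (Z n)))
        + h *\<^sub>R (G (Y n) - G (Z n))" by (simp add: algebra_simps)
    have "d (Suc n) \<le> d n + (a * (h * \<epsilon>) + a * (h * \<epsilon>)) + norm (h *\<^sub>R (G (Y n) - G (Z n)))"
      unfolding d_def eqn using f[OF n] g[OF n]
        norm_triangle_ineq[of "(f n - g n) + ((f (Suc n) - f n - h *\<^sub>R G (Y n)) - (g (Suc n) - g n - h *\<^sub>R G (Z n)))"
          "h *\<^sub>R (G (Y n) - G (Z n))"]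
        norm_triangle_ineq[of "f n - g n" "(f (Suc n) - f n - h *\<^sub>R G (Y n)) - (g (Suc n) - g n - h *\<^sub>R G (Z n))"]
        norm_triangle_ineq4[of "f (Suc n) - f n - h *\<^sub>R G (Y n)" "g (Suc n) - g n - h *\<^sub>R G (Z n)"]
      by linarith
    also have "norm (h *\<^sub>R (G (Y n) - G (Z n))) \<le> h * (\<mu> * (d n + 2 * (a * \<epsilon>)))"
      using order_trans[OF lip[OF n] mult_left_mono[OF YZ[OF fY(1)[OF n] gZ(1)[OF n]] nonneg(2)]] nonneg
      by (simp add: mult_left_mono)
    finally show "d (Suc n) \<le> d n + h * (\<mu> * d n + b)" by (simp add: b_def algebra_simps)
  qed (use nonneg in \<open>auto simp: b_def d_def\<close>)
  also have "\<dots> \<le> (2 * (a * \<epsilon>) + T * b) * exp (\<mu> * T)"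
    using nonneg N d0
    by (intro mult_mono add_mono mult_right_mono) (auto simp: b_def d_def intro!: mult_left_mono mult_nonneg_nonneg add_nonneg_nonneg)
  finally have "d N \<le> (2 * (a * \<epsilon>) + T * b) * exp (\<mu> * T)" .
  then show ?thesis using YZ[of N] fY(2)[of N'] gZ(2)[of N'] Suc by (simp add: b_def algebra_simps)
qed


lemma small_enough:
  fixes K s \<epsilon> :: real
  assumes "0 \<le> K" "0 < s" "0 < \<epsilon>" "\<epsilon> \<le> s / (K + 1)"
  shows "K * \<epsilon> < s"
proof -
  have "\<epsilon> * (K + 1) \<le> s" using assms by (simp add: pos_le_divide_eq)
  then show ?thesis using assms by (simp add: algebra_simps)
qed

lemma abs_sin_angle_diff:
  assumes "\<bar>norm (B y) - norm (B x)\<bar> \<le> D" "0 < \<epsilon>" "0 < h" "0 \<le> a"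
  shows "\<bar>sin (a * angle B \<epsilon> h x)\<bar> - a * (h / \<epsilon> * D) \<le> \<bar>sin (a * angle B \<epsilon> h y)\<bar>"
proof -
  have "\<bar>sin p - sin q\<bar> \<le> \<bar>p - q\<bar>" for p q :: real
  proof -
    have "\<bar>sin p - sin q\<bar> = 2 * \<bar>sin ((p - q) / 2)\<bar> * \<bar>cos ((p + q) / 2)\<bar>"
      by (simp add: sin_diff_sin abs_mult)
    also have "\<dots> \<le> 2 * \<bar>(p - q) / 2\<bar> * 1"
      using abs_sin_le[of "(p - q) / 2"] by (intro mult_mono) auto
    finally show ?thesis by simp
  qed
  from this[of "a * angle B \<epsilon> h y" "a * angle B \<epsilon> h x"]
  have "\<bar>sin (a * angle B \<epsilon> h y) - sin (a * angle B \<epsilon> h x)\<bar> \<le> \<bar>a * (h / \<epsilon> * (norm (B y) - norm (B x)))\<bar>"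
    by (simp add: angle_def right_diff_distrib)
  also have "\<dots> = a * (h / \<epsilon> * \<bar>norm (B y) - norm (B x)\<bar>)"
    using assms by (simp add: abs_mult)
  also have "\<dots> \<le> a * (h / \<epsilon> * D)" using assms by (intro mult_left_mono) auto
  finally show ?thesis by linarith
qed

lemma sinc_lower_bound:
  assumes "c \<le> \<bar>sinc z\<bar>" "0 < z"
  shows "c * z \<le> \<bar>sin z\<bar>"
proof -
  have "\<bar>sinc z\<bar> = \<bar>sin z\<bar> / z" using assms(2) by simp
  then show ?thesis using assms by (simp add: pos_le_divide_eq)
qed

text \<open>At x the sinc bounds give |sin(\<theta>/2)| >= c \<theta>/2 and |sin \<theta>| >= c
  \<theta>, where \<theta> >= \<beta> h/\<epsilon>. Passing to y changes \<theta> by at most c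
  \<beta>/4 times h/\<epsilon>, so at least 3/8 of c \<beta> h/\<epsilon> is left in both
  cases.\<close>

lemma nonresonant_near:
  assumes res: "\<And>k. k \<in> {1, 2 :: nat} \<Longrightarrow> c \<le> \<bar>sinc (real k * (h / (2 * \<epsilon>)) * norm (B x))\<bar>"
    and B: "\<beta> \<le> norm (B x)" "\<bar>norm (B y) - norm (B x)\<bar> \<le> c * \<beta> / 4"
    and pos: "0 < \<epsilon>" "0 < h" "0 < c" "0 < \<beta>"
  shows "nonresonant B \<epsilon> h (c * \<beta> / 4) y"
proof -
  define \<theta> where "\<theta> = angle B \<epsilon> h x"
  have "h / \<epsilon> * \<beta> \<le> \<theta>" unfolding \<theta>_def angle_def using pos B by (intro mult_left_mono) auto
  then have \<theta>: "c * (h / \<epsilon> * \<beta>) \<le> c * \<theta>" using pos by (intro mult_left_mono) auto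
  have "0 < norm (B x)" using B pos by linarith
  then have \<theta>0: "0 < \<theta>" using pos unfolding \<theta>_def angle_def by simp
  have r: "c \<le> \<bar>sinc (\<theta> / 2)\<bar>" "c \<le> \<bar>sinc \<theta>\<bar>"
  proof -
    have e: "real 1 * (h / (2 * \<epsilon>)) * norm (B x) = \<theta> / 2" "real 2 * (h / (2 * \<epsilon>)) * norm (B x) = \<theta>"
      by (simp_all add: \<theta>_def angle_def)
    show "c \<le> \<bar>sinc (\<theta> / 2)\<bar>" using res[of 1] unfolding e by blast
    show "c \<le> \<bar>sinc \<theta>\<bar>" using res[of 2] unfolding e by blast
  qed
  have s: "c * (\<theta> / 2) \<le> \<bar>sin (\<theta> / 2)\<bar>" "c * \<theta> \<le> \<bar>sin \<theta>\<bar>"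
    by (rule sinc_lower_bound[OF r(1)] sinc_lower_bound[OF r(2)]; use \<theta>0 in simp)+
  have "\<bar>sin (1/2 * \<theta>)\<bar> - 1/2 * (h / \<epsilon> * (c * \<beta> / 4)) \<le> \<bar>sin (1/2 * angle B \<epsilon> h y)\<bar>"
    "\<bar>sin (1 * \<theta>)\<bar> - 1 * (h / \<epsilon> * (c * \<beta> / 4)) \<le> \<bar>sin (1 * angle B \<epsilon> h y)\<bar>"
    unfolding \<theta>_def using B pos by (intro abs_sin_angle_diff; simp)+
  moreover have "0 < c * (h / \<epsilon> * \<beta>)" using pos by simp
  ultimately show ?thesis
    using s \<theta> unfolding nonresonant_def by (simp add: mult_ac)
qed

lemma parallel_part_conv: "parallel_part B x v = fst (averaged B E (slow_vars B x v))"
  by (simp add: parallel_part_def averaged_def slow_vars_def avg_pos_def unit_field_def Let_def)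

lemma error_bounds:
  fixes M T C c \<delta> L \<beta> :: real
  assumes pos: "0 < C" "0 < c" "0 < T" "0 < \<delta>" "0 < \<beta>" and M: "0 \<le> M" and L: "1 \<le> L"
  obtains \<epsilon>0 C' where "0 < \<epsilon>0" "0 < C'"
    "\<And>K B E \<epsilon> h x0 v0 x v X V step n. C_order 2 B \<Longrightarrow> C_order 2 E \<Longrightarrow>
      derivs_bounded 2 L (\<Union>y\<in>K. ball y \<delta>) B \<Longrightarrow> derivs_bounded 2 L (\<Union>y\<in>K. ball y \<delta>) E \<Longrightarrow>
      (\<And>y. y \<in> K \<Longrightarrow> \<beta> \<le> norm (B y)) \<Longrightarrow> step \<in> {S1_AVF B E \<epsilon> h, S1_SV B E \<epsilon> h, S1_VP B E \<epsilon> h} \<Longrightarrow>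
      0 < \<epsilon> \<Longrightarrow> \<epsilon> \<le> \<epsilon>0 \<Longrightarrow> 0 < h \<Longrightarrow> h \<le> C * \<epsilon> \<Longrightarrow> norm v0 \<le> M \<Longrightarrow> cpd_solution B E \<epsilon> T x0 v0 x v \<Longrightarrow>
      (\<And>t. t \<in> {0..T} \<Longrightarrow> x t \<in> K) \<Longrightarrow>
      (\<And>t k. t \<in> {0..T} \<Longrightarrow> k \<in> {1,2::nat} \<Longrightarrow> c \<le> \<bar>sinc (real k * (h / (2 * \<epsilon>)) * norm (B (x t)))\<bar>) \<Longrightarrow>
      numerical_solution step h T x0 v0 X V \<Longrightarrow> real n * h \<le> T \<Longrightarrow>
      norm (X n - x (real n * h)) \<le> C' * \<epsilon> \<and>
      norm (parallel_part B (X n) (V n) - parallel_part B (x (real n * h)) (v (real n * h))) \<le> C' * \<epsilon> \<and>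
      norm (V n - v (real n * h)) \<le> C'"
proof -
  define \<beta>' where "\<beta>' = \<beta> / 2"
  \<comment> \<open>On a ball of radius \<beta>/(2 L) the field changes by at most \<beta>/2, so |B|
    stays above \<beta>'.\<close>
  define \<sigma> where "\<sigma> = min \<delta> (\<beta> / (2 * L))"
  \<comment> \<open>The schemes let |V| grow at rate at most 3 L; the extra 1 makes the bound
    dominate M + T (L + 1), the one for the exact velocity.\<close>
  define Vb where "Vb = M + T * (3 * L + 1)"
  define R where "R = Vb + 3 * C * L"
  define \<Lambda> where "\<Lambda> = 3 * C * L + C * L * R"
  define \<gamma> where "\<gamma> = c * \<beta> / 4"
  \<comment> \<open>Admissible distance from the exact solution: \<sigma>/2 leaves room for one more
    step inside the ball, and c \<beta>/(4 L) preserves non-resonance.\<close>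
  define \<tau> where "\<tau> = min (\<sigma> / 2) (c * \<beta> / (4 * L))"
  have p: "0 < \<beta>'" "0 < \<sigma>" "0 < \<gamma>" "0 < \<tau>" using pos L by (auto simp: \<beta>'_def \<sigma>_def \<gamma>_def \<tau>_def)
  have Vb: "0 \<le> Vb" using M pos L by (simp add: Vb_def)
  have R: "0 \<le> R" using Vb pos L by (simp add: R_def)
  obtain Ae where Ae: "Ae > 0" and exact_avg: "\<And>B E \<epsilon> h x0 v0 x v. continuous_on UNIV B \<Longrightarrow> continuous_on UNIV E \<Longrightarrow>
    0 < \<epsilon> \<Longrightarrow> \<epsilon> \<le> 1 \<Longrightarrow> 0 < h \<Longrightarrow> h \<le> C * \<epsilon> \<Longrightarrow> Ae * h < \<sigma> \<Longrightarrow> norm v0 \<le> M \<Longrightarrow> cpd_solution B E \<epsilon> T x0 v0 x v \<Longrightarrow>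
    (\<And>t. t \<in> {0..T} \<Longrightarrow> regular L \<beta>' (ball (x t) \<sigma>) B E) \<Longrightarrow>
    (\<forall>n. real n * h \<le> T \<longrightarrow> norm (v (real n * h)) \<le> M + T * (L + 1)) \<and>
    (\<exists>\<phi>. \<forall>n. real (Suc n) * h \<le> T \<longrightarrow>
       norm (\<phi> n - slow_vars B (x (real n * h)) (v (real n * h))) \<le> Ae * \<epsilon> \<and>
       norm (\<phi> (Suc n) - slow_vars B (x (real (Suc n) * h)) (v (real (Suc n) * h))) \<le> Ae * \<epsilon> \<and>
       norm (\<phi> (Suc n) - \<phi> n - h *\<^sub>R averaged B E (slow_vars B (x (real n * h)) (v (real n * h)))) \<le> Ae * (h * \<epsilon>) \<and>
       norm (slow_vars B (x (real (Suc n) * h)) (v (real (Suc n) * h)) - slow_vars B (x (real n * h)) (v (real n * h))) \<le> Ae * h)"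
    using exact_averaging[OF p(1,2) L pos(3) M, of C] by metis
  from split_step_averaging[OF p(1,3), where L = L and M = Vb and C = C and \<Lambda> = \<Lambda>]
  obtain An where An: "An > 0" "\<And>exact B E S \<epsilon> h x v y w. split_step L \<beta>' Vb C \<gamma> \<Lambda> exact B E S \<epsilon> h x v y w \<Longrightarrow>
     norm (slow_vars B y w - correctors exact B E \<epsilon> h y w - (slow_vars B x v - correctors exact B E \<epsilon> h x v)
       - h *\<^sub>R averaged B E (slow_vars B x v)) \<le> An * (h * \<epsilon>) \<and>
     norm (correctors exact B E \<epsilon> h x v) \<le> An * \<epsilon> \<and> norm (correctors exact B E \<epsilon> h y w) \<le> An * \<epsilon> \<and>
     norm (slow_vars B y w - slow_vars B x v) \<le> An * h" by blast
  obtain AL where AL: "AL > 0" "\<And>B E S Y Z. regular L \<beta>' S B E \<Longrightarrow> fst Y \<in> S \<Longrightarrow> fst Z \<in> S \<Longrightarrow> norm (snd Y) \<le> Vb + Vb\<^sup>2 \<Longrightarrow>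
    norm (snd Z) \<le> Vb + Vb\<^sup>2 \<Longrightarrow> norm (averaged B E Z - averaged B E Y) \<le> AL * norm (Z - Y)"
    using averaged_lipschitz[OF p(1)] by blast
  define a where "a = max Ae An"
  have a: "0 < a" "Ae \<le> a" "An \<le> a" using Ae by (auto simp: a_def)
  define C1 where "C1 = (2 * a + T * (2 * a * AL + 2 * a)) * exp (AL * T) + 2 * a"
  have C1: "0 < C1" unfolding C1_def using a AL pos by (intro add_nonneg_pos mult_nonneg_nonneg) auto
  \<comment> \<open>In this order: \<epsilon> <= 1; a step of the exact flow stays in the ball; h^2
    L <= 1 for the contraction; a numerical step is shorter than \<sigma>/4; the position error
    after one further step is below \<tau>.\<close>
  define \<epsilon>0 where "\<epsilon>0 = Min {1, \<sigma> / (Ae * C + 1), 1 / (C\<^sup>2 * L + 1), (\<sigma> / 4) / (C * R + 1), \<tau> / ((C1 + C * (R + Ae)) + 1)}"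
  define C' where "C' = (1 + AL) * C1 + 2 * Vb + 1"
  have nn: "0 \<le> Ae * C" "0 \<le> C\<^sup>2 * L" "0 \<le> C * R" "0 \<le> C1 + C * (R + Ae)" using Ae pos L R C1 by auto
  show thesis
  proof (rule that)
    show "0 < \<epsilon>0" using p nn by (simp add: \<epsilon>0_def add_nonneg_pos)
    show "0 < C'" using AL C1 Vb by (simp add: C'_def add_pos_nonneg)
    fix K B E \<epsilon> h x0 v0 x v X V step n
    assume CB: "C_order 2 B" and CE: "C_order 2 E"
      and DB: "derivs_bounded 2 L (\<Union>y\<in>K. ball y \<delta>) B" and DE: "derivs_bounded 2 L (\<Union>y\<in>K. ball y \<delta>) E"
      and BK: "\<And>y. y \<in> K \<Longrightarrow> \<beta> \<le> norm (B y)"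
      and step: "step \<in> {S1_AVF B E \<epsilon> h, S1_SV B E \<epsilon> h, S1_VP B E \<epsilon> h}"
      and \<epsilon>: "0 < \<epsilon>" "\<epsilon> \<le> \<epsilon>0" and h: "0 < h" "h \<le> C * \<epsilon>" and v0: "norm v0 \<le> M"
      and sol: "cpd_solution B E \<epsilon> T x0 v0 x v" and xK: "\<And>t. t \<in> {0..T} \<Longrightarrow> x t \<in> K"
      and res: "\<And>t k. t \<in> {0..T} \<Longrightarrow> k \<in> {1,2::nat} \<Longrightarrow> c \<le> \<bar>sinc (real k * (h / (2 * \<epsilon>)) * norm (B (x t)))\<bar>"
      and num: "numerical_solution step h T x0 v0 X V" and nT: "real n * h \<le> T"
    have \<epsilon>s: "\<epsilon> \<le> 1" "(Ae * C) * \<epsilon> < \<sigma>" "(C\<^sup>2 * L) * \<epsilon> < 1" "(C * R) * \<epsilon> < \<sigma> / 4" "(C1 + C * (R + Ae)) * \<epsilon> < \<tau>"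
    proof -
      have "\<epsilon> \<le> r" if "r \<in> {1, \<sigma> / (Ae * C + 1), 1 / (C\<^sup>2 * L + 1), (\<sigma> / 4) / (C * R + 1), \<tau> / ((C1 + C * (R + Ae)) + 1)}" for r
        using order_trans[OF \<epsilon>(2)[unfolded \<epsilon>0_def] Min_le[OF _ that]] by simp
      note small = this small_enough[OF _ _ \<epsilon>(1) this]
      show "\<epsilon> \<le> 1" by (rule small(1)) simp
      show "(Ae * C) * \<epsilon> < \<sigma>" "(C\<^sup>2 * L) * \<epsilon> < 1" "(C * R) * \<epsilon> < \<sigma> / 4" "(C1 + C * (R + Ae)) * \<epsilon> < \<tau>"
        by (rule small(2)[OF nn(1)] small(2)[OF nn(2)] small(2)[OF nn(3)] small(2)[OF nn(4)]; use p in simp)+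
    qed
    have dB: "B differentiable (at y)" and dE: "E differentiable (at y)" for y
      using CB CE by (auto simp: numeral_2_eq_2)
    have cB: "continuous_on UNIV B" and cE: "continuous_on UNIV E"
      using dB dE by (auto simp: continuous_on_eq_continuous_at intro: differentiable_imp_continuous_within)
    have ballB: "norm (B z - B y) \<le> L * norm (z - y)" if "y \<in> K" "z \<in> ball y \<sigma>" for y z
    proof -
      have "ball y \<sigma> \<subseteq> (\<Union>y\<in>K. ball y \<delta>)" using that(1) by (auto simp: \<sigma>_def)
      from derivs_bounded_mono[OF DB this order_refl]
      have "norm (frechet_derivative B (at w) u) \<le> L" if "norm u \<le> 1" "w \<in> ball y \<sigma>" for u w
        using that by (auto simp: numeral_2_eq_2)
      from lipschitz_on_derivs_bounded(2)[OF dB _ convex_ball this] show ?thesis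
        using that p L by simp
    qed
    have reg: "regular L \<beta>' (ball y \<sigma>) B E" if y: "y \<in> K" for y
    proof (rule regularI[OF CB CE])
      have sub: "ball y \<sigma> \<subseteq> (\<Union>y\<in>K. ball y \<delta>)" using y by (auto simp: \<sigma>_def)
      show "derivs_bounded 2 L (ball y \<sigma>) B" "derivs_bounded 2 L (ball y \<sigma>) E"
        using derivs_bounded_mono[OF DB sub order_refl] derivs_bounded_mono[OF DE sub order_refl] .
      fix z assume z: "z \<in> ball y \<sigma>"
      have "norm (z - y) \<le> \<beta> / (2 * L)" using z by (simp add: \<sigma>_def dist_norm norm_minus_commute)
      then have "L * norm (z - y) \<le> \<beta> / 2" using L by (simp add: field_simps)
      with ballB[OF y z] have "norm (B z - B y) \<le> \<beta> / 2" by linarith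
      then show "\<beta>' \<le> norm (B z)"
        using BK[OF y] norm_triangle_ineq3[of "B z" "B y"] by (simp add: \<beta>'_def)
    qed (use L in auto)
    have hC: "h * (Ae + R) \<le> C * \<epsilon> * (Ae + R)" using h Ae R by (intro mult_right_mono) auto
    have Aeh: "Ae * h < \<sigma>"
    proof -
      have "Ae * h \<le> Ae * (C * \<epsilon>)" using h Ae by (intro mult_left_mono) auto
      then show ?thesis using \<epsilon>s(2) by (simp add: mult.assoc)
    qed
    have hL: "h\<^sup>2 * L \<le> 1"
    proof -
      have "h\<^sup>2 \<le> (C * \<epsilon>)\<^sup>2" using h by (intro power_mono) auto
      also have "\<dots> = C\<^sup>2 * (\<epsilon> * \<epsilon>)" by (simp add: power2_eq_square)
      also have "\<dots> \<le> C\<^sup>2 * (\<epsilon> * 1)" using \<epsilon> \<epsilon>s(1) by (intro mult_left_mono) auto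
      finally have "h\<^sup>2 * L \<le> C\<^sup>2 * \<epsilon> * L" using L by (intro mult_right_mono) auto
      then show ?thesis using \<epsilon>s(3) by (simp add: mult_ac)
    qed
    have hR: "h * R < \<sigma> / 4"
    proof -
      have "h * R \<le> C * \<epsilon> * R" using h R by (intro mult_right_mono) auto
      then show ?thesis using \<epsilon>s(4) by (simp add: mult_ac)
    qed
    define xn vn where "xn n = x (real n * h)" and "vn n = v (real n * h)" for n
    define Z where "Z n = slow_vars B (xn n) (vn n)" for n
    define Y where "Y n = slow_vars B (X n) (V n)" for n
    have xnK: "xn j \<in> K" if "real j * h \<le> T" for j using xK[of "real j * h"] that h by (simp add: xn_def)
    obtain \<phi> where vn: "\<And>n. real n * h \<le> T \<Longrightarrow> norm (vn n) \<le> M + T * (L + 1)"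
      and \<phi>: "\<And>n. real (Suc n) * h \<le> T \<Longrightarrow> norm (\<phi> n - Z n) \<le> Ae * \<epsilon> \<and> norm (\<phi> (Suc n) - Z (Suc n)) \<le> Ae * \<epsilon> \<and>
        norm (\<phi> (Suc n) - \<phi> n - h *\<^sub>R averaged B E (Z n)) \<le> Ae * (h * \<epsilon>) \<and> norm (Z (Suc n) - Z n) \<le> Ae * h"
      using exact_avg[OF cB cE \<epsilon>(1) \<epsilon>s(1) h Aeh v0 sol reg[OF xK]] unfolding Z_def xn_def vn_def by blast
    have vnV: "norm (vn j) \<le> Vb" if "real j * h \<le> T" for j
    proof -
      have "T * (L + 1) \<le> T * (3 * L + 1)" using pos L by (intro mult_left_mono) auto
      then show ?thesis using vn[OF that] by (simp add: Vb_def)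
    qed
    have x0: "X 0 = x0" "V 0 = v0" and st: "\<And>j. real (Suc j) * h \<le> T \<Longrightarrow> step (X j) (V j) (X (Suc j)) (V (Suc j))"
      using num h unfolding numerical_solution_def by (auto simp: pos_le_divide_eq)
    \<comment> \<open>Invariant of the induction. The radius \<tau> does not depend on \<epsilon>,
      while the comparison will yield C1 \<epsilon>; this gap is what closes the induction. The
      velocity bound is kept in the form that one step can propagate.\<close>
    define good where "good j \<longleftrightarrow> norm (X j - xn j) \<le> \<tau> \<and> norm (V j) \<le> M + real j * h * (3 * L)" for j
    have \<tau>\<sigma>: "\<tau> \<le> \<sigma> / 2" and \<tau>L: "L * \<tau> \<le> c * \<beta> / 4"
    proof -
      show "\<tau> \<le> \<sigma> / 2" by (simp add: \<tau>_def)
      have "L * \<tau> \<le> L * (c * \<beta> / (4 * L))" using L by (intro mult_left_mono) (auto simp: \<tau>_def)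
      also have "\<dots> = c * \<beta> / 4" using L by simp
      finally show "L * \<tau> \<le> c * \<beta> / 4" .
    qed
    have VV: "norm (V j) \<le> Vb" if "good j" "real j * h \<le> T" for j
    proof -
      have "real j * h * (3 * L) \<le> T * (3 * L)" using that L by (intro mult_right_mono) auto
      also have "\<dots> \<le> T * (3 * L + 1)" using pos by simp
      finally show ?thesis using that(1) by (simp add: good_def Vb_def)
    qed
    have XS: "X j \<in> ball (xn j) \<sigma>" if "good j" for j
      using that \<tau>\<sigma> p(2) by (auto simp: good_def dist_norm norm_minus_commute)
    have nonres: "nonresonant B \<epsilon> h \<gamma> (X j)" if g: "good j" and jT: "real j * h \<le> T" for j
      unfolding \<gamma>_def
    proof (rule nonresonant_near[where x = "xn j"])
      show "c \<le> \<bar>sinc (real k * (h / (2 * \<epsilon>)) * norm (B (xn j)))\<bar>" if "k \<in> {1, 2}" for k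
        unfolding xn_def using jT h that by (intro res) auto
      show "\<beta> \<le> norm (B (xn j))" using BK[OF xnK[OF jT]] .
      have "norm (B (X j) - B (xn j)) \<le> L * norm (X j - xn j)" using ballB[OF xnK[OF jT] XS[OF g]] .
      also have "\<dots> \<le> L * \<tau>" using g L by (intro mult_left_mono) (auto simp: good_def)
      finally show "\<bar>norm (B (X j)) - norm (B (xn j))\<bar> \<le> c * \<beta> / 4"
        using norm_triangle_ineq3[of "B (X j)" "B (xn j)"] \<tau>L by linarith
    qed (use \<epsilon> h pos in auto)
    define ex where "ex \<longleftrightarrow> step \<in> {S1_AVF B E \<epsilon> h, S1_SV B E \<epsilon> h}"
    have scheme: "norm (X (Suc j) - X j) \<le> h * R" "norm (V (Suc j)) \<le> norm (V j) + h * (3 * L)"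
      "norm (X (Suc j) - X j - h *\<^sub>R turned B \<epsilon> h (X j) (V j)) \<le> \<Lambda> * (h * \<epsilon>)"
      "norm (V (Suc j) - turned B \<epsilon> h (X j) (V j) - h *\<^sub>R forcing ex B E \<epsilon> h (X j)) \<le> \<Lambda> * (h * \<epsilon>)"
      "X (Suc j) \<in> ball (xn j) \<sigma>"
      if g: "good j" and jT: "real (Suc j) * h \<le> T" for j
    proof -
      have jT': "real j * h \<le> T" using jT h by (simp add: algebra_simps)
      have sub: "z \<in> ball (xn j) \<sigma>" if "norm (z - X j) \<le> h * R" for z
      proof -
        have "norm (z - xn j) \<le> norm (z - X j) + norm (X j - xn j)"
          using norm_triangle_ineq[of "z - X j" "X j - xn j"] by simp
        then have "norm (z - xn j) < \<sigma>" using that g hR \<tau>\<sigma> p(2) unfolding good_def by linarith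
        then show ?thesis by (simp add: dist_norm norm_minus_commute)
      qed
      have "cball (X j) (h * (Vb + 3 * C * L)) \<subseteq> ball (xn j) \<sigma>"
        using sub unfolding R_def by (auto simp: dist_norm norm_minus_commute)
      note s = scheme_consistent[OF reg[OF xnK[OF jT']] p(1) _ cE \<epsilon>(1) \<epsilon>s(1) h hL VV[OF g jT'] this step st[OF jT] ex_def]
      show "norm (X (Suc j) - X j) \<le> h * R" "norm (V (Suc j)) \<le> norm (V j) + h * (3 * L)"
        "norm (X (Suc j) - X j - h *\<^sub>R turned B \<epsilon> h (X j) (V j)) \<le> \<Lambda> * (h * \<epsilon>)"
        "norm (V (Suc j) - turned B \<epsilon> h (X j) (V j) - h *\<^sub>R forcing ex B E \<epsilon> h (X j)) \<le> \<Lambda> * (h * \<epsilon>)"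
        using s L unfolding R_def \<Lambda>_def by simp_all
      then show "X (Suc j) \<in> ball (xn j) \<sigma>" by (intro sub)
    qed
    have sn: "norm (snd (Y j)) \<le> Vb + Vb\<^sup>2" if "good j" "real j * h \<le> T" for j
      unfolding Y_def using regularD(3)[OF reg[OF xnK[OF that(2)]] XS[OF that(1)] p(1)]
      by (intro norm_snd_slow_vars[of B "X j"] VV[OF that])
    have xx: "xn j \<in> ball (xn j) \<sigma>" for j using p(2) by simp
    have snZ: "norm (snd (Z j)) \<le> Vb + Vb\<^sup>2" if "real j * h \<le> T" for j
      unfolding Z_def using regularD(3)[OF reg[OF xnK[OF that]] xx p(1)]
      by (intro norm_snd_slow_vars[of B "xn j"] vnV[OF that])
    have lip: "norm (averaged B E (Y j) - averaged B E (Z j)) \<le> AL * norm (Y j - Z j)" if "good j" "real j * h \<le> T" for j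
      by (rule AL(2)[OF reg[OF xnK[OF that(2)]] _ _ snZ[OF that(2)] sn[OF that]])
         (use XS[OF that(1)] p(2) in \<open>auto simp: Y_def Z_def slow_vars_def\<close>)
    define f where "f j = Y j - correctors ex B E \<epsilon> h (X j) (V j)" for j
    \<comment> \<open>The invariant is required up to N itself, because the corrector of the last
      step is also evaluated at its end, where non-resonance must hold.\<close>
    have cmp: "norm (Y N - Z N) \<le> C1 * \<epsilon>" if g: "\<And>j. j \<le> N \<Longrightarrow> good j" and NT: "real N * h \<le> T" for N
      unfolding C1_def
    proof (rule averaged_comparison[where f = f and g = \<phi> and G = "averaged B E" and h = h])
      fix j assume j: "j < N"
      have "real (Suc j) * h \<le> real N * h" using j h by (intro mult_right_mono) auto
      then have jT: "real (Suc j) * h \<le> T" using NT by linarith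
      have jT': "real j * h \<le> T" using jT h by (simp add: algebra_simps)
      have gj: "good j" "good (Suc j)" using j by (auto intro: g)
      have "split_step L \<beta>' Vb C \<gamma> \<Lambda> ex B E (ball (xn j) \<sigma>) \<epsilon> h (X j) (V j) (X (Suc j)) (V (Suc j))"
        unfolding split_step_def
        using reg[OF xnK[OF jT']] XS[OF gj(1)] scheme[OF gj(1) jT] \<epsilon> \<epsilon>s(1) h VV[OF gj(1) jT']
          nonres[OF gj(1) jT'] nonres[OF gj(2) jT] by blast
      from An(2)[OF this, folded Y_def, folded f_def]
      have s: "norm (f (Suc j) - f j - h *\<^sub>R averaged B E (Y j)) \<le> An * (h * \<epsilon>)"
        "norm (f j - Y j) \<le> An * \<epsilon>" "norm (f (Suc j) - Y (Suc j)) \<le> An * \<epsilon>"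
        by (auto simp: f_def)
      have m: "Ae * \<epsilon> \<le> a * \<epsilon>" "An * \<epsilon> \<le> a * \<epsilon>" "Ae * (h * \<epsilon>) \<le> a * (h * \<epsilon>)" "An * (h * \<epsilon>) \<le> a * (h * \<epsilon>)"
        using a \<epsilon> h by (auto intro!: mult_right_mono)
      show "norm (f j - Y j) \<le> a * \<epsilon>" "norm (f (Suc j) - Y (Suc j)) \<le> a * \<epsilon>"
        "norm (f (Suc j) - f j - h *\<^sub>R averaged B E (Y j)) \<le> a * (h * \<epsilon>)"
        using s m by linarith+
      show "norm (\<phi> j - Z j) \<le> a * \<epsilon>" "norm (\<phi> (Suc j) - Z (Suc j)) \<le> a * \<epsilon>"
        "norm (\<phi> (Suc j) - \<phi> j - h *\<^sub>R averaged B E (Z j)) \<le> a * (h * \<epsilon>)"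
        using \<phi>[OF jT] m by linarith+
      show "norm (averaged B E (Y j) - averaged B E (Z j)) \<le> AL * norm (Y j - Z j)"
        by (rule lip[OF gj(1) jT'])
    next
      show "Y 0 = Z 0" using x0 sol by (simp add: Y_def Z_def xn_def vn_def cpd_solution_def)
    qed (use a AL \<epsilon> h pos NT in auto)
    have YX: "norm (X j - xn j) \<le> norm (Y j - Z j)" for j
      using norm_fst_le'[of "Y j - Z j"] by (simp add: Y_def Z_def slow_vars_def)
    \<comment> \<open>The comparison at N + 1 would already need the invariant there. Instead the
      error C1 \<epsilon> at N is increased by the crude lengths h R and Ae h of one numerical and
      one exact step.\<close>
    have all_good: "\<forall>j\<le>N. good j" if "real N * h \<le> T" for N
      using that
    proof (induction N)
      case 0
      show ?case using x0 sol v0 p by (simp add: good_def xn_def cpd_solution_def)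
    next
      case (Suc N)
      have NT: "real N * h \<le> T" using Suc.prems h by (simp add: algebra_simps)
      have g: "\<And>j. j \<le> N \<Longrightarrow> good j" using Suc.IH[OF NT] by blast
      note s = scheme[OF g[OF order_refl] Suc.prems]
      have "norm (X N - xn N) \<le> C1 * \<epsilon>" using YX[of N] cmp[OF g NT] by linarith
      moreover have "norm (xn (Suc N) - xn N) \<le> Ae * h"
        using norm_fst_le'[of "Z (Suc N) - Z N"] \<phi>[OF Suc.prems] by (simp add: Z_def slow_vars_def)
      moreover have "norm (X (Suc N) - xn (Suc N)) \<le> norm (X (Suc N) - X N) + norm (X N - xn N) + norm (xn (Suc N) - xn N)"
        using norm_triangle_ineq4[of "(X (Suc N) - X N) + (X N - xn N)" "xn (Suc N) - xn N"]
          norm_triangle_ineq[of "X (Suc N) - X N" "X N - xn N"] by simp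
      ultimately have "norm (X (Suc N) - xn (Suc N)) \<le> h * R + C1 * \<epsilon> + Ae * h" using s(1) by linarith
      also have "\<dots> = C1 * \<epsilon> + h * (Ae + R)" by (simp add: algebra_simps)
      also have "\<dots> \<le> (C1 + C * (R + Ae)) * \<epsilon>" using hC by (simp add: algebra_simps)
      finally have "norm (X (Suc N) - xn (Suc N)) \<le> \<tau>" using \<epsilon>s(5) by linarith
      moreover have "norm (V (Suc N)) \<le> M + real (Suc N) * h * (3 * L)"
        using s(2) g[OF order_refl] unfolding good_def by (simp add: algebra_simps)
      ultimately have "good (Suc N)" by (simp add: good_def)
      then show ?case using g le_Suc_eq by auto
    qed
    have gn: "good n" and cn: "norm (Y n - Z n) \<le> C1 * \<epsilon>" using all_good[OF nT] cmp[OF _ nT] by auto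
    have c1: "C1 \<le> C'" "AL * C1 \<le> C'"
      using AL C1 Vb mult_pos_pos[of AL C1] by (auto simp: C'_def distrib_right)
    have "norm (X n - xn n) \<le> C' * \<epsilon>"
      using YX[of n] cn mult_right_mono[OF c1(1), of \<epsilon>] \<epsilon> by linarith
    moreover have "norm (parallel_part B (X n) (V n) - parallel_part B (xn n) (vn n)) \<le> C' * \<epsilon>"
    proof -
      have "norm (parallel_part B (X n) (V n) - parallel_part B (xn n) (vn n)) \<le> norm (averaged B E (Y n) - averaged B E (Z n))"
        using norm_fst_le'[of "averaged B E (Y n) - averaged B E (Z n)"] by (simp add: parallel_part_conv[of B _ _ E] Y_def Z_def)
      also have "\<dots> \<le> AL * (C1 * \<epsilon>)"
        by (rule order_trans[OF lip[OF gn nT] mult_left_mono[OF cn]]) (use AL in auto)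
      also have "\<dots> \<le> C' * \<epsilon>" using mult_right_mono[OF c1(2), of \<epsilon>] \<epsilon> by (simp add: mult.assoc)
      finally show ?thesis .
    qed
    moreover have "norm (V n - vn n) \<le> C'"
    proof -
      have "0 \<le> (1 + AL) * C1" using AL C1 by simp
      then show ?thesis
        using norm_triangle_ineq4[of "V n" "vn n"] VV[OF gn nT] vnV[OF nT] unfolding C'_def by linarith
    qed
    ultimately show "norm (X n - x (real n * h)) \<le> C' * \<epsilon> \<and>
      norm (parallel_part B (X n) (V n) - parallel_part B (x (real n * h)) (v (real n * h))) \<le> C' * \<epsilon> \<and>
      norm (V n - v (real n * h)) \<le> C'"
      unfolding xn_def vn_def by blast
  qed
qed

text \<open>Sufficient smoothness is expressed by an order N fixed before all other data; N = 2
  works because a Lipschitz derivative of B controls both the Taylor remainder of b and the trace in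
  the averaged field. Derivatives are bounded on a \<delta>-neighbourhood of K, since the numerical
  positions need not lie in K.\<close>

theorem theorem4p1:
  shows "\<exists>N::nat. \<forall>(M::real) (K::(real^3) set) (C::real) (c::real) (T::real)
             (\<delta>::real) (L::real) (\<beta>::real).
     bounded K \<and> 0 < C \<and> 0 < c \<and> 0 < T \<and> 0 < \<delta> \<and> 0 < \<beta> \<longrightarrow>
     (\<exists>\<epsilon>0>0. \<exists>C'>0.
       \<forall>(B::real^3 \<Rightarrow> real^3) (E::real^3 \<Rightarrow> real^3) (U::real^3 \<Rightarrow> real).
         C_order N B \<and> C_order N E \<and> (\<forall>y. GDERIV U y :> - E y) \<and>
         derivs_bounded N L (\<Union>y\<in>K. ball y \<delta>) B \<and>
         derivs_bounded N L (\<Union>y\<in>K. ball y \<delta>) E \<and>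
         (\<forall>y\<in>K. \<beta> \<le> norm (B y)) \<longrightarrow>
         (\<forall>(\<epsilon>::real) (h::real) (x0::real^3) (v0::real^3)
            (x::real \<Rightarrow> real^3) (v::real \<Rightarrow> real^3) (X::nat \<Rightarrow> real^3) (V::nat \<Rightarrow> real^3).
            \<forall>step \<in> {S1_AVF B E \<epsilon> h, S1_SV B E \<epsilon> h, S1_VP B E \<epsilon> h}.
              0 < \<epsilon> \<and> \<epsilon> \<le> \<epsilon>0 \<and> 0 < h \<and> h \<le> C * \<epsilon> \<and>
              norm x0 \<le> M \<and> norm v0 \<le> M \<and>
              cpd_solution B E \<epsilon> T x0 v0 x v \<and>
              (\<forall>t\<in>{0..T}. x t \<in> K) \<and>
              (\<forall>t\<in>{0..T}. \<forall>k\<in>{1,2::nat}.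
                 c \<le> \<bar>sinc (real k * (h / (2 * \<epsilon>)) * norm (B (x t)))\<bar>) \<and>
              numerical_solution step h T x0 v0 X V \<longrightarrow>
              (\<forall>n::nat. real n \<le> T / h \<longrightarrow>
                 norm (X n - x (real n * h)) \<le> C' * \<epsilon> \<and>
                 norm (parallel_part B (X n) (V n)
                       - parallel_part B (x (real n * h)) (v (real n * h))) \<le> C' * \<epsilon> \<and>
                 norm (V n - v (real n * h)) \<le> C')))"
proof (intro exI[of _ "2::nat"] allI impI, goal_cases)
  case (1 M K C c T \<delta> L \<beta>)
  \<comment> \<open>M and L are arbitrary reals here; enlarging them to \<open>max M 0\<close> and
    \<open>max L 1\<close> weakens the bounds and supplies the inequalities that the estimates
    use.\<close>
  then have "0 < C" "0 < c" "0 < T" "0 < \<delta>" "0 < \<beta>" "0 \<le> max M 0" "1 \<le> max L 1" by auto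
  then show ?case
  proof (rule error_bounds, goal_cases)
    case (1 \<epsilon>0 C')
    note pos = 1(1,2) and bound = 1(3)
    show ?case
    proof (rule exI[of _ \<epsilon>0], rule conjI[OF pos(1)], rule exI[of _ C'], rule conjI[OF pos(2)], intro allI ballI impI)
      fix B E U \<epsilon> h x0 v0 x v X V step n
      assume BE: "C_order 2 B \<and> C_order 2 E \<and> (\<forall>y. GDERIV U y :> - E y) \<and>
           derivs_bounded 2 L (\<Union>y\<in>K. ball y \<delta>) B \<and>
           derivs_bounded 2 L (\<Union>y\<in>K. ball y \<delta>) E \<and> (\<forall>y\<in>K. \<beta> \<le> norm (B y))"
        and step: "step \<in> {S1_AVF B E \<epsilon> h, S1_SV B E \<epsilon> h, S1_VP B E \<epsilon> h}"
        and h: "0 < \<epsilon> \<and> \<epsilon> \<le> \<epsilon>0 \<and> 0 < h \<and> h \<le> C * \<epsilon> \<and>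
                norm x0 \<le> M \<and> norm v0 \<le> M \<and>
                cpd_solution B E \<epsilon> T x0 v0 x v \<and>
                (\<forall>t\<in>{0..T}. x t \<in> K) \<and>
                (\<forall>t\<in>{0..T}. \<forall>k\<in>{1,2::nat}.
                   c \<le> \<bar>sinc (real k * (h / (2 * \<epsilon>)) * norm (B (x t)))\<bar>) \<and>
                numerical_solution step h T x0 v0 X V"
        and n: "real n \<le> T / h"
      have db: "derivs_bounded 2 (max L 1) (\<Union>y\<in>K. ball y \<delta>) B" "derivs_bounded 2 (max L 1) (\<Union>y\<in>K. ball y \<delta>) E"
        using BE by (auto intro: derivs_bounded_mono[OF _ order_refl max.cobounded1])
      have "0 < h" using h by blast
      then have nT: "real n * h \<le> T" using n by (simp add: pos_le_divide_eq)
      have "norm v0 \<le> M" using h by blast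
      then have v0: "norm v0 \<le> max M 0" by simp
      show "norm (X n - x (real n * h)) \<le> C' * \<epsilon> \<and>
            norm (parallel_part B (X n) (V n) - parallel_part B (x (real n * h)) (v (real n * h))) \<le> C' * \<epsilon> \<and>
            norm (V n - v (real n * h)) \<le> C'"
        using BE h by (intro bound[OF _ _ db _ step _ _ _ _ v0 _ _ _ _ nT]) blast+
    qed
  qed
qed

end
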